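(* The system $Y'=(\mathrm{PFO},\to_{\{S\downarrow,M\}})/\stackrel{*}{\leftrightarrow}_{\mathcal{T}}$ is convergent.
   Context: All formulas are relational first-order formulas; $\wedge,\vee$ are binary. A pfo-formula is a first-order formula with no negation; $\mathrm{PFO}$ is the class of all pfo-formulas; $\mathrm{free}(\psi)$ is the set of free variables of $\psi$. Rewriting rules (applicable to any subformula occurrence; $\oplus\in\{\wedge,\vee\}$, $Q\in\{\exists,\forall\}$): $A$: $F_1\oplus(F_2\oplus F_3)\to(F_1\oplus F_2)\oplus F_3$ and its converse; $C$: $F_1\oplus F_2\to F_2\oplus F_1$; $O$: $QxQyF\to QyQxF$; $P\!\downarrow$: $\exists x(F_1\wedge F_2)\to(\exists xF_1)\wedge F_2$ and $\forall x(F_1\vee F_2)\to(\forall xF_1)\vee F_2$ whenever $x\notin\mathrm{free}(F_2)$; $P\!\uparrow$: inverse of $P\!\downarrow$; $N$: $QxF\to QyF'$ when $y\notin\mathrm{free}(F)$ and $F'$ arises from $F$ by replacing each free occurrence of $x$ by $y$; $S\!\downarrow$: $\exists x(F_1\vee F_2)\to(\exists xF_1)\vee(\exists xF_2)$ and $\forall x(F_1\wedge F_2)\to(\forall xF_1)\wedge(\forall xF_2)$; $M$: $QxF\to F$ when $x\notin\mathrm{free}(F)$. $\mathcal{T}=\{A,C,O,P\!\downarrow,P\!\uparrow,N\}$. For a set $\mathcal{R}$ of rules, $\to_{\mathcal{R}}$ is the union of the $\to_R$; $\stackrel{*}{\leftrightarrow}_{\mathcal{R}}$ is the reflexive-transitive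 closure of $\to_{\mathcal{R}}$ together with its inverse. A system is a pair $(D,\to)$ of a set and a binary relation; $\stackrel{*}{\to}$ is the reflexive-transitive closure of $\to$. It is confluent if $d\stackrel{*}{\to}e$ and $d\stackrel{*}{\to}e'$ imply there is $f$ with $e\stackrel{*}{\to}f$ and $e'\stackrel{*}{\to}f$; terminating if there is no infinite chain $d_0\to d_1\to\cdots$; convergent if confluent and terminating. For an equivalence relation $\equiv$ on $D$, $(D,\to)/\equiv$ is the system whose elements are the $\equiv$-classes, with $C\to C'$ iff there exist $d\in C$, $d'\in C'$ with $d\to d'$.
   Formalization: Rule N is read as capture-avoiding: QxF→QyF' also requires that no occurrence of y put in for x falls under a quantifier of F binding y; with capture allowed, confluence fails, e.g. for ∀y(∃xS(x)∨(R(y)∧∀uU(u))). *)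

theory Defs
  imports "HOL-Library.Infinite_Typeclass"
begin

section \<open>Relational first-order formulas\<close>

datatype bop = Conj | Disj

datatype quant = Exists | Forall

text \<open>Equality atoms, if wanted, are atoms of a binary relation symbol: everything below is
  purely syntactic.\<close>

datatype ('r, 'v) fm =
    Atom 'r "'v list"
  | Neg "('r, 'v) fm"
  | Bin bop "('r, 'v) fm" "('r, 'v) fm"
  | Quant quant 'v "('r, 'v) fm"

fun free :: "('r, 'v) fm \<Rightarrow> 'v set" where
  "free (Atom R vs) = set vs"
| "free (Neg F) = free F"
| "free (Bin b F G) = free F \<union> free G"
| "free (Quant Q x F) = free F - {x}"

text \<open>Well-formedness over a signature, given by the arities of the relation symbols.\<close>

fun wf_fm :: "('r \<Rightarrow> nat) \<Rightarrow> ('r, 'v) fm \<Rightarrow> bool" where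
  "wf_fm ar (Atom R vs) \<longleftrightarrow> length vs = ar R"
| "wf_fm ar (Neg F) \<longleftrightarrow> wf_fm ar F"
| "wf_fm ar (Bin b F G) \<longleftrightarrow> wf_fm ar F \<and> wf_fm ar G"
| "wf_fm ar (Quant Q x F) \<longleftrightarrow> wf_fm ar F"

fun neg_free :: "('r, 'v) fm \<Rightarrow> bool" where
  "neg_free (Atom R vs) \<longleftrightarrow> True"
| "neg_free (Neg F) \<longleftrightarrow> False"
| "neg_free (Bin b F G) \<longleftrightarrow> neg_free F \<and> neg_free G"
| "neg_free (Quant Q x F) \<longleftrightarrow> neg_free F"

definition PFO :: "('r \<Rightarrow> nat) \<Rightarrow> ('r, 'v) fm set" where
  "PFO ar = {F. wf_fm ar F \<and> neg_free F}"

text \<open>\<open>replace x y F\<close> replaces each free occurrence of \<open>x\<close> in \<open>F\<close> by \<open>y\<close>, literally, that is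
  without renaming bound variables; \<open>free_for y x F\<close> says that no occurrence of \<open>y\<close> introduced
  in this way is captured by a quantifier of \<open>F\<close>.\<close>

fun replace :: "'v \<Rightarrow> 'v \<Rightarrow> ('r, 'v) fm \<Rightarrow> ('r, 'v) fm" where
  "replace x y (Atom R vs) = Atom R (map (\<lambda>v. if v = x then y else v) vs)"
| "replace x y (Neg F) = Neg (replace x y F)"
| "replace x y (Bin b F G) = Bin b (replace x y F) (replace x y G)"
| "replace x y (Quant Q z F) = (if z = x then Quant Q z F else Quant Q z (replace x y F))"

fun free_for :: "'v \<Rightarrow> 'v \<Rightarrow> ('r, 'v) fm \<Rightarrow> bool" where
  "free_for y x (Atom R vs) \<longleftrightarrow> True"
| "free_for y x (Neg F) \<longleftrightarrow> free_for y x F"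
| "free_for y x (Bin b F G) \<longleftrightarrow> free_for y x F \<and> free_for y x G"
| "free_for y x (Quant Q z F) \<longleftrightarrow> x \<notin> free (Quant Q z F) \<or> (z \<noteq> y \<and> free_for y x F)"


section \<open>Rewriting rules\<close>

datatype rule = rule_A | rule_C | rule_O | rule_Pdown | rule_Pup | rule_N | rule_Sdown | rule_M

text \<open>In rule N the side condition \<open>free_for\<close> is the usual convention that renaming a bound
  variable is capture-avoiding. If capture were allowed, N would not preserve logical equivalence
  (\<open>\<exists>x. \<forall>y. R x y\<close> would become \<open>\<exists>y. \<forall>y. R y y\<close>).\<close>

inductive root_step :: "rule \<Rightarrow> ('r, 'v) fm \<Rightarrow> ('r, 'v) fm \<Rightarrow> bool" where
  A_left: "root_step rule_A (Bin b F1 (Bin b F2 F3)) (Bin b (Bin b F1 F2) F3)"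
| A_right: "root_step rule_A (Bin b (Bin b F1 F2) F3) (Bin b F1 (Bin b F2 F3))"
| C: "root_step rule_C (Bin b F1 F2) (Bin b F2 F1)"
| O: "root_step rule_O (Quant Q x (Quant Q y F)) (Quant Q y (Quant Q x F))"
| Pdown_Exists: "x \<notin> free F2 \<Longrightarrow>
    root_step rule_Pdown (Quant Exists x (Bin Conj F1 F2)) (Bin Conj (Quant Exists x F1) F2)"
| Pdown_Forall: "x \<notin> free F2 \<Longrightarrow>
    root_step rule_Pdown (Quant Forall x (Bin Disj F1 F2)) (Bin Disj (Quant Forall x F1) F2)"
| Pup: "root_step rule_Pdown F G \<Longrightarrow> root_step rule_Pup G F"
| N: "y \<notin> free F \<Longrightarrow> free_for y x F \<Longrightarrow>
    root_step rule_N (Quant Q x F) (Quant Q y (replace x y F))"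
| Sdown_Exists: "root_step rule_Sdown (Quant Exists x (Bin Disj F1 F2))
    (Bin Disj (Quant Exists x F1) (Quant Exists x F2))"
| Sdown_Forall: "root_step rule_Sdown (Quant Forall x (Bin Conj F1 F2))
    (Bin Conj (Quant Forall x F1) (Quant Forall x F2))"
| M: "x \<notin> free F \<Longrightarrow> root_step rule_M (Quant Q x F) F"

inductive rewrite :: "rule set \<Rightarrow> ('r, 'v) fm \<Rightarrow> ('r, 'v) fm \<Rightarrow> bool" for \<R> where
  root: "r \<in> \<R> \<Longrightarrow> root_step r F G \<Longrightarrow> rewrite \<R> F G"
| in_Neg: "rewrite \<R> F G \<Longrightarrow> rewrite \<R> (Neg F) (Neg G)"
| in_Bin_left: "rewrite \<R> F G \<Longrightarrow> rewrite \<R> (Bin b F H) (Bin b G H)"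
| in_Bin_right: "rewrite \<R> F G \<Longrightarrow> rewrite \<R> (Bin b H F) (Bin b H G)"
| in_Quant: "rewrite \<R> F G \<Longrightarrow> rewrite \<R> (Quant Q x F) (Quant Q x G)"

definition rules_T :: "rule set" where
  "rules_T = {rule_A, rule_C, rule_O, rule_Pdown, rule_Pup, rule_N}"


section \<open>Systems\<close>

text \<open>A system \<open>(D, r)\<close> is a carrier set with a relation; all systems built below satisfy
  \<open>r \<subseteq> D \<times> D\<close>.\<close>

type_synonym 'a system = "'a set \<times> ('a \<times> 'a) set"

definition confluent_system :: "'a system \<Rightarrow> bool" where
  "confluent_system = (\<lambda>(D, r). \<forall>d\<in>D. \<forall>e\<in>D. \<forall>e'\<in>D. (d, e) \<in> r\<^sup>* \<longrightarrow> (d, e') \<in> r\<^sup>* \<longrightarrow>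
     (\<exists>f\<in>D. (e, f) \<in> r\<^sup>* \<and> (e', f) \<in> r\<^sup>*))"

definition terminating_system :: "'a system \<Rightarrow> bool" where
  "terminating_system = (\<lambda>(D, r).
     \<not> (\<exists>d :: nat \<Rightarrow> 'a. \<forall>i. d i \<in> D \<and> (d i, d (Suc i)) \<in> r))"

definition convergent_system :: "'a system \<Rightarrow> bool" where
  "convergent_system S \<longleftrightarrow> confluent_system S \<and> terminating_system S"

definition quotient_system :: "'a system \<Rightarrow> ('a \<times> 'a) set \<Rightarrow> 'a set system" where
  "quotient_system = (\<lambda>(D, r) E. (D // E,
     {(C, C'). C \<in> D // E \<and> C' \<in> D // E \<and> (\<exists>d\<in>C. \<exists>d'\<in>C'. (d, d') \<in> r)}))"

definition PFO_rel :: "('r \<Rightarrow> nat) \<Rightarrow> rule set \<Rightarrow> (('r, 'v) fm \<times> ('r, 'v) fm) set" where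
  "PFO_rel ar \<R> = {(F, G). F \<in> PFO ar \<and> G \<in> PFO ar \<and> rewrite \<R> F G}"

definition PFO_system :: "('r \<Rightarrow> nat) \<Rightarrow> rule set \<Rightarrow> ('r, 'v) fm system" where
  "PFO_system ar \<R> = (PFO ar, PFO_rel ar \<R>)"

text \<open>Intersecting with \<open>PFO ar \<times> PFO ar\<close> only discards the pairs \<open>(F, F)\<close> with \<open>F\<close> outside
  \<open>PFO ar\<close>.\<close>

definition PFO_equiv :: "('r \<Rightarrow> nat) \<Rightarrow> rule set \<Rightarrow> (('r, 'v) fm \<times> ('r, 'v) fm) set" where
  "PFO_equiv ar \<R> = (PFO_rel ar \<R> \<union> (PFO_rel ar \<R>)\<inverse>)\<^sup>* \<inter> (PFO ar \<times> PFO ar)"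

lemma equiv_PFO_equiv: "equiv (PFO ar) (PFO_equiv ar \<R>)"
proof (rule equivI)
  show "PFO_equiv ar \<R> \<subseteq> PFO ar \<times> PFO ar"
    by (auto simp: PFO_equiv_def)
  show "refl_on (PFO ar) (PFO_equiv ar \<R>)"
    by (auto simp: PFO_equiv_def refl_on_def)
  have "sym ((PFO_rel ar \<R> \<union> (PFO_rel ar \<R>)\<inverse>)\<^sup>*)"
    by (intro sym_rtrancl sym_Un_converse)
  then show "sym (PFO_equiv ar \<R>)"
    by (auto simp: PFO_equiv_def sym_def)
  show "trans (PFO_equiv ar \<R>)"
    unfolding PFO_equiv_def trans_def by (blast intro: rtrancl_trans)
qed

lemma PFO_replace_iff: "replace x y F \<in> PFO ar \<longleftrightarrow> F \<in> PFO ar"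
  by (induction F) (auto simp: PFO_def)

lemma root_step_PFO_iff: "root_step r F G \<Longrightarrow> F \<in> PFO ar \<longleftrightarrow> G \<in> PFO ar"
proof (induction rule: root_step.induct)
  case (N y F x Q)
  then show ?case
    using PFO_replace_iff[of x y F ar] by (auto simp: PFO_def)
qed (auto simp: PFO_def)

text \<open>Rewriting neither leaves nor enters \<open>PFO ar\<close>, so the restriction to \<open>PFO ar\<close> in
  \<open>PFO_rel\<close> cuts off no rewriting step of a pfo-formula.\<close>

lemma rewrite_PFO_iff: "rewrite \<R> F G \<Longrightarrow> F \<in> PFO ar \<longleftrightarrow> G \<in> PFO ar"
proof (induction rule: rewrite.induct)
  case (root r F G)
  then show ?case by (simp add: root_step_PFO_iff)
qed (auto simp: PFO_def)

end

theory Submission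
  imports Defs "HOL-Library.FSet" "HOL-Library.Multiset"
begin

text \<open>
  None of the rules changes the atoms or the connective at which two atoms meet; they only move, split
  and delete quantifiers. Confluence: annotate the atoms so that they become pairwise distinct. Modulo
  T such a formula is a tree of alternating blocks (\<open>\<exists>\<and>\<close> and \<open>\<forall>\<or>\<close>), each consisting of a set of
  quantifiers and a set of subtrees. Evaluating a formula bottom-up, pushing every quantifier inwards
  as far as S and M allow, yields a tree that is invariant under all rules. The main point is that
  pushing two quantifiers of the same kind commutes. Every formula rewrites, modulo T, to the formula
  read back from its tree, which therefore is a common reduct of any two reducts.

  Termination: weigh first the quantifiers that bind something, by the atoms still to be expelled from
  their scopes and the copies still to be made; this is unchanged by M and never increased by S. Then
  weigh the vacuous quantifiers.
\<close>

section \<open>Block trees\<close>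

text \<open>The obstacle is that a block of the other kind need not fall apart into its arguments.
  In \<open>\<exists>x. \<forall>y. (R x y \<or> S x y)\<close> the inner quantifier ties the two
  disjuncts together and blocks S, whereas
  \<open>\<exists>x. ((\<forall>y. R x y) \<or> S x)\<close> does split. A quantifier is therefore
  distributed over the connected components of the opposite block, two arguments being adjacent when
  one binder meets both. Quantifiers of one kind do not disturb each other because whether and where
  a quantifier splits is decided by the atom sets of the arguments and by binders of the other kind,
  and pushing changes neither. Distinct atoms turn all this into a matter of sets: disjoint nonempty
  atom sets identify the arguments of a block, so no two can merge. The annotation is harmless,
  since no rule compares atoms and every step can be repeated on the annotated formula. Names of
  bound variables are a function of the binders, so that any two reducts reach literally the same
  formula, not merely formulas equal modulo T.\<close>

fun dual :: "bop \<Rightarrow> bop" where "dual Conj = Disj" | "dual Disj = Conj"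

lemma dual_dual [simp]: "dual (dual b) = b" by (cases b) auto
lemma dual_neq [simp]: "dual b \<noteq> b" "b \<noteq> dual b" by (cases b; simp)+

text \<open>A binder is the set of the argument positions \<open>(r, i)\<close> it binds, so that bound names, and with
  them rule N, disappear. The arguments of a \<open>Conj\<close>-block are its \<open>\<and>\<close>-operands and its binders are
  existential; dually for \<open>Disj\<close>. Identifying a position by its relation symbol presupposes that no
  symbol occurs twice; sets then suffice where in general multisets would be needed.\<close>

datatype 'r bt = Leaf 'r | Blk bop "('r \<times> nat) set fset" "'r bt fset"

primrec leaves :: "'r bt \<Rightarrow> 'r set" where
  "leaves (Leaf r) = {r}"
| "leaves (Blk b V C) = \<Union> (fset (leaves |`| C))"

primrec binders :: "'r bt \<Rightarrow> ('r \<times> nat) set set" where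
  "binders (Leaf r) = {}"
| "binders (Blk b V C) = fset V \<union> \<Union> (fset (binders |`| C))"

fun is_block :: "bop \<Rightarrow> 'r bt \<Rightarrow> bool" where
  "is_block b (Leaf r) \<longleftrightarrow> False"
| "is_block b (Blk b' V C) \<longleftrightarrow> b' = b"

fun block_binders :: "bop \<Rightarrow> 'r bt \<Rightarrow> ('r \<times> nat) set set" where
  "block_binders b (Leaf r) = {}"
| "block_binders b (Blk b' V C) = (if b' = b then fset V else {})"

fun block_args :: "bop \<Rightarrow> 'r bt \<Rightarrow> 'r bt set" where
  "block_args b (Leaf r) = {Leaf r}"
| "block_args b (Blk b' V C) = (if b' = b then fset C else {Blk b' V C})"

text \<open>Every tree can be viewed as a \<open>b\<close>-block, for either \<open>b\<close>: a tree that is not one is the block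
  with no binder and itself as the only argument.\<close>

definition mk_block :: "bop \<Rightarrow> ('r \<times> nat) set set \<Rightarrow> 'r bt set \<Rightarrow> 'r bt" where
  "mk_block b V C = (if V = {} \<and> is_singleton C then the_elem C else Blk b (Abs_fset V) (Abs_fset C))"

definition meets :: "('r \<times> nat) set \<Rightarrow> 'r bt \<Rightarrow> bool" where
  "meets X n \<longleftrightarrow> fst ` X \<inter> leaves n \<noteq> {}"

definition restrict_to :: "('r \<times> nat) set \<Rightarrow> 'r bt \<Rightarrow> ('r \<times> nat) set" where
  "restrict_to X n = {p \<in> X. fst p \<in> leaves n}"

text \<open>Nonempty binders rule out vacuous quantifiers, and the second clause rules out blocks
  that merely wrap one argument. Together with the alternation of kinds this makes a tree determined
  by either of its views. The disjointness clauses say that an argument position is bound at most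
  once.\<close>

inductive wf_bt :: "'r bt \<Rightarrow> bool" where
  "wf_bt (Leaf r)"
| "fset C \<noteq> {} \<Longrightarrow> fset V \<noteq> {} \<or> \<not> is_singleton (fset C) \<Longrightarrow>
   \<forall>c\<in>fset C. wf_bt c \<and> \<not> is_block b c \<Longrightarrow>
   \<forall>c\<in>fset C. \<forall>c'\<in>fset C. c \<noteq> c' \<longrightarrow> leaves c \<inter> leaves c' = {} \<Longrightarrow>
   \<forall>X\<in>fset V. X \<noteq> {} \<and> fst ` X \<subseteq> \<Union> (leaves ` fset C) \<Longrightarrow>
   \<forall>X\<in>fset V. \<forall>Y\<in>fset V. X \<noteq> Y \<longrightarrow> X \<inter> Y = {} \<Longrightarrow>
   \<forall>X\<in>fset V. \<forall>c\<in>fset C. \<forall>Y\<in>binders c. X \<inter> Y = {} \<Longrightarrow>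
   wf_bt (Blk b V C)"

text \<open>The conditions on the contents of a block, but with the wrapper of a single argument
  allowed: this is the view of a tree that is not a \<open>b\<close>-block.\<close>

definition wf_view :: "bop \<Rightarrow> ('r \<times> nat) set set \<Rightarrow> 'r bt set \<Rightarrow> bool" where
  "wf_view b V C \<longleftrightarrow> finite V \<and> finite C \<and> C \<noteq> {} \<and>
   (\<forall>c\<in>C. wf_bt c \<and> \<not> is_block b c) \<and>
   (\<forall>c\<in>C. \<forall>c'\<in>C. c \<noteq> c' \<longrightarrow> leaves c \<inter> leaves c' = {}) \<and>
   (\<forall>X\<in>V. X \<noteq> {} \<and> fst ` X \<subseteq> \<Union> (leaves ` C)) \<and>
   (\<forall>X\<in>V. \<forall>Y\<in>V. X \<noteq> Y \<longrightarrow> X \<inter> Y = {}) \<and>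
   (\<forall>X\<in>V. \<forall>c\<in>C. \<forall>Y\<in>binders c. X \<inter> Y = {})"

lemma wf_viewD:
  assumes "wf_view b V C"
  shows "finite V" "finite C" "C \<noteq> {}" "\<And>c. c \<in> C \<Longrightarrow> wf_bt c" "\<And>c. c \<in> C \<Longrightarrow> \<not> is_block b c"
    "\<And>c c'. c \<in> C \<Longrightarrow> c' \<in> C \<Longrightarrow> c \<noteq> c' \<Longrightarrow> leaves c \<inter> leaves c' = {}"
    "\<And>X. X \<in> V \<Longrightarrow> X \<noteq> {}" "\<And>X. X \<in> V \<Longrightarrow> fst ` X \<subseteq> \<Union> (leaves ` C)"
    "\<And>X Y. X \<in> V \<Longrightarrow> Y \<in> V \<Longrightarrow> X \<noteq> Y \<Longrightarrow> X \<inter> Y = {}"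
    "\<And>X Y c. X \<in> V \<Longrightarrow> c \<in> C \<Longrightarrow> Y \<in> binders c \<Longrightarrow> X \<inter> Y = {}"
  using assms by (simp_all add: wf_view_def)

lemma leaves_nonempty: "wf_bt n \<Longrightarrow> leaves n \<noteq> {}"
  by (induction rule: wf_bt.induct) auto

lemma finite_leaves: "finite (leaves n)"
  by (induction n) auto

lemma view_not_block: "\<not> is_block b n \<Longrightarrow> block_binders b n = {} \<and> block_args b n = {n}"
  by (cases n) auto

lemma wf_view_views: assumes "wf_bt n" shows "wf_view b (block_binders b n) (block_args b n)"
proof (cases "is_block b n")
  case True
  then obtain V C where n: "n = Blk b V C" by (cases n) auto
  show ?thesis using assms unfolding n by (cases rule: wf_bt.cases) (auto simp: wf_view_def)
next
  case False
  then show ?thesis using assms by (simp add: view_not_block wf_view_def)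
qed

lemma mk_block_view: assumes "wf_bt n" shows "mk_block b (block_binders b n) (block_args b n) = n"
proof (cases "is_block b n")
  case True
  then obtain V C where n: "n = Blk b V C" by (cases n) auto
  show ?thesis using assms unfolding n
    by (cases rule: wf_bt.cases) (auto simp: mk_block_def fset_inverse)
next
  case False
  then show ?thesis by (simp add: view_not_block mk_block_def)
qed

lemma view_mk_block:
  assumes "finite V" "finite C" "\<And>c. c \<in> C \<Longrightarrow> \<not> is_block b c"
  shows "block_binders b (mk_block b V C) = V" "block_args b (mk_block b V C) = C"
  using assms by (auto simp: mk_block_def is_singleton_def view_not_block Abs_fset_inverse)

lemma view_mk_block_wf_view:
  assumes "wf_view b V C"
  shows "block_binders b (mk_block b V C) = V" "block_args b (mk_block b V C) = C"
  using view_mk_block[of V C b] wf_viewD(1,2,5)[OF assms] by auto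

lemma wf_mk_block: assumes "wf_view b V C" shows "wf_bt (mk_block b V C)"
proof (cases "V = {} \<and> is_singleton C")
  case True
  then show ?thesis using wf_viewD(4)[OF assms] by (auto simp: mk_block_def is_singleton_def)
next
  case False
  have s: "fset (Abs_fset V) = V" "fset (Abs_fset C) = C"
    using wf_viewD(1,2)[OF assms] by (simp_all add: Abs_fset_inverse)
  have "wf_bt (Blk b (Abs_fset V) (Abs_fset C))"
    by (rule wf_bt.intros; unfold s) (use False assms in \<open>auto simp: wf_view_def\<close>)
  with False show ?thesis unfolding mk_block_def by auto
qed

lemma leaves_view: "leaves n = \<Union> (leaves ` block_args b n)"
  by (cases n) auto

lemma binders_view: "binders n = block_binders b n \<union> \<Union> (binders ` block_args b n)"
  by (cases n) auto

lemma leaves_mk_block: assumes "wf_view b V C" shows "leaves (mk_block b V C) = \<Union> (leaves ` C)"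
  using leaves_view[of "mk_block b V C" b] view_mk_block_wf_view[OF assms] by simp

lemma binders_mk_block: assumes "wf_view b V C" shows "binders (mk_block b V C) = V \<union> \<Union> (binders ` C)"
  using binders_view[of "mk_block b V C" b] view_mk_block_wf_view[OF assms] by simp

lemma is_block_mk_block: "is_block b (mk_block b V C) \<longleftrightarrow> \<not> (V = {} \<and> is_singleton C)" 
  if "\<And>c. c \<in> C \<Longrightarrow> \<not> is_block b c"
  using that by (auto simp: mk_block_def is_singleton_def)

lemma is_block_dual: "is_block b n \<Longrightarrow> \<not> is_block (dual b) n"
  by (cases n) auto

text \<open>Extensionality. Equations between pushed trees are proved by comparing binders and
  arguments in one common view.\<close>

lemma wf_eqI: 
  assumes "wf_bt n" "wf_bt m" "block_binders b n = block_binders b m" "block_args b n = block_args b m" shows "n = m"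
  using mk_block_view assms by metis

lemma binders_leaves: "wf_bt n \<Longrightarrow> Y \<in> binders n \<Longrightarrow> Y \<noteq> {} \<and> fst ` Y \<subseteq> leaves n"
proof (induction n)
  case (Blk b V C)
  have v: "wf_view b (fset V) (fset C)" using wf_view_views[OF Blk.prems(1), of b] by simp
  show ?case
  proof (cases "Y \<in> fset V")
    case True
    then show ?thesis using wf_viewD(7,8)[OF v] by auto
  next
    case False
    then obtain c where c: "c \<in> fset C" "Y \<in> binders c" using Blk.prems by auto
    then have "Y \<noteq> {} \<and> fst ` Y \<subseteq> leaves c" using Blk.IH wf_viewD(4)[OF v] by blast
    then show ?thesis using c by auto
  qed
qed auto

lemma meets_leaves: "meets X n \<longleftrightarrow> (\<exists>c\<in>block_args b n. meets X c)"
  unfolding meets_def using leaves_view[of n b] by blast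

section \<open>Combining trees with disjoint sets of atoms\<close>

definition disj_leaves :: "'r bt set \<Rightarrow> bool" where
  "disj_leaves S \<longleftrightarrow> (\<forall>s\<in>S. \<forall>t\<in>S. s \<noteq> t \<longrightarrow> leaves s \<inter> leaves t = {})"

text \<open>Uniting the binders lets every quantifier of kind \<open>b\<close> range over the whole
  combination, as P allows; uniting the arguments as sets absorbs A and C.\<close>

definition join :: "bop \<Rightarrow> 'r bt set \<Rightarrow> 'r bt" where
  "join b S = mk_block b (\<Union> (block_binders b ` S)) (\<Union> (block_args b ` S))"

lemma finite_view: "finite (block_binders b n) \<and> finite (block_args b n)"
  by (cases n) auto

lemma view_leaves: 
  assumes "wf_bt n"
  shows "c \<in> block_args b n \<Longrightarrow> leaves c \<subseteq> leaves n" "X \<in> block_binders b n \<Longrightarrow> X \<noteq> {} \<and> fst ` X \<subseteq> leaves n"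
  using leaves_view[of n b] wf_viewD(7,8)[OF wf_view_views[OF assms, of b]] by auto

lemma wf_view_join:
  assumes "finite S" "S \<noteq> {}" "\<And>s. s \<in> S \<Longrightarrow> wf_bt s" "disj_leaves S"
  shows "wf_view b (\<Union> (block_binders b ` S)) (\<Union> (block_args b ` S))"
proof -
  note v = wf_view_views[OF assms(3), of _ b]
  \<comment> \<open>An atom, and hence a bound position, determines the member of \<open>S\<close>
    it comes from. All conditions that involve two members reduce to this.\<close>
  have d: "s = t" if "s \<in> S" "t \<in> S" "r \<in> leaves s" "r \<in> leaves t" for s t r
    using assms(4) that unfolding disj_leaves_def by blast
  have dp: "s = t" if "s \<in> S" "t \<in> S" "p \<in> X" "p \<in> Y" "fst ` X \<subseteq> leaves s" "fst ` Y \<subseteq> leaves t" for s t p X Y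
    using d[OF that(1,2)] that(3-6) by blast
  show ?thesis
    unfolding wf_view_def
  proof (intro conjI ballI impI)
    show "finite (\<Union> (block_binders b ` S))" "finite (\<Union> (block_args b ` S))" 
      using assms(1) by (auto simp: finite_view)
    show "\<Union> (block_args b ` S) \<noteq> {}" using assms(2) wf_viewD(3)[OF v] by fastforce
    fix c assume c: "c \<in> \<Union> (block_args b ` S)"
    then obtain s where s: "s \<in> S" "c \<in> block_args b s" by blast
    show "wf_bt c" "\<not> is_block b c" using s wf_viewD(4,5)[OF v] by blast+
    { fix c' assume c': "c' \<in> \<Union> (block_args b ` S)" "c \<noteq> c'"
      then obtain t where t: "t \<in> S" "c' \<in> block_args b t" by blast
      show "leaves c \<inter> leaves c' = {}"
      proof (cases "s = t")
        case True
        then show ?thesis using wf_viewD(6)[OF v] s t c' by blast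
      next
        case False
        then show ?thesis
          using d[OF s(1) t(1)] view_leaves(1)[OF assms(3) s(2)] view_leaves(1)[OF assms(3) t(2)] s t by blast
      qed }
  next
    fix X assume "X \<in> \<Union> (block_binders b ` S)"
    then obtain s where s: "s \<in> S" "X \<in> block_binders b s" by blast
    have Xs: "X \<noteq> {}" "fst ` X \<subseteq> leaves s" using view_leaves(2)[OF assms(3) s(2)] s by auto
    show "X \<noteq> {}" by fact
    show "fst ` X \<subseteq> \<Union> (leaves ` \<Union> (block_args b ` S))" using Xs s leaves_view[of s b] by auto
    { fix Y assume Y: "Y \<in> \<Union> (block_binders b ` S)" "X \<noteq> Y"
      then obtain t where t: "t \<in> S" "Y \<in> block_binders b t" by blast
      have Yt: "fst ` Y \<subseteq> leaves t" using view_leaves(2)[OF assms(3) t(2)] t by auto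
      show "X \<inter> Y = {}"
        using wf_viewD(9)[OF v] s t Y(2) dp[OF s(1) t(1) _ _ Xs(2) Yt] by blast }
    { fix c Y assume c: "c \<in> \<Union> (block_args b ` S)" and Y: "Y \<in> binders c"
      then obtain t where t: "t \<in> S" "c \<in> block_args b t" by blast
      have "wf_bt c" using wf_viewD(4)[OF v] t by blast
      then have Yt: "fst ` Y \<subseteq> leaves t" 
        using binders_leaves[OF _ Y] view_leaves(1)[OF assms(3) t(2)] t by blast
      show "X \<inter> Y = {}"
        using wf_viewD(10)[OF v] s t Y dp[OF s(1) t(1) _ _ Xs(2) Yt] by blast }
  qed
qed

definition family :: "'r bt set \<Rightarrow> bool" where
  "family S \<longleftrightarrow> finite S \<and> S \<noteq> {} \<and> (\<forall>s\<in>S. wf_bt s) \<and> disj_leaves S"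

lemma family_join:
  assumes "family S"
  shows "wf_bt (join b S)" "block_binders b (join b S) = \<Union> (block_binders b ` S)" "block_args b (join b S) = \<Union> (block_args b ` S)"
    "leaves (join b S) = \<Union> (leaves ` S)" "binders (join b S) = \<Union> (binders ` S)"
proof -
  have v: "wf_view b (\<Union> (block_binders b ` S)) (\<Union> (block_args b ` S))"
    using assms wf_view_join unfolding family_def by blast
  show "wf_bt (join b S)" unfolding join_def by (rule wf_mk_block[OF v])
  show b: "block_binders b (join b S) = \<Union> (block_binders b ` S)" "block_args b (join b S) = \<Union> (block_args b ` S)"
    unfolding join_def using view_mk_block_wf_view[OF v] by auto
  show "leaves (join b S) = \<Union> (leaves ` S)"
    unfolding leaves_view[of "join b S" b] b by (simp add: leaves_view[of _ b, symmetric])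
  have "\<Union> (binders ` S) = (\<Union>s\<in>S. block_binders b s \<union> \<Union> (binders ` block_args b s))"
    by (rule SUP_cong[OF refl binders_view])
  also have "\<dots> = binders (join b S)"
    unfolding binders_view[of "join b S" b] b by blast
  finally show "binders (join b S) = \<Union> (binders ` S)" ..
qed

lemma join_single: "wf_bt n \<Longrightarrow> join b {n} = n"
  by (simp add: join_def mk_block_view)

lemma family_subset: "family S \<Longrightarrow> T \<subseteq> S \<Longrightarrow> T \<noteq> {} \<Longrightarrow> family T"
  unfolding family_def disj_leaves_def using finite_subset by blast

lemma join_Un:
  assumes "family (S \<union> T)" "S \<noteq> {}" "T \<noteq> {}"
  shows "join b (S \<union> T) = join b {join b S, join b T}"
proof -
  have "family S" "family T" using family_subset[OF assms(1)] assms by auto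
  then show ?thesis unfolding join_def[of b "S \<union> T"] join_def[of b "{join b S, join b T}"]
    by (simp add: family_join)
qed

lemma disj_leaves_inj:
  assumes "disj_leaves S" "\<And>s. s \<in> S \<Longrightarrow> wf_bt s" "s \<in> S" "t \<in> S" "leaves s = leaves t" shows "s = t"
  using assms leaves_nonempty unfolding disj_leaves_def by (metis Int_absorb)

text \<open>Otherwise the join would be its own only argument, so every member would have just this
  argument and the same atoms as the join, and two members could not differ.\<close>

lemma is_block_join:
  assumes "family S" "\<not> is_singleton S" shows "is_block b (join b S)"
proof (rule ccontr)
  assume "\<not> is_block b (join b S)"
  then have 1: "\<Union> (block_args b ` S) = {join b S}" using family_join(3)[OF assms(1), of b] view_not_block by metis
  obtain s where s: "s \<in> S" using assms unfolding family_def by blast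
  then obtain t where t: "t \<in> S" "t \<noteq> s" using s assms(2) unfolding is_singleton_def by blast
  have "leaves u = leaves (join b S)" if "u \<in> S" for u
  proof -
    have "block_args b u \<noteq> {}" using assms(1) that wf_viewD(3)[OF wf_view_views] unfolding family_def by blast
    moreover have "block_args b u \<subseteq> {join b S}" using UN_upper[OF that, of "block_args b"] unfolding 1 .
    ultimately have "block_args b u = {join b S}" by blast
    then show ?thesis using leaves_view[of u b] by simp
  qed
  then have "leaves s = leaves (join b S)" "leaves t = leaves (join b S)" using s t by auto
  then show False using disj_leaves_inj[of S s t] assms(1) s t unfolding family_def by auto
qed

section \<open>Connected components of a block\<close>

text \<open>Arguments are the vertices and binders the hyperedges of a hypergraph; closed sets are
  unions of connected components, and \<open>component\<close> is the least closed set around a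
  vertex.\<close>

definition linked_closed :: "('r \<times> nat) set set \<Rightarrow> 'r bt set \<Rightarrow> 'r bt set \<Rightarrow> bool" where
  "linked_closed V C S \<longleftrightarrow> S \<subseteq> C \<and> (\<forall>X\<in>V. \<forall>c\<in>S. \<forall>c'\<in>C. meets X c \<longrightarrow> meets X c' \<longrightarrow> c' \<in> S)"

definition component :: "('r \<times> nat) set set \<Rightarrow> 'r bt set \<Rightarrow> 'r bt \<Rightarrow> 'r bt set" where
  "component V C c = \<Inter> {S. linked_closed V C S \<and> c \<in> S}"

lemma component_least: "linked_closed V C S \<Longrightarrow> c \<in> S \<Longrightarrow> component V C c \<subseteq> S"
  unfolding component_def by blast

lemma component_self: "c \<in> component V C c"
  unfolding component_def by blast

lemma linked_closed_component: assumes "c \<in> C" shows "linked_closed V C (component V C c)"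
proof -
  have "linked_closed V C C" unfolding linked_closed_def by blast
  then have override: "component V C c \<subseteq> C" using assms by (rule component_least)
  show ?thesis
    unfolding linked_closed_def
  proof (intro conjI ballI impI)
    fix X e e' assume a: "X \<in> V" "e \<in> component V C c" "e' \<in> C" "meets X e" "meets X e'"
    show "e' \<in> component V C c"
      unfolding component_def
    proof
      fix S assume S: "S \<in> {S. linked_closed V C S \<and> c \<in> S}"
      then have "e \<in> S" using a(2) unfolding component_def by blast
      then show "e' \<in> S" using S a unfolding linked_closed_def by blast
    qed
  qed (fact override)
qed

lemma component_sub: "c \<in> C \<Longrightarrow> component V C c \<subseteq> C"
  using linked_closed_component unfolding linked_closed_def by blast

text \<open>Linking is symmetric, so removing one component from another leaves a closed set. If the
  component of \<open>e\<close> missed \<open>c\<close>, this smaller closed set would contradict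
  the minimality of the component of \<open>c\<close>.\<close>

lemma component_eq: assumes "c \<in> C" "e \<in> component V C c" shows "component V C e = component V C c"
proof
  show 1: "component V C e \<subseteq> component V C c" using component_least[OF linked_closed_component[OF assms(1)] assms(2)] .
  have eC: "e \<in> C" using assms component_sub by blast
  have "c \<in> component V C e"
  proof (rule ccontr)
    assume "c \<notin> component V C e"
    moreover have "linked_closed V C (component V C c - component V C e)"
      using linked_closed_component[OF assms(1), of V] linked_closed_component[OF eC, of V]
      unfolding linked_closed_def by blast
    ultimately have "component V C c \<subseteq> component V C c - component V C e" by (intro component_least) (auto simp: component_self)
    then show False using assms(2) component_self by blast
  qed
  then show "component V C c \<subseteq> component V C e" using component_least[OF linked_closed_component[OF eC]] by blast
qed

definition touched :: "('r \<times> nat) set set \<Rightarrow> 'r bt set \<Rightarrow> ('r \<times> nat) set set" where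
  "touched V S = {X \<in> V. \<exists>c\<in>S. meets X c}"

definition piece :: "bop \<Rightarrow> 'r bt \<Rightarrow> 'r bt \<Rightarrow> 'r bt" where
  "piece d n c = mk_block d (touched (block_binders d n) (component (block_binders d n) (block_args d n) c)) (component (block_binders d n) (block_args d n) c)"

text \<open>The finest decomposition of a \<open>d\<close>-block as a \<open>d\<close>-combination of blocks, up to P: two arguments
  stay together iff they are linked by binders.\<close>

definition parts :: "bop \<Rightarrow> 'r bt \<Rightarrow> 'r bt set" where
  "parts d n = piece d n ` block_args d n"

lemma wf_view_touched:
  assumes v: "wf_view d V C" and S: "linked_closed V C S" "S \<noteq> {}"
  shows "wf_view d (touched V S) S"
proof -
  have SC: "S \<subseteq> C" using S(1) unfolding linked_closed_def by blast
  have TV: "touched V S \<subseteq> V" unfolding touched_def by blast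
  have X: "fst ` X \<subseteq> \<Union> (leaves ` S)" if XT: "X \<in> touched V S" for X
  proof
    fix r assume r: "r \<in> fst ` X"
    then obtain c' where c': "c' \<in> C" "r \<in> leaves c'" using wf_viewD(8)[OF v, of X] XT TV by blast
    then have "meets X c'" using r unfolding meets_def by blast
    then have "c' \<in> S" using XT c' S(1) unfolding touched_def linked_closed_def by blast
    then show "r \<in> \<Union> (leaves ` S)" using c' by blast
  qed
  note D = wf_viewD[OF v]
  show ?thesis unfolding wf_view_def
  proof (intro conjI ballI impI)
    show "finite (touched V S)" "finite S" "S \<noteq> {}" 
      using S(2) finite_subset[OF SC D(2)] finite_subset[OF TV D(1)] by auto
    show "wf_bt c" "\<not> is_block d c" if "c \<in> S" for c using D(4,5) SC that by auto
    show "leaves c \<inter> leaves e = {}" if "c \<in> S" "e \<in> S" "c \<noteq> e" for c e 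
      using D(6)[of c e] SC that by auto
    fix Y assume Y: "Y \<in> touched V S"
    show "Y \<noteq> {}" using D(7) Y TV by auto
    show "fst ` Y \<subseteq> \<Union> (leaves ` S)" using X[OF Y] .
    show "Y \<inter> Z = {}" if "Z \<in> touched V S" "Y \<noteq> Z" for Z using D(9)[of Y Z] Y TV that by auto
    show "Y \<inter> Z = {}" if "c \<in> S" "Z \<in> binders c" for c Z using D(10)[of Y c Z] Y TV SC that by auto
  qed
qed

lemma parts_props:
  assumes w: "wf_bt n" and c: "c \<in> block_args d n"
  shows "wf_bt (piece d n c)" "block_binders d (piece d n c) = touched (block_binders d n) (component (block_binders d n) (block_args d n) c)"
    "block_args d (piece d n c) = component (block_binders d n) (block_args d n) c"
proof -
  let ?S = "component (block_binders d n) (block_args d n) c"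
  have v: "wf_view d (touched (block_binders d n) ?S) ?S"
    using component_self[of c] by (intro wf_view_touched[OF wf_view_views[OF w] linked_closed_component[OF c]]) blast
  show "wf_bt (piece d n c)" unfolding piece_def by (rule wf_mk_block[OF v])
  show "block_binders d (piece d n c) = touched (block_binders d n) ?S" "block_args d (piece d n c) = ?S"
    unfolding piece_def using view_mk_block_wf_view[OF v] by auto
qed

lemma piece_eq:
  assumes w: "wf_bt n" and c: "c \<in> block_args d n" "c' \<in> block_args d n" and r: "r \<in> leaves (piece d n c)" "r \<in> leaves (piece d n c')"
  shows "piece d n c = piece d n c'"
proof -
  let ?component = "component (block_binders d n) (block_args d n)"
  obtain e where e: "e \<in> ?component c" "r \<in> leaves e" using r(1) leaves_view[of "piece d n c" d] parts_props(3)[OF w c(1)] by auto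
  obtain e' where e': "e' \<in> ?component c'" "r \<in> leaves e'" using r(2) leaves_view[of "piece d n c'" d] parts_props(3)[OF w c(2)] by auto
  have "e \<in> block_args d n" "e' \<in> block_args d n" using e e' component_sub[OF c(1)] component_sub[OF c(2)] by blast+
  then have "e = e'" using e e' wf_viewD(6)[OF wf_view_views[OF w]] by blast
  then have "?component c = ?component c'" using component_eq[OF c(1) e(1)] component_eq[OF c(2) e'(1)] by simp
  then show ?thesis unfolding piece_def by simp
qed

lemma family_parts:
  assumes w: "wf_bt n" shows "family (parts d n)"
proof -
  have "finite (parts d n)" "parts d n \<noteq> {}"
    unfolding parts_def using finite_view[of d n] wf_viewD(3)[OF wf_view_views[OF w]] by auto
  moreover have "disj_leaves (parts d n)"
    unfolding disj_leaves_def parts_def using piece_eq[OF w] by blast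
  ultimately show ?thesis unfolding family_def parts_def using parts_props(1)[OF w] by blast
qed

lemma join_parts:
  assumes w: "wf_bt n" shows "join d (parts d n) = n"
proof (rule wf_eqI[where b = d])
  note f = family_parts[OF w, of d]
  show "wf_bt (join d (parts d n))" using family_join(1)[OF f] .
  show "wf_bt n" by fact
  have "\<Union> (block_args d ` parts d n) = (\<Union>c\<in>block_args d n. component (block_binders d n) (block_args d n) c)"
    unfolding parts_def using parts_props(3)[OF w] by auto
  also have "\<dots> = block_args d n" using component_self component_sub by blast
  finally show "block_args d (join d (parts d n)) = block_args d n" using family_join(3)[OF f] by simp
  have "\<Union> (block_binders d ` parts d n) = (\<Union>c\<in>block_args d n. touched (block_binders d n) (component (block_binders d n) (block_args d n) c))"
    unfolding parts_def using parts_props(2)[OF w] by auto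
  also have "\<dots> = block_binders d n"
  proof
    show "block_binders d n \<subseteq> (\<Union>c\<in>block_args d n. touched (block_binders d n) (component (block_binders d n) (block_args d n) c))"
    proof
      fix X assume X: "X \<in> block_binders d n"
      then have "fst ` X \<inter> leaves n \<noteq> {}" using view_leaves(2)[OF w] by blast
      then obtain c where "c \<in> block_args d n" "meets X c" using leaves_view[of n d] unfolding meets_def by blast
      then show "X \<in> (\<Union>c\<in>block_args d n. touched (block_binders d n) (component (block_binders d n) (block_args d n) c))"
        using X component_self unfolding touched_def by blast
    qed
  qed (auto simp: touched_def)
  finally show "block_binders d (join d (parts d n)) = block_binders d n" using family_join(2)[OF f] by simp
qed

lemma parts_not_block: assumes "\<not> is_block d n" shows "parts d n = {n}"
proof -
  have v: "block_binders d n = {}" "block_args d n = {n}" using view_not_block assms by auto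
  have "component {} {n} n = {n}"
    using component_least[of "{}" "{n}" "{n}" n] component_self[of n] unfolding linked_closed_def by blast
  then show ?thesis unfolding parts_def piece_def v by (simp add: touched_def mk_block_def)
qed

text \<open>No link leads out of a closed set, so its components can be computed from its own
  arguments and the binders that touch them.\<close>

lemma component_cong_closed:
  assumes S: "linked_closed V C S" and c: "c \<in> S" and V': "touched V S \<subseteq> V'" "V' \<subseteq> V" 
  shows "component V' S c = component V C c"
proof
  have SC: "S \<subseteq> C" using S unfolding linked_closed_def by blast
  have cC: "c \<in> C" using c SC by blast
  have override: "component V C c \<subseteq> S" using component_least[OF S c] .
  have "linked_closed V' S (component V C c)"
    unfolding linked_closed_def
  proof (intro conjI ballI impI)
    fix X e e' assume "X \<in> V'" "e \<in> component V C c" "e' \<in> S" "meets X e" "meets X e'"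
    moreover from this have "X \<in> V" "e' \<in> C" using V'(2) SC by auto
    ultimately show "e' \<in> component V C c"
      using linked_closed_component[OF cC, of V] unfolding linked_closed_def by blast
  qed (fact override)
  then show "component V' S c \<subseteq> component V C c" using component_self by (rule component_least)
  have "linked_closed V C (component V' S c)"
    unfolding linked_closed_def
  proof (intro conjI ballI impI)
    show "component V' S c \<subseteq> C" using component_sub[OF c] SC by blast
    fix X e e' assume a: "X \<in> V" "e \<in> component V' S c" "e' \<in> C" "meets X e" "meets X e'"
    have e: "e \<in> S" using a(2) component_sub[OF c] by blast
    have "e' \<in> S" using S a e unfolding linked_closed_def by blast
    moreover have "X \<in> V'" using V'(1) a e unfolding touched_def by blast
    ultimately show "e' \<in> component V' S c"
      using linked_closed_component[OF c, of V'] a unfolding linked_closed_def by blast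
  qed
  then show "component V C c \<subseteq> component V' S c" using component_self by (rule component_least)
qed

text \<open>Here \<open>m\<close> is cut out of \<open>n\<close> along component boundaries. This is
  the common source of idempotence (\<open>parts_part\<close>) and additivity
  (\<open>parts_join\<close>) of the decomposition.\<close>

lemma parts_sub_eq:
  assumes S: "linked_closed (block_binders d n) (block_args d n) (block_args d m)" and V: "block_binders d m = touched (block_binders d n) (block_args d m)" 
    and c: "c \<in> block_args d m"
  shows "piece d m c = piece d n c"
proof -
  have eq: "component (block_binders d m) (block_args d m) c = component (block_binders d n) (block_args d n) c"
    using component_cong_closed[OF S c, of "block_binders d m"] V unfolding touched_def by auto
  have "touched (block_binders d m) (component (block_binders d n) (block_args d n) c) = touched (block_binders d n) (component (block_binders d n) (block_args d n) c)"
    using component_least[OF S c] V unfolding touched_def by blast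
  then show ?thesis unfolding piece_def eq by simp
qed

lemma parts_part:
  assumes w: "wf_bt n" and p: "p \<in> parts d n" shows "parts d p = {p}"
proof -
  obtain c where c: "c \<in> block_args d n" "p = piece d n c" using p unfolding parts_def by blast
  note pr = parts_props[OF w c(1), folded c(2)]
  have e: "piece d p e = piece d n e \<and> piece d n e = p" if "e \<in> block_args d p" for e
  proof
    show "piece d p e = piece d n e"
      using parts_sub_eq[of d n p e] pr that linked_closed_component[OF c(1)] by simp
    have "component (block_binders d n) (block_args d n) e = component (block_binders d n) (block_args d n) c"
      using component_eq[OF c(1)] that pr(3) by simp
    then show "piece d n e = p" unfolding c(2) piece_def by simp
  qed
  have "block_args d p \<noteq> {}" using pr(3) component_self by fastforce
  then show ?thesis unfolding parts_def using e by (auto simp: image_iff)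
qed

text \<open>Each binder of the join comes from one member and meets arguments of that member only,
  so joining creates no link between members.\<close>

lemma parts_join:
  assumes f: "family S" shows "parts d (join d S) = (\<Union>s\<in>S. parts d s)"
proof -
  note j = family_join[OF f, of d]
  have "piece d s c = piece d (join d S) c" if s: "s \<in> S" and c: "c \<in> block_args d s" for s c
  proof (rule parts_sub_eq[OF _ _ c])
    have ws: "\<And>s. s \<in> S \<Longrightarrow> wf_bt s" and dj: "\<And>s t r. s \<in> S \<Longrightarrow> t \<in> S \<Longrightarrow> r \<in> leaves s \<Longrightarrow> r \<in> leaves t \<Longrightarrow> s = t"
      using f unfolding family_def disj_leaves_def by blast+
    have loc: "t = s" if l: "t \<in> S" "X \<in> block_binders d t" "e \<in> block_args d s" "meets X e" for t X e
    proof -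
      obtain r where "r \<in> fst ` X" "r \<in> leaves e" using l(4) unfolding meets_def by blast
      then show ?thesis
        using dj[OF l(1) s] view_leaves(2)[OF ws[OF l(1)] l(2)] view_leaves(1)[OF ws[OF s] l(3)] by blast
    qed
    show "linked_closed (block_binders d (join d S)) (block_args d (join d S)) (block_args d s)"
      unfolding linked_closed_def j
    proof (intro conjI ballI impI)
      show "block_args d s \<subseteq> \<Union> (block_args d ` S)" using s by blast
      fix X e e' assume a: "X \<in> \<Union> (block_binders d ` S)" "e \<in> block_args d s" "e' \<in> \<Union> (block_args d ` S)" "meets X e" "meets X e'"
      then have X: "X \<in> block_binders d s" using loc by blast
      obtain t where t: "t \<in> S" "e' \<in> block_args d t" using a by blast
      obtain r where "r \<in> fst ` X" "r \<in> leaves e'" using a(5) unfolding meets_def by blast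
      then have "s = t"
        using dj[OF s t(1)] view_leaves(2)[OF ws[OF s] X] view_leaves(1)[OF ws[OF t(1)] t(2)] by blast
      then show "e' \<in> block_args d s" using t by simp
    qed
    show "block_binders d s = touched (block_binders d (join d S)) (block_args d s)"
    proof
      show "block_binders d s \<subseteq> touched (block_binders d (join d S)) (block_args d s)"
      proof
        fix X assume X: "X \<in> block_binders d s"
        then have "meets X s" using view_leaves(2)[OF ws[OF s]] unfolding meets_def by blast
        then show "X \<in> touched (block_binders d (join d S)) (block_args d s)"
          using X s unfolding touched_def j meets_leaves[of X s d] by blast
      qed
      show "touched (block_binders d (join d S)) (block_args d s) \<subseteq> block_binders d s"
        unfolding touched_def j using loc by blast
    qed
  qed
  then show ?thesis unfolding parts_def j by (auto simp: image_iff)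
qed

lemma parts_single: "wf_bt n \<Longrightarrow> is_singleton (parts d n) \<longleftrightarrow> parts d n = {n}"
proof
  assume w: "wf_bt n" and "is_singleton (parts d n)"
  then obtain p where p: "parts d n = {p}" by (auto simp: is_singleton_def)
  then have "wf_bt p" using family_parts[OF w, of d] unfolding family_def by simp
  then have "p = n" using join_parts[OF w, of d] p join_single by metis
  then show "parts d n = {n}" using p by simp
qed auto

text \<open>The strict inclusion drives the inductions along \<open>push\<close>: a tree with more
  than one part has strictly more atoms than each of them.\<close>

lemma part_sub:
  assumes w: "wf_bt n" and p: "p \<in> parts d n"
  shows "wf_bt p" "leaves p \<subseteq> leaves n" "binders p \<subseteq> binders n"
    "parts d n \<noteq> {n} \<Longrightarrow> leaves p \<subset> leaves n"
proof -
  note f = family_parts[OF w, of d]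
  show "wf_bt p" using f p unfolding family_def by blast
  show 1: "leaves p \<subseteq> leaves n" "binders p \<subseteq> binders n"
    using family_join(4,5)[OF f, of d] p join_parts[OF w, of d] by auto
  assume "parts d n \<noteq> {n}"
  then have "\<not> is_singleton (parts d n)" using parts_single[OF w] by simp
  then obtain q where q: "q \<in> parts d n" "q \<noteq> p" using p unfolding is_singleton_def by blast
  have "leaves q \<noteq> {}" "leaves q \<inter> leaves p = {}" "leaves q \<subseteq> leaves n"
    using f q p leaves_nonempty family_join(4)[OF f, of d] join_parts[OF w, of d] 
    unfolding family_def disj_leaves_def by auto
  then show "leaves p \<subset> leaves n" using 1 by blast
qed

section \<open>Pushing a quantifier into a block tree\<close>

definition hit :: "bop \<Rightarrow> ('r \<times> nat) set \<Rightarrow> 'r bt \<Rightarrow> 'r bt set" where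
  "hit b X n = {c \<in> block_args b n. meets X c}"

text \<open>If a quantifier meets only one argument of its block and this argument has several parts, it is
  distributed over them (P, S); otherwise it joins the binders of the block.
  The cardinality test only serves termination, it always succeeds on well-formed trees.\<close>

function push :: "bop \<Rightarrow> ('r \<times> nat) set \<Rightarrow> 'r bt \<Rightarrow> 'r bt" where
  "push b X n =
    (if hit b X n = {} then n
     else if is_singleton (hit b X n) \<and> parts (dual b) (the_elem (hit b X n)) \<noteq> hit b X n then
       mk_block b (block_binders b n)
         (insert (join (dual b) ((\<lambda>e. if card (leaves e) < card (leaves n) then push b X e else e) ` parts (dual b) (the_elem (hit b X n))))
           (block_args b n - hit b X n))
     else mk_block b (insert (restrict_to X n) (block_binders b n)) (block_args b n))"
  by auto
termination by (relation "measure (\<lambda>(b, X, n). card (leaves n))") auto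

declare push.simps [simp del]

definition splits :: "bop \<Rightarrow> ('r \<times> nat) set \<Rightarrow> 'r bt \<Rightarrow> 'r bt \<Rightarrow> bool" where
  "splits b X n j \<longleftrightarrow> hit b X n = {j} \<and> parts (dual b) j \<noteq> {j}"

lemma hit_empty: "hit b X n = {} \<longleftrightarrow> \<not> meets X n"
  unfolding hit_def using meets_leaves[of X n b] by blast

lemma push_none: "\<not> meets X n \<Longrightarrow> push b X n = n"
  by (simp add: push.simps hit_empty)

lemma push_stuck:
  assumes "meets X n" "\<nexists>j. splits b X n j"
  shows "push b X n = mk_block b (insert (restrict_to X n) (block_binders b n)) (block_args b n)"
proof -
  have "\<not> (is_singleton (hit b X n) \<and> parts (dual b) (the_elem (hit b X n)) \<noteq> hit b X n)"
    using assms(2) unfolding splits_def is_singleton_def by auto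
  then show ?thesis using assms(1) hit_empty[of b X n] by (subst push.simps) auto
qed

definition split_part :: "bop \<Rightarrow> ('r \<times> nat) set \<Rightarrow> 'r bt \<Rightarrow> 'r bt" where
  "split_part b X j = join (dual b) (push b X ` parts (dual b) j)"

lemma hit_mem: "splits b X n j \<Longrightarrow> j \<in> block_args b n \<and> meets X j"
  unfolding splits_def hit_def by blast

lemma part_card_less:
  assumes "wf_bt n" "j \<in> block_args b n" "parts d j \<noteq> {j}" "e \<in> parts d j"
  shows "card (leaves e) < card (leaves n)"
proof -
  have "wf_bt j" using wf_viewD(4)[OF wf_view_views[OF assms(1)] assms(2)] .
  then have "leaves e \<subset> leaves n" using part_sub(4)[OF _ assms(4,3)] view_leaves(1)[OF assms(1,2)] by blast
  then show ?thesis by (rule psubset_card_mono[OF finite_leaves])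
qed

lemma push_split:
  assumes "wf_bt n" "splits b X n j"
  shows "push b X n = mk_block b (block_binders b n) (insert (split_part b X j) (block_args b n - {j}))"
proof -
  have h: "hit b X n = {j}" "parts (dual b) j \<noteq> {j}" using assms(2) unfolding splits_def by auto
  have "(\<lambda>e. if card (leaves e) < card (leaves n) then push b X e else e) ` parts (dual b) j = push b X ` parts (dual b) j"
    using part_card_less[OF assms(1) conjunct1[OF hit_mem[OF assms(2)]] h(2)] by (intro image_cong) auto
  then show ?thesis using h unfolding split_part_def by (subst push.simps) auto
qed

section \<open>Invariants of pushing\<close>

definition apart :: "('r \<times> nat) set \<Rightarrow> 'r bt \<Rightarrow> bool" where
  "apart X n \<longleftrightarrow> (\<forall>Y\<in>binders n. X \<inter> Y = {})"

lemma family_image: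
  assumes f: "family S" and g: "\<And>s. s \<in> S \<Longrightarrow> wf_bt (g s) \<and> leaves (g s) = leaves s"
  shows "family (g ` S)" "inj_on g S"
proof -
  show i: "inj_on g S"
    unfolding inj_on_def using g disj_leaves_inj[of S] f unfolding family_def by metis
  show "family (g ` S)"
    unfolding family_def
  proof (intro conjI)
    show "disj_leaves (g ` S)" unfolding disj_leaves_def
    proof (intro ballI impI)
      fix a c assume "a \<in> g ` S" "c \<in> g ` S" "a \<noteq> c"
      then obtain s t where st: "s \<in> S" "t \<in> S" "a = g s" "c = g t" "s \<noteq> t" by blast
      then have "leaves s \<inter> leaves t = {}" using f unfolding family_def disj_leaves_def by blast
      then show "leaves a \<inter> leaves c = {}" using st g by simp
    qed
  qed (use f g in \<open>auto simp: family_def\<close>)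
qed

lemma wf_view_replace:
  assumes v: "wf_view b V C" and j: "j \<in> C" and w: "wf_bt j'" and nb: "\<not> is_block b j'" and l: "leaves j' = leaves j"
    and B: "\<And>X Y. X \<in> V \<Longrightarrow> Y \<in> binders j' \<Longrightarrow> X \<inter> Y = {}"
  shows "wf_view b V (insert j' (C - {j}))"
proof -
  note D = wf_viewD[OF v]
  have U: "\<Union> (leaves ` insert j' (C - {j})) = \<Union> (leaves ` C)" using j l by auto
  show ?thesis unfolding wf_view_def U
  proof (intro conjI ballI impI)
    show "finite V" "finite (insert j' (C - {j}))" "insert j' (C - {j}) \<noteq> {}" using D(1,2) by auto
    show "wf_bt c" "\<not> is_block b c" if "c \<in> insert j' (C - {j})" for c using that D(4,5) w nb by auto
    show "leaves c \<inter> leaves e = {}" if "c \<in> insert j' (C - {j})" "e \<in> insert j' (C - {j})" "c \<noteq> e" for c e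
      using that D(6)[of c e] D(6)[of j e] D(6)[of c j] j l by auto
    show "X \<noteq> {}" "fst ` X \<subseteq> \<Union> (leaves ` C)" if "X \<in> V" for X using D(7,8)[OF that] by auto
    show "X \<inter> Y = {}" if "X \<in> V" "Y \<in> V" "X \<noteq> Y" for X Y using D(9) that by auto
    show "X \<inter> Y = {}" if "X \<in> V" "c \<in> insert j' (C - {j})" "Y \<in> binders c" for X c Y 
      using D(10)[of X c Y] B[of X Y] that by blast
  qed
qed

lemma block_args_props:
  assumes "wf_bt n" "c \<in> block_args b n"
  shows "wf_bt c" "\<not> is_block b c" "leaves c \<subseteq> leaves n" "binders c \<subseteq> binders n"
  using assms wf_viewD(4,5)[OF wf_view_views[OF assms(1)]] view_leaves(1)[OF assms] binders_view[of n b] by auto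

text \<open>The claims rely on each other, hence one induction: replacing a split argument needs
  pushed parts to be well-formed with unchanged atoms, and its new decomposition needs them to stay
  indecomposable. They do, because an indecomposable tree met by the quantifier ends up as a
  \<open>b\<close>-block, which has only one part for \<open>dual b\<close>: a stuck quantifier adds
  a binder, and a splitting one exchanges an argument of what already was a
  \<open>b\<close>-block.\<close>

lemma push_invariants:
  assumes "wf_bt n" "apart X n"
  shows "wf_bt (push b X n) \<and> leaves (push b X n) = leaves n \<and>
    (parts (dual b) n = {n} \<longrightarrow> parts (dual b) (push b X n) = {push b X n}) \<and>
    (\<forall>Y\<in>binders (push b X n). Y \<in> binders n \<or> Y \<subseteq> X) \<and>
    (\<forall>j. splits b X n j \<longrightarrow> wf_view b (block_binders b n) (insert (split_part b X j) (block_args b n - {j})) \<and>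
      wf_bt (split_part b X j) \<and> leaves (split_part b X j) = leaves j \<and>
      parts (dual b) (split_part b X j) = push b X ` parts (dual b) j \<and>
      parts (dual b) (split_part b X j) \<noteq> {split_part b X j} \<and>
      (\<forall>Y\<in>binders (split_part b X j). Y \<in> binders j \<or> Y \<subseteq> X)) \<and>
    (meets X n \<longrightarrow> wf_view b (insert (restrict_to X n) (block_binders b n)) (block_args b n))"
  using assms
proof (induction "card (leaves n)" arbitrary: n rule: less_induct)
  case less
  note w = less.prems(1) and a = less.prems(2)
  note v = wf_view_views[OF w, of b]
  let ?d = "dual b"
  have X: "X \<inter> Y = {}" if "Y \<in> binders n" for Y using a that unfolding apart_def by blast
  have S: "wf_view b (block_binders b n) (insert (split_part b X j) (block_args b n - {j})) \<and>
      wf_bt (split_part b X j) \<and> leaves (split_part b X j) = leaves j \<and>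
      parts ?d (split_part b X j) = push b X ` parts ?d j \<and>
      parts ?d (split_part b X j) \<noteq> {split_part b X j} \<and> is_block ?d (split_part b X j) \<and>
      (\<forall>Y\<in>binders (split_part b X j). Y \<in> binders j \<or> Y \<subseteq> X)" if s: "splits b X n j" for j
  proof -
    have j: "j \<in> block_args b n" "parts ?d j \<noteq> {j}" using hit_mem[OF s] s unfolding splits_def by auto
    note bj = block_args_props[OF w j(1)]
    have IH: "wf_bt (push b X e) \<and> leaves (push b X e) = leaves e \<and> parts ?d (push b X e) = {push b X e} \<and>
      (\<forall>Y\<in>binders (push b X e). Y \<in> binders e \<or> Y \<subseteq> X)" if e: "e \<in> parts ?d j" for e
    proof -
      have "binders e \<subseteq> binders n" using part_sub(3)[OF bj(1) e] bj by blast
      then have "apart X e" using a unfolding apart_def by blast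
      then show ?thesis
        using less.hyps[OF part_card_less[OF w j e] part_sub(1)[OF bj(1) e]] parts_part[OF bj(1) e]
        by (elim meta_impE) simp_all
    qed
    note fp = family_parts[OF bj(1), of ?d]
    have f: "family (push b X ` parts ?d j)" "inj_on (push b X) (parts ?d j)"
      using family_image[OF fp, of "push b X"] IH by auto
    have ns: "\<not> is_singleton (push b X ` parts ?d j)"
    proof
      assume "is_singleton (push b X ` parts ?d j)"
      then have "is_singleton (parts ?d j)"
        using f(2) card_image[OF f(2)] by (simp add: is_singleton_altdef)
      then show False using parts_single[OF bj(1)] j by blast
    qed
    note J = family_join[OF f(1), of ?d, folded split_part_def]
    have block: "is_block ?d (split_part b X j)" unfolding split_part_def using is_block_join[OF f(1) ns] .
    have l: "leaves (split_part b X j) = leaves j"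
      using J(4) IH family_join(4)[OF fp, of ?d] join_parts[OF bj(1), of ?d] by simp
    have B: "\<forall>Y\<in>binders (split_part b X j). Y \<in> binders j \<or> Y \<subseteq> X"
      using J(5) IH part_sub(3)[OF bj(1)] by fastforce
    have p: "parts ?d (split_part b X j) = push b X ` parts ?d j"
      using parts_join[OF f(1), of ?d] IH unfolding split_part_def by auto
    moreover have "parts ?d (split_part b X j) \<noteq> {split_part b X j}" using ns p by auto
    moreover have "wf_view b (block_binders b n) (insert (split_part b X j) (block_args b n - {j}))"
    proof (rule wf_view_replace[OF v j(1) J(1) _ l])
      show "\<not> is_block b (split_part b X j)" using is_block_dual[OF block] by simp
      fix Z Y assume Z: "Z \<in> block_binders b n" and Y: "Y \<in> binders (split_part b X j)"
      have "Z \<in> binders n" using Z binders_view[of n b] by blast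
      then show "Z \<inter> Y = {}" using B Y X wf_viewD(10)[OF v Z j(1)] by blast
    qed
    ultimately show ?thesis using J(1) l B block by blast
  qed
  have S': "\<forall>j. splits b X n j \<longrightarrow> wf_view b (block_binders b n) (insert (split_part b X j) (block_args b n - {j})) \<and>
      wf_bt (split_part b X j) \<and> leaves (split_part b X j) = leaves j \<and>
      parts ?d (split_part b X j) = push b X ` parts ?d j \<and>
      parts ?d (split_part b X j) \<noteq> {split_part b X j} \<and>
      (\<forall>Y\<in>binders (split_part b X j). Y \<in> binders j \<or> Y \<subseteq> X)" (is "\<forall>j. _ \<longrightarrow> ?P j")
  proof (intro allI impI)
    fix j assume "splits b X n j"
    from S[OF this] show "?P j" by (elim conjE) (intro conjI; assumption)
  qed
  have T: "wf_view b (insert (restrict_to X n) (block_binders b n)) (block_args b n)" if m: "meets X n"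
  proof -
    note D = wf_viewD[OF v]
    have r: "restrict_to X n \<noteq> {}" using m unfolding meets_def restrict_to_def by blast
    have rl: "fst ` restrict_to X n \<subseteq> \<Union> (leaves ` block_args b n)" using leaves_view[of n b] unfolding restrict_to_def by auto
    have rX: "restrict_to X n \<subseteq> X" unfolding restrict_to_def by blast
    have readback: "restrict_to X n \<inter> Y = {}" if "Y \<in> block_binders b n" for Y
      using X that rX binders_view[of n b] by blast
    have rc: "restrict_to X n \<inter> Y = {}" if "c \<in> block_args b n" "Y \<in> binders c" for c Y
      using X that rX binders_view[of n b] by blast
    show ?thesis unfolding wf_view_def
    proof (intro conjI ballI impI)
      show "finite (insert (restrict_to X n) (block_binders b n))" "finite (block_args b n)" "block_args b n \<noteq> {}" using D(1-3) by auto
      show "wf_bt c" "\<not> is_block b c" if "c \<in> block_args b n" for c using that D(4,5) by auto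
      show "leaves c \<inter> leaves e = {}" if "c \<in> block_args b n" "e \<in> block_args b n" "c \<noteq> e" for c e using D(6) that by auto
      fix Y assume Y: "Y \<in> insert (restrict_to X n) (block_binders b n)"
      show "Y \<noteq> {}" "fst ` Y \<subseteq> \<Union> (leaves ` block_args b n)" using Y D(7,8) r rl by auto
      show "Y \<inter> Z = {}" if "Z \<in> insert (restrict_to X n) (block_binders b n)" "Y \<noteq> Z" for Z 
        using Y that readback D(9) by blast
      show "Y \<inter> Z = {}" if "c \<in> block_args b n" "Z \<in> binders c" for c Z using Y that rc D(10) by blast
    qed
  qed
  show ?case
  proof (cases "meets X n")
    case False
    have 1: "wf_bt (push b X n)" "leaves (push b X n) = leaves n"
      "\<forall>Y\<in>binders (push b X n). Y \<in> binders n \<or> Y \<subseteq> X"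
      "parts ?d n = {n} \<Longrightarrow> parts ?d (push b X n) = {push b X n}"
      using False w by (simp_all add: push_none)
    show ?thesis by (intro conjI impI 1 S' T)
  next
    case m: True
    show ?thesis
    proof (cases "\<exists>j. splits b X n j")
      case True
      then obtain j where s: "splits b X n j" by blast
      note e = push_split[OF w s] and Sj = S[OF s]
      then have v': "wf_view b (block_binders b n) (insert (split_part b X j) (block_args b n - {j}))" by blast
      have j: "j \<in> block_args b n" using hit_mem[OF s] by blast
      have 1: "wf_bt (push b X n)" unfolding e by (rule wf_mk_block[OF v'])
      have 2: "leaves (push b X n) = leaves n" unfolding e leaves_mk_block[OF v'] leaves_view[of n b] using Sj j by auto
      have 3: "\<forall>Y\<in>binders (push b X n). Y \<in> binders n \<or> Y \<subseteq> X"
        unfolding e binders_mk_block[OF v'] using Sj block_args_props(4)[OF w] j binders_view[of n b] by blast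
      have 4: "parts ?d (push b X n) = {push b X n}" if c: "parts ?d n = {n}"
      proof (rule parts_not_block)
        \<comment> \<open>If \<open>n\<close> were no \<open>b\<close>-block, it would be its own
          only argument, and a split would require it to have several parts.\<close>
        have "is_block b n" 
        proof (rule ccontr)
          assume "\<not> is_block b n"
          then have "j = n" using j view_not_block by blast
          then show False using c s unfolding splits_def by blast
        qed
        then have ns: "\<not> (block_binders b n = {} \<and> is_singleton (block_args b n))"
          using is_block_mk_block[of "block_args b n" b "block_binders b n"] wf_viewD(5)[OF v] mk_block_view[OF w, of b] by auto
        have "\<not> (block_binders b n = {} \<and> is_singleton (insert (split_part b X j) (block_args b n - {j})))"
        proof
          assume h: "block_binders b n = {} \<and> is_singleton (insert (split_part b X j) (block_args b n - {j}))"
          have "block_args b n - {j} = {}"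
          proof (rule ccontr)
            assume "block_args b n - {j} \<noteq> {}"
            then obtain c where c: "c \<in> block_args b n" "c \<noteq> j" by blast
            then have "c = split_part b X j" using h unfolding is_singleton_def by blast
            then have "leaves c = leaves j" using Sj by simp
            then show False using wf_viewD(6)[OF v c(1) j c(2)] leaves_nonempty[OF block_args_props(1)[OF w c(1)]] by blast
          qed
          then have "block_args b n = {j}" using j by blast
          then show False using ns h by auto
        qed
        then have "is_block b (push b X n)" unfolding e using is_block_mk_block wf_viewD(5)[OF v'] by metis
        then show "\<not> is_block ?d (push b X n)" by (rule is_block_dual)
      qed
      show ?thesis by (intro conjI impI 1 2 3 4 S' T)
    next
      case False
      note e = push_stuck[OF m False] and v' = T[OF m]
      have 1: "wf_bt (push b X n)" unfolding e by (rule wf_mk_block[OF v'])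
      have 2: "leaves (push b X n) = leaves n" unfolding e leaves_mk_block[OF v'] leaves_view[of n b] ..
      have 3: "\<forall>Y\<in>binders (push b X n). Y \<in> binders n \<or> Y \<subseteq> X"
        unfolding e binders_mk_block[OF v'] using binders_view[of n b] unfolding restrict_to_def by auto
      have "is_block b (push b X n)" unfolding e using is_block_mk_block[of "block_args b n" b] wf_viewD(5)[OF v'] by blast
      then have 4: "parts ?d (push b X n) = {push b X n}" using parts_not_block is_block_dual by blast
      show ?thesis by (intro conjI impI 1 2 3 4 S' T)
    qed
  qed
qed

lemmas push_wf = push_invariants[THEN conjunct1]
lemmas push_leaves = push_invariants[THEN conjunct2, THEN conjunct1]
lemmas push_binders = push_invariants[THEN conjunct2, THEN conjunct2, THEN conjunct2, THEN conjunct1, THEN bspec]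

lemma split_part_props:
  assumes "wf_bt n" "apart X n" "splits b X n j"
  shows "wf_view b (block_binders b n) (insert (split_part b X j) (block_args b n - {j}))" "wf_bt (split_part b X j)"
    "leaves (split_part b X j) = leaves j" "parts (dual b) (split_part b X j) = push b X ` parts (dual b) j"
    "parts (dual b) (split_part b X j) \<noteq> {split_part b X j}"
  using push_invariants[OF assms(1,2), of b, THEN conjunct2, THEN conjunct2, THEN conjunct2, THEN conjunct2, THEN conjunct1,
    THEN spec, THEN mp, OF assms(3)]
  by - (elim conjE, assumption)+

lemma wf_view_stuck:
  assumes "wf_bt n" "apart X n" "meets X n" shows "wf_view b (insert (restrict_to X n) (block_binders b n)) (block_args b n)"
  using push_invariants[OF assms(1,2), of b] assms(3) by simp

lemma apart_push:
  assumes "wf_bt n" "apart Y n" "apart X n" "X \<inter> Y = {}"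
  shows "apart X (push b Y n)"
  using push_binders[OF assms(1,2), of _ b] assms(3,4) unfolding apart_def by blast

section \<open>Commutation of pushes\<close>

lemma hit_replace:
  assumes w: "wf_bt n" and j: "j \<in> block_args b n" and l: "leaves j' = leaves j" and V: "block_args b m = insert j' (block_args b n - {j})"
  shows "hit b X m = (if meets X j then insert j' (hit b X n - {j}) else hit b X n)"
proof -
  have "meets X j' = meets X j" using l unfolding meets_def by simp
  then show ?thesis unfolding hit_def V using j by auto
qed

text \<open>Arguments are kept in a set, where a replaced argument might coincide with another one.
  Disjoint nonempty atom sets exclude this.\<close>

lemma replace_notin:
  assumes w: "wf_bt n" and j: "j \<in> block_args b n" and l: "leaves j' = leaves j" and c: "c \<in> block_args b n" "c \<noteq> j"
  shows "j' \<noteq> c"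
  using wf_viewD(6)[OF wf_view_views[OF w] c(1) j c(2)] leaves_nonempty[OF block_args_props(1)[OF w c(1)]] l by auto

lemma push_split_views:
  assumes w: "wf_bt n" "apart X n" and s: "splits b X n j"
  shows "block_binders b (push b X n) = block_binders b n" "block_args b (push b X n) = insert (split_part b X j) (block_args b n - {j})"
  unfolding push_split[OF w(1) s] using view_mk_block_wf_view[OF split_part_props(1)[OF w s]] by auto

lemma push_stuck_views:
  assumes w: "wf_bt n" "apart X n" and m: "meets X n" and s: "\<nexists>j. splits b X n j"
  shows "block_binders b (push b X n) = insert (restrict_to X n) (block_binders b n)" "block_args b (push b X n) = block_args b n"
  unfolding push_stuck[OF m s] using view_mk_block_wf_view[OF wf_view_stuck[OF w m]] by auto

lemma splits_after_stuck:
  assumes w: "wf_bt n" "apart Y n" and m: "meets Y n" and s: "\<nexists>j. splits b Y n j"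
  shows "splits b X (push b Y n) j \<longleftrightarrow> splits b X n j"
  unfolding splits_def hit_def push_stuck_views[OF assms] ..

text \<open>Which arguments are hit depends on their atoms only, and pushing keeps these. If
  \<open>X\<close> meets \<open>i\<close>, it meets another argument too, so it is stuck before and
  after; if it misses \<open>i\<close>, its hits are untouched.\<close>

lemma splits_after_split_neq:
  assumes w: "wf_bt n" "apart Y n" and s: "splits b Y n i" and X: "hit b X n \<noteq> {i}"
  shows "splits b X (push b Y n) j \<longleftrightarrow> splits b X n j"
proof -
  note V = push_split_views[OF w s]
  have i: "i \<in> block_args b n" using hit_mem[OF s] by blast
  note l = split_part_props(3)[OF w s]
  have h: "hit b X (push b Y n) = (if meets X i then insert (split_part b Y i) (hit b X n - {i}) else hit b X n)"
    using hit_replace[OF w(1) i l V(2)] .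
  show ?thesis
  proof (cases "meets X i")
    case True
    then have "i \<in> hit b X n" using i unfolding hit_def by blast
    then obtain c where c: "c \<in> hit b X n" "c \<noteq> i" using X by blast
    then have "split_part b Y i \<noteq> c" using replace_notin[OF w(1) i l] unfolding hit_def by blast
    then show ?thesis using h True c \<open>i \<in> hit b X n\<close> unfolding splits_def by auto
  next
    case False
    then show ?thesis using h unfolding splits_def by simp
  qed
qed

lemma meets_push: "wf_bt n \<Longrightarrow> apart Y n \<Longrightarrow> meets X (push b Y n) \<longleftrightarrow> meets X n"
  unfolding meets_def by (simp add: push_leaves)

lemma restr_push: "wf_bt n \<Longrightarrow> apart Y n \<Longrightarrow> restrict_to X (push b Y n) = restrict_to X n"
  unfolding restrict_to_def by (simp add: push_leaves)

text \<open>A stuck \<open>Y\<close> adds a binder and leaves the arguments alone, so the fate of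
  \<open>X\<close> is unchanged. Conversely \<open>X\<close> leaves \<open>Y\<close> stuck and does
  not alter the positions to which \<open>Y\<close> is restricted, since the atoms stay the
  same.\<close>

lemma push_commute_stuck:
  assumes w: "wf_bt n" and a: "apart X n" "apart Y n" and XY: "X \<inter> Y = {}"
    and m: "meets X n" "meets Y n" and s: "\<nexists>j. splits b Y n j"
  shows "push b X (push b Y n) = push b Y (push b X n)"
proof -
  have aX: "apart X (push b Y n)" and aY: "apart Y (push b X n)"
    using apart_push[OF w a(2,1) XY] apart_push[OF w a(1,2)] XY by blast+
  note wX = push_wf[OF w a(1), of b] and wY = push_wf[OF w a(2), of b]
  note lX = push_leaves[OF w a(1), of b] and lY = push_leaves[OF w a(2), of b]
  have mX: "meets X (push b Y n)" and mY: "meets Y (push b X n)"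
    using m meets_push[OF w] a by blast+
  note VY = push_stuck_views[OF w a(2) m(2) s]
  show ?thesis
  proof (cases "\<exists>j. splits b X n j")
    case True
    then obtain j where j: "splits b X n j" by blast
    note VX = push_split_views[OF w a(1) j]
    have h: "hit b Y n \<noteq> {j}" using s j unfolding splits_def by blast
    have s': "\<nexists>i. splits b Y (push b X n) i" using splits_after_split_neq[OF w a(1) j h] s by blast
    have j': "splits b X (push b Y n) j" using splits_after_stuck[OF w a(2) m(2) s] j by blast
    show ?thesis
    proof (rule wf_eqI[where b = b])
      show "wf_bt (push b X (push b Y n))" "wf_bt (push b Y (push b X n))" 
        using push_wf[OF wY aX] push_wf[OF wX aY] by auto
    qed (simp_all add: push_split_views[OF wY aX j'] push_stuck_views[OF wX aY mY s'] VX VY restr_push[OF w a(1)])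
  next
    case False
    note VX = push_stuck_views[OF w a(1) m(1) False]
    have sX: "\<nexists>i. splits b X (push b Y n) i" using splits_after_stuck[OF w a(2) m(2) s] False by blast
    have sY: "\<nexists>i. splits b Y (push b X n) i" using splits_after_stuck[OF w a(1) m(1) False] s by blast
    show ?thesis
    proof (rule wf_eqI[where b = b])
      show "wf_bt (push b X (push b Y n))" "wf_bt (push b Y (push b X n))" 
        using push_wf[OF wY aX] push_wf[OF wX aY] by auto
    qed (simp_all add: push_stuck_views[OF wY aX mX sX] push_stuck_views[OF wX aY mY sY] VX VY 
         restr_push[OF w a(1)] restr_push[OF w a(2)] insert_commute)
  qed
qed

text \<open>If the two quantifiers split different arguments, the replacements are independent. If
  they split the same one, both spread over the same parts, since pushing maps the parts of the
  opposite block one by one, and the induction hypothesis applies within each part. Disjointness of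
  \<open>X\<close> and \<open>Y\<close> keeps each apart from the binders that the other
  inserts.\<close>

lemma push_commute:
  assumes "wf_bt n" "apart X n" "apart Y n" "X \<inter> Y = {}"
  shows "push b X (push b Y n) = push b Y (push b X n)"
  using assms
proof (induction "card (leaves n)" arbitrary: n rule: less_induct)
  case less
  note w = less.prems(1) and a = less.prems(2,3) and XY = less.prems(4)
  have aX: "apart X (push b Y n)" and aY: "apart Y (push b X n)"
    using apart_push[OF w a(2,1) XY] apart_push[OF w a(1,2)] XY by blast+
  note wX = push_wf[OF w a(1), of b] and wY = push_wf[OF w a(2), of b]
  show ?case
  proof (cases "meets X n \<and> meets Y n")
    case False
    then show ?thesis using meets_push[OF w a(2), of X b] meets_push[OF w a(1), of Y b] push_none by metis
  next
    case m: True
    show ?thesis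
    proof (cases "(\<exists>j. splits b X n j) \<and> (\<exists>j. splits b Y n j)")
      case False
      then show ?thesis
        using push_commute_stuck[OF w a XY, of b] push_commute_stuck[OF w a(2,1), of b] m XY by (metis Int_commute)
    next
      case True
      then obtain i j where i: "splits b X n i" and j: "splits b Y n j" by blast
      note VX = push_split_views[OF w a(1) i] and VY = push_split_views[OF w a(2) j]
      note pX = split_part_props[OF w a(1) i] and pY = split_part_props[OF w a(2) j]
      have mem: "i \<in> block_args b n" "j \<in> block_args b n" "meets X i" "meets Y j" using hit_mem i j by blast+
      show ?thesis
      proof (cases "i = j")
        case False
        have h: "hit b X n \<noteq> {j}" "hit b Y n \<noteq> {i}" using i j False unfolding splits_def by auto
        have i': "splits b X (push b Y n) i" using splits_after_split_neq[OF w a(2) j h(1)] i by blast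
        have j': "splits b Y (push b X n) j" using splits_after_split_neq[OF w a(1) i h(2)] j by blast
        have ne: "split_part b X i \<noteq> j" "split_part b Y j \<noteq> i"
          using replace_notin[OF w mem(1) pX(3) mem(2)] replace_notin[OF w mem(2) pY(3) mem(1)] False by auto
        show ?thesis
        proof (rule wf_eqI[where b = b])
          show "wf_bt (push b X (push b Y n))" "wf_bt (push b Y (push b X n))" 
            using push_wf[OF wY aX] push_wf[OF wX aY] by auto
          show "block_args b (push b X (push b Y n)) = block_args b (push b Y (push b X n))"
            unfolding push_split_views[OF wY aX i'] push_split_views[OF wX aY j'] VX VY
            using ne False by blast
        qed (simp add: push_split_views[OF wY aX i'] push_split_views[OF wX aY j'] VX VY)
      next
        case True
        have hX: "hit b X n = {j}" "hit b Y n = {j}" using i j True unfolding splits_def by auto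
        have i': "splits b X (push b Y n) (split_part b Y j)"
          using hit_replace[OF w mem(2) pY(3) VY(2), of X] mem hX True pY(5) unfolding splits_def by simp
        have j': "splits b Y (push b X n) (split_part b X j)"
          using hit_replace[OF w mem(1) pX(3) VX(2), of Y] mem hX True pX(5) unfolding splits_def by simp
        have wj: "wf_bt j" "binders j \<subseteq> binders n" using block_args_props[OF w mem(2)] by auto
        have "push b X (push b Y e) = push b Y (push b X e)" if e: "e \<in> parts (dual b) j" for e
        proof (rule less.hyps)
          show "card (leaves e) < card (leaves n)" using part_card_less[OF w mem(2) _ e] j unfolding splits_def by blast
          show "wf_bt e" using part_sub(1)[OF wj(1) e] .
          have "binders e \<subseteq> binders n" using part_sub(3)[OF wj(1) e] wj by blast
          then show "apart X e" "apart Y e" using a unfolding apart_def by blast+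
          show "X \<inter> Y = {}" by fact
        qed
        then have eq: "split_part b X (split_part b Y j) = split_part b Y (split_part b X j)"
          unfolding split_part_def[of b X "split_part b Y j"] split_part_def[of b Y "split_part b X j"]
          using pX(4) pY(4) True by (simp add: image_image)
        have rem: "insert (split_part b Z j) (block_args b n - {j}) - {split_part b Z j} = block_args b n - {j}"
          if "leaves (split_part b Z j) = leaves j" for Z
          using replace_notin[OF w mem(2) that] by blast
        show ?thesis
        proof (rule wf_eqI[where b = b])
          show "wf_bt (push b X (push b Y n))" "wf_bt (push b Y (push b X n))" 
            using push_wf[OF wY aX] push_wf[OF wX aY] by auto
          show "block_args b (push b X (push b Y n)) = block_args b (push b Y (push b X n))"
            unfolding push_split_views[OF wY aX i'] push_split_views[OF wX aY j'] VX VY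
            using rem pX(3) pY(3) True eq by simp
        qed (simp add: push_split_views[OF wY aX i'] push_split_views[OF wX aY j'] VX VY)
      qed
    qed
  qed
qed

section \<open>Compatibility of pushing with P and S\<close>

lemma push_parts:
  assumes w: "wf_bt n" and a: "apart X n"
  shows "push b X n = join (dual b) (push b X ` parts (dual b) n)"
proof (cases "parts (dual b) n = {n}")
  case True
  then show ?thesis using join_single[OF push_wf[OF w a]] by simp
next
  case False
  then have "is_block (dual b) n" using parts_not_block by blast
  then have nb: "\<not> is_block b n" using is_block_dual by fastforce
  note v = view_not_block[OF nb]
  show ?thesis
  proof (cases "meets X n")
    case True
    \<comment> \<open>A block of the other kind is the sole argument of its \<open>b\<close>-view,
      so it is itself the argument to be split.\<close>
    then have s: "splits b X n n" using v False unfolding splits_def hit_def by auto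
    have "push b X n = mk_block b {} {split_part b X n}" using push_split[OF w s] v by simp
    then show ?thesis unfolding split_part_def mk_block_def by simp
  next
    case F: False
    have "push b X e = e" if e: "e \<in> parts (dual b) n" for e
      using part_sub(2)[OF w e] F unfolding meets_def by (intro push_none) (auto simp: meets_def)
    then have "push b X ` parts (dual b) n = parts (dual b) n" by force
    then show ?thesis using push_none[OF F] join_parts[OF w] by metis
  qed
qed

lemma apart_join: "family S \<Longrightarrow> apart X (join b S) \<longleftrightarrow> (\<forall>s\<in>S. apart X s)"
  unfolding apart_def by (auto simp: family_join)

text \<open>The tree form of S. Both sides are the combination of all pushed parts of
  \<open>n\<close> and of \<open>m\<close>, because parts are additive over joins.\<close>

lemma push_join_dual:
  assumes f: "family {n, m}" and a: "apart X n" "apart X m"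
  shows "push b X (join (dual b) {n, m}) = join (dual b) {push b X n, push b X m}"
proof -
  let ?d = "dual b" and ?p = "push b X"
  have wnm: "wf_bt n" "wf_bt m" using f unfolding family_def by auto
  let ?j = "join ?d {n, m}"
  have aj: "apart X ?j" using apart_join[OF f] a by blast
  have pj: "parts ?d ?j = parts ?d n \<union> parts ?d m" using parts_join[OF f, of ?d] by simp
  have fam: "family (?p ` parts ?d ?j)"
  proof (rule family_image(1)[OF family_parts[OF family_join(1)[OF f]]])
    fix e assume e: "e \<in> parts ?d ?j"
    then have "apart X e" "wf_bt e" using part_sub[OF family_join(1)[OF f]] aj unfolding apart_def by blast+
    then show "wf_bt (?p e) \<and> leaves (?p e) = leaves e" using push_wf push_leaves by blast
  qed
  have ne: "parts ?d n \<noteq> {}" "parts ?d m \<noteq> {}" using family_parts[OF wnm(1)] family_parts[OF wnm(2)] unfolding family_def by blast+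
  have "?p ?j = join ?d (?p ` parts ?d n \<union> ?p ` parts ?d m)"
    unfolding push_parts[OF family_join(1)[OF f] aj] pj image_Un ..
  also have "\<dots> = join ?d {join ?d (?p ` parts ?d n), join ?d (?p ` parts ?d m)}"
    by (rule join_Un) (use fam ne in \<open>auto simp: pj image_Un\<close>)
  also have "\<dots> = join ?d {?p n, ?p m}"
    using push_parts[OF wnm(1) a(1)] push_parts[OF wnm(2) a(2)] by simp
  finally show ?thesis .
qed

text \<open>The tree form of P. As \<open>X\<close> misses \<open>m\<close>, it hits the same
  arguments in the join as in \<open>n\<close>, so the same branch of \<open>push\<close> is
  taken.\<close>

lemma push_join_same:
  assumes f: "family {n, m}" and nm: "n \<noteq> m" and a: "apart X n" "apart X m" and X: "\<not> meets X m"
  shows "push b X (join b {n, m}) = join b {push b X n, m}"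
proof -
  let ?j = "join b {n, m}"
  have wnm: "wf_bt n" "wf_bt m" and dj: "leaves n \<inter> leaves m = {}" using f nm unfolding family_def disj_leaves_def by auto
  note J = family_join[OF f, of b]
  have aj: "apart X ?j" using apart_join[OF f] a by blast
  have lp: "leaves (push b X n) = leaves n" using push_leaves[OF wnm(1) a(1)] .
  have f': "family {push b X n, m}"
    using push_wf[OF wnm(1) a(1), of b] wnm dj lp unfolding family_def disj_leaves_def by auto
  note J' = family_join[OF f', of b]
  have hit: "hit b X ?j = hit b X n"
    unfolding hit_def J using X meets_leaves[of X m b] by auto
  show ?thesis
  proof (cases "meets X n")
    case False
    then have "\<not> meets X ?j" using X unfolding meets_def J by auto
    then show ?thesis using False push_none by metis
  next
    case m: True
    then have mj: "meets X ?j" unfolding meets_def J by auto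
    show ?thesis
    proof (rule wf_eqI[where b = b])
      show "wf_bt (push b X ?j)" "wf_bt (join b {push b X n, m})" using push_wf[OF J(1) aj] J'(1) by auto
    next
      show "block_binders b (push b X ?j) = block_binders b (join b {push b X n, m})"
      proof (cases "\<exists>i. splits b X n i")
        case True
        then obtain i where i: "splits b X n i" by blast
        then have i': "splits b X ?j i" unfolding splits_def hit .
        show ?thesis using push_split_views[OF J(1) aj i'] push_split_views[OF wnm(1) a(1) i] J J' by simp
      next
        case False
        then have s: "\<nexists>i. splits b X ?j i" unfolding splits_def hit .
        have "restrict_to X ?j = restrict_to X n" using X unfolding restrict_to_def J meets_def by auto
        then show ?thesis
          using push_stuck_views[OF J(1) aj mj s] push_stuck_views[OF wnm(1) a(1) m False] J J' by simp
      qed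
      show "block_args b (push b X ?j) = block_args b (join b {push b X n, m})"
      proof (cases "\<exists>i. splits b X n i")
        case True
        then obtain i where i: "splits b X n i" by blast
        then have i': "splits b X ?j i" unfolding splits_def hit .
        have "i \<in> block_args b n" using hit_mem[OF i] by blast
        then have "i \<notin> block_args b m" using view_leaves(1)[OF wnm(1)] view_leaves(1)[OF wnm(2)] dj leaves_nonempty[OF block_args_props(1)[OF wnm(1)]] by blast
        then show ?thesis using push_split_views[OF J(1) aj i'] push_split_views[OF wnm(1) a(1) i] J J' by auto
      next
        case False
        then have s: "\<nexists>i. splits b X ?j i" unfolding splits_def hit .
        then show ?thesis
          using push_stuck_views[OF J(1) aj mj s] push_stuck_views[OF wnm(1) a(1) m False] J J' by simp
      qed
    qed
  qed
qed

section \<open>Evaluation of linear formulas\<close>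

text \<open>A tree sees a binder only through the positions at its own atoms. For S this allows both
  copies of a quantifier to be pushed with the binder of the original.\<close>

lemma push_cong:
  assumes "wf_bt n" "restrict_to X n = restrict_to Y n" shows "push b X n = push b Y n"
  using assms
proof (induction "card (leaves n)" arbitrary: n rule: less_induct)
  case less
  note w = less.prems(1)
  have override: "restrict_to X m = restrict_to Y m" if "leaves m \<subseteq> leaves n" for m
    using less.prems(2) that unfolding restrict_to_def by blast
  have meets: "meets X m = meets Y m" if "leaves m \<subseteq> leaves n" for m
    using override[OF that] unfolding meets_def restrict_to_def by blast
  have hit: "hit b X n = hit b Y n"
    unfolding hit_def using meets view_leaves(1)[OF w] by blast
  then have s: "splits b X n = splits b Y n" unfolding splits_def by simp
  show ?case
  proof (cases "\<exists>j. splits b X n j")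
    case True
    then obtain j where j: "splits b X n j" by blast
    then have j': "splits b Y n j" using s by simp
    have mj: "j \<in> block_args b n" using hit_mem[OF j] by blast
    note bj = block_args_props[OF w mj]
    have "push b X e = push b Y e" if e: "e \<in> parts (dual b) j" for e
      using less.hyps[OF part_card_less[OF w mj _ e] part_sub(1)[OF bj(1) e] override] 
        j part_sub(2)[OF bj(1) e] bj(3) unfolding splits_def by blast
    then have "split_part b X j = split_part b Y j" unfolding split_part_def by (metis image_cong)
    then show ?thesis using push_split[OF w j] push_split[OF w j'] by simp
  next
    case F: False
    then have F': "\<nexists>j. splits b Y n j" using s by simp
    show ?thesis
    proof (cases "meets X n")
      case True
      then show ?thesis using push_stuck[OF True F] push_stuck[OF _ F'] meets[of n] less.prems(2) by simp
    next
      case False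
      then show ?thesis using push_none[OF False] push_none[of Y n] meets[of n] by simp
    qed
  qed
qed

lemma push_empty: "push b {} n = n"
  by (rule push_none) (simp add: meets_def)

section \<open>From linear formulas to trees\<close>

fun bop_of :: "quant \<Rightarrow> bop" where "bop_of Exists = Conj" | "bop_of Forall = Disj"

text \<open>The binder denoted by a quantifier on \<open>x\<close> in front of the formula.\<close>

fun occ :: "'v \<Rightarrow> ('r, 'v) fm \<Rightarrow> ('r \<times> nat) set" where
  "occ x (Atom R vs) = {(R, i) | i. i < length vs \<and> vs ! i = x}"
| "occ x (Neg F) = occ x F"
| "occ x (Bin b F G) = occ x F \<union> occ x G"
| "occ x (Quant Q y F) = (if y = x then {} else occ x F)"

fun rels :: "('r, 'v) fm \<Rightarrow> 'r set" where
  "rels (Atom R vs) = {R}"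
| "rels (Neg F) = rels F"
| "rels (Bin b F G) = rels F \<union> rels G"
| "rels (Quant Q y F) = rels F"

fun linear :: "('r, 'v) fm \<Rightarrow> bool" where
  "linear (Atom R vs) \<longleftrightarrow> True"
| "linear (Neg F) \<longleftrightarrow> linear F"
| "linear (Bin b F G) \<longleftrightarrow> linear F \<and> linear G \<and> rels F \<inter> rels G = {}"
| "linear (Quant Q y F) \<longleftrightarrow> linear F"

text \<open>The clause for \<open>Neg\<close> is a default that keeps invariance valid for steps
  below a negation; formulas of \<open>PFO\<close> never reach it.\<close>

fun tree_of :: "('r, 'v) fm \<Rightarrow> 'r bt" where
  "tree_of (Atom R vs) = Leaf R"
| "tree_of (Neg F) = tree_of F"
| "tree_of (Bin b F G) = join b {tree_of F, tree_of G}"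
| "tree_of (Quant Q x F) = push (bop_of Q) (occ x F) (tree_of F)"

lemma occ_empty: "occ x F = {} \<longleftrightarrow> x \<notin> free F"
  by (induction F) (auto simp: in_set_conv_nth)

lemma occ_rels: "fst ` occ x F \<subseteq> rels F"
  by (induction F) auto

lemma occ_disjoint: "linear F \<Longrightarrow> x \<noteq> y \<Longrightarrow> occ x F \<inter> occ y F = {}"
proof (induction F)
  case (Bin b F G)
  have 1: "occ u F \<inter> occ w G = {}" for u w
    using occ_rels[of u F] occ_rels[of w G] Bin.prems(1) by (auto simp: disjoint_iff image_subset_iff)
  have 2: "occ x F \<inter> occ y F = {}" "occ x G \<inter> occ y G = {}" using Bin by auto
  then show ?case using 1[of x y] 1[of y x] by (simp add: Int_Un_distrib Int_Un_distrib2 Int_commute)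
qed auto

text \<open>The last conjunct says that free occurrences are not bound inside; it supplies the
  \<open>apart\<close> condition required for pushing.\<close>

lemma tree_of_props:
  assumes "linear F"
  shows "wf_bt (tree_of F) \<and> leaves (tree_of F) = rels F \<and> (\<forall>Y\<in>binders (tree_of F). \<forall>x. occ x F \<inter> Y = {})"
  using assms
proof (induction F)
  case (Atom R vs)
  then show ?case by (simp add: wf_bt.intros)
next
  case (Neg F)
  then show ?case by simp
next
  case (Bin b F G)
  then have f: "family {tree_of F, tree_of G}" unfolding family_def disj_leaves_def by auto
  have "fst ` Y \<subseteq> rels F \<and> (\<forall>x. occ x F \<inter> Y = {})" if "Y \<in> binders (tree_of F)" for Y
    using binders_leaves[of "tree_of F" Y] Bin that by auto
  moreover have "fst ` Y \<subseteq> rels G \<and> (\<forall>x. occ x G \<inter> Y = {})" if "Y \<in> binders (tree_of G)" for Y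
    using binders_leaves[of "tree_of G" Y] Bin that by auto
  moreover have "occ x F \<inter> Y = {}" if "fst ` Y \<subseteq> rels G" for x Y
    using occ_rels[of x F] that Bin.prems by (auto simp: disjoint_iff image_subset_iff)
  moreover have "occ x G \<inter> Y = {}" if "fst ` Y \<subseteq> rels F" for x Y
    using occ_rels[of x G] that Bin.prems by (auto simp: disjoint_iff image_subset_iff)
  ultimately have "\<forall>Y\<in>binders (tree_of F) \<union> binders (tree_of G). \<forall>x. (occ x F \<union> occ x G) \<inter> Y = {}"
    by (simp add: Int_Un_distrib2 ball_Un)
  then show ?case using family_join[OF f, of b] Bin by simp
next
  case (Quant Q x F)
  then have IH: "wf_bt (tree_of F)" "leaves (tree_of F) = rels F" "\<forall>Y\<in>binders (tree_of F). \<forall>x. occ x F \<inter> Y = {}" by auto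
  then have a: "apart (occ x F) (tree_of F)" unfolding apart_def by blast
  have "occ y F \<inter> Y = {}" if Y: "Y \<in> binders (push (bop_of Q) (occ x F) (tree_of F))" and "x \<noteq> y" for y Y
    using push_binders[OF IH(1) a Y] IH(3) occ_disjoint[of F x y] that Quant.prems by auto
  then show ?case using push_wf[OF IH(1) a] push_leaves[OF IH(1) a] IH(2) by auto
qed

lemma tree_of_wf: "linear F \<Longrightarrow> wf_bt (tree_of F)" and tree_of_leaves: "linear F \<Longrightarrow> leaves (tree_of F) = rels F"
  and tree_of_apart: "linear F \<Longrightarrow> apart (occ x F) (tree_of F)"
  using tree_of_props[of F] unfolding apart_def by auto

lemma rels_nonempty: "rels F \<noteq> {}"
  by (induction F) auto

lemma tree_of_family: 
  assumes "linear (Bin b F G)" shows "family {tree_of F, tree_of G}" "tree_of F \<noteq> tree_of G"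
  using assms tree_of_wf[of F] tree_of_wf[of G] tree_of_leaves[of F] tree_of_leaves[of G] rels_nonempty[of G]
  unfolding family_def disj_leaves_def by auto

lemma replace_self: "x \<notin> free F \<Longrightarrow> replace x y F = F"
  by (induction F) (auto intro!: map_idI)

lemma occ_replace:
  assumes "y \<notin> free F" "free_for y x F"
  shows "occ z (replace x y F) = (if z = y then (if x = y then {} else occ x F) else if z = x then {} else occ z F)"
  using assms
proof (induction F)
  case (Atom R vs)
  then have "vs ! i \<noteq> y" if "i < length vs" for i using that by auto
  then show ?case by (auto split: if_splits)
next
  case (Quant Q u F)
  show ?case
  proof (cases "x \<in> free (Quant Q u F)")
    case False
    then show ?thesis using Quant.prems occ_empty[of x "Quant Q u F"] occ_empty[of y "Quant Q u F"] 
      by (auto simp: replace_self)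
  next
    case True
    then show ?thesis using Quant occ_empty[of x F] occ_empty[of y F] by (auto split: if_splits)
  qed
qed (auto simp: occ_empty)

lemma rels_replace [simp]: "rels (replace x y F) = rels F"
  by (induction F) auto

lemma linear_replace [simp]: "linear (replace x y F) \<longleftrightarrow> linear F"
  by (induction F) auto

text \<open>Free variables leave no trace in the tree, and in the absence of capture the inner
  quantifiers bind the same positions as before.\<close>

lemma tree_of_replace:
  assumes "y \<notin> free F" "free_for y x F" shows "tree_of (replace x y F) = tree_of F"
  using assms
proof (induction F)
  case (Quant Q u F)
  show ?case
  proof (cases "x \<in> free (Quant Q u F)")
    case False
    then show ?thesis by (subst replace_self) auto
  next
    case True
    then show ?thesis using Quant occ_replace[of y F x u] by (auto split: if_splits)
  qed
qed auto

lemma join_assoc: 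
  assumes "family {n, m, k}" shows "join b {n, join b {m, k}} = join b {join b {n, m}, k}"
proof -
  have "family {m, k}" "family {n, m}" using family_subset[OF assms] by auto
  then show ?thesis unfolding join_def[of b "{n, join b {m, k}}"] join_def[of b "{join b {n, m}, k}"]
    by (simp add: family_join Un_assoc)
qed

lemma apart_disj: "wf_bt n \<Longrightarrow> fst ` X \<inter> leaves n = {} \<Longrightarrow> apart X n"
  unfolding apart_def using binders_leaves by blast

lemma tree_of_pull:
  assumes l: "linear (Bin b F G)" and x: "x \<notin> free G" and b: "b = bop_of Q"
  shows "tree_of (Quant Q x (Bin b F G)) = tree_of (Bin b (Quant Q x F) G)"
proof -
  have lFG: "linear F" "linear G" "rels F \<inter> rels G = {}" using l by auto
  have "fst ` occ x F \<inter> leaves (tree_of G) = {}" using occ_rels[of x F] tree_of_leaves[OF lFG(2)] lFG(3) by blast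
  then have "\<not> meets (occ x F) (tree_of G)" "apart (occ x F) (tree_of G)"
    using apart_disj[OF tree_of_wf[OF lFG(2)]] unfolding meets_def by auto
  moreover have "occ x G = {}" using x occ_empty[of x G] by simp
  ultimately show ?thesis
    using push_join_same[OF tree_of_family[OF l] tree_of_apart[OF lFG(1)]] b by simp
qed

lemma apart_Un: "apart X n \<Longrightarrow> apart Y n \<Longrightarrow> apart (X \<union> Y) n"
  unfolding apart_def by (simp add: Int_Un_distrib2)

lemma tree_of_distrib:
  assumes l: "linear (Bin b F G)" and b: "b = dual (bop_of Q)"
  shows "tree_of (Quant Q x (Bin b F G)) = tree_of (Bin b (Quant Q x F) (Quant Q x G))"
proof -
  have lFG: "linear F" "linear G" "rels F \<inter> rels G = {}" using l by auto
  let ?X = "occ x F \<union> occ x G"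
  have r: "restrict_to ?X (tree_of F) = restrict_to (occ x F) (tree_of F)" "restrict_to ?X (tree_of G) = restrict_to (occ x G) (tree_of G)"
    using occ_rels[of x F] occ_rels[of x G] tree_of_leaves[OF lFG(1)] tree_of_leaves[OF lFG(2)] lFG(3)
    unfolding restrict_to_def by (auto simp: disjoint_iff image_subset_iff)
  have "fst ` occ x F \<inter> leaves (tree_of G) = {}"
    using occ_rels[of x F] lFG(3) unfolding tree_of_leaves[OF lFG(2)] by blast
  then have 1: "apart (occ x F) (tree_of G)" by (rule apart_disj[OF tree_of_wf[OF lFG(2)]])
  have "fst ` occ x G \<inter> leaves (tree_of F) = {}"
    using occ_rels[of x G] lFG(3) unfolding tree_of_leaves[OF lFG(1)] by blast
  then have 2: "apart (occ x G) (tree_of F)" by (rule apart_disj[OF tree_of_wf[OF lFG(1)]])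
  have "apart ?X (tree_of F)" "apart ?X (tree_of G)"
    using apart_Un[OF tree_of_apart[OF lFG(1)] 2] apart_Un[OF 1 tree_of_apart[OF lFG(2)]] by auto
  then have "push (bop_of Q) ?X (join b {tree_of F, tree_of G}) = join b {push (bop_of Q) ?X (tree_of F), push (bop_of Q) ?X (tree_of G)}"
    unfolding b by (rule push_join_dual[OF tree_of_family(1)[OF l]])
  then show ?thesis
    using push_cong[OF tree_of_wf[OF lFG(1)] r(1)] push_cong[OF tree_of_wf[OF lFG(2)] r(2)] by simp
qed

text \<open>A and C disappear in the sets, O is commutation of pushes, P and S are the two facts
  about \<open>push\<close> and \<open>join\<close>, M pushes the empty binder, and N keeps
  positions. Atoms and occurrences are included in the statement because the surrounding formula
  depends on them when the step takes place inside it.\<close>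

lemma root_step_tree_of:
  assumes "root_step r F G"
  shows "(linear F \<longleftrightarrow> linear G) \<and> rels F = rels G \<and> (\<forall>z. occ z F = occ z G) \<and> (linear F \<longrightarrow> tree_of F = tree_of G)"
  using assms
proof (induction rule: root_step.induct)
  case (A_left b F1 F2 F3)
  have "tree_of (Bin b F1 (Bin b F2 F3)) = tree_of (Bin b (Bin b F1 F2) F3)" if "linear (Bin b F1 (Bin b F2 F3))"
  proof -
    have "family {tree_of F1, tree_of F2, tree_of F3}"
      using that tree_of_wf[of F1] tree_of_wf[of F2] tree_of_wf[of F3] tree_of_leaves[of F1] tree_of_leaves[of F2] tree_of_leaves[of F3]
      unfolding family_def disj_leaves_def by auto
    then show ?thesis using join_assoc by simp
  qed
  then show ?case by (auto simp: Int_Un_distrib Int_Un_distrib2)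
next
  case (A_right b F1 F2 F3)
  have "tree_of (Bin b F1 (Bin b F2 F3)) = tree_of (Bin b (Bin b F1 F2) F3)" if "linear (Bin b F1 (Bin b F2 F3))"
  proof -
    have "family {tree_of F1, tree_of F2, tree_of F3}"
      using that tree_of_wf[of F1] tree_of_wf[of F2] tree_of_wf[of F3] tree_of_leaves[of F1] tree_of_leaves[of F2] tree_of_leaves[of F3]
      unfolding family_def disj_leaves_def by auto
    then show ?thesis using join_assoc by simp
  qed
  then show ?case by (auto simp: Int_Un_distrib Int_Un_distrib2)
next
  case (C b F1 F2)
  then show ?case by (auto simp: insert_commute)
next
  case (O Q x y F)
  have "tree_of (Quant Q x (Quant Q y F)) = tree_of (Quant Q y (Quant Q x F))" if l: "linear F"
  \<comment> \<open>For \<open>x = y\<close> both sides are the same formula; otherwise the two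
    binders are disjoint, as commutation requires.\<close>
  proof (cases "x = y")
    case False
    then show ?thesis 
      using push_commute[OF tree_of_wf[OF l] tree_of_apart[OF l] tree_of_apart[OF l] occ_disjoint[OF l False]] by simp
  qed simp
  then show ?case by auto
next
  case (Pdown_Exists x F2 F1)
  then show ?case using tree_of_pull[of Conj F1 F2 x Exists] occ_empty[of x F2] by auto
next
  case (Pdown_Forall x F2 F1)
  then show ?case using tree_of_pull[of Disj F1 F2 x Forall] occ_empty[of x F2] by auto
next
  case (Pup F G)
  then show ?case by auto
next
  case (N y F x Q)
  then show ?case using occ_replace[OF N] tree_of_replace[OF N] occ_empty[of y F] by auto
next
  case (Sdown_Exists x F1 F2)
  then show ?case using tree_of_distrib[of Disj F1 F2 Exists x] by auto
next
  case (Sdown_Forall x F1 F2)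
  then show ?case using tree_of_distrib[of Conj F1 F2 Forall x] by auto
next
  case (M x F Q)
  then show ?case using occ_empty[of x F] by (auto simp: push_empty)
qed

lemma rewrite_tree_of:
  assumes "rewrite R F G"
  shows "(linear F \<longleftrightarrow> linear G) \<and> rels F = rels G \<and> (\<forall>z. occ z F = occ z G) \<and> (linear F \<longrightarrow> tree_of F = tree_of G)"
  using assms
proof (induction rule: rewrite.induct)
  case (root r F G)
  then show ?case using root_step_tree_of by blast
qed auto

section \<open>Equational reasoning modulo T\<close>

lemma rewrite_mono: "rewrite R F G \<Longrightarrow> R \<subseteq> S \<Longrightarrow> rewrite S F G"
  by (induction rule: rewrite.induct) (auto intro: rewrite.intros)

lemma rewrite_Un: "rewrite (R \<union> S) F G \<Longrightarrow> rewrite R F G \<or> rewrite S F G"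
  by (induction rule: rewrite.induct) (auto intro: rewrite.intros)

lemma replace_id: "replace x x F = F"
  by (induction F) (auto intro: map_idI)

lemma free_replace:
  "free_for y x F \<Longrightarrow> free (replace x y F) = (if x \<in> free F then insert y (free F - {x}) else free F)"
proof (induction F)
  case (Quant Q z F)
  show ?case
  proof (cases "x \<in> free (Quant Q z F)")
    case True
    then show ?thesis using Quant by auto
  next
    case False
    then show ?thesis by (subst replace_self) auto
  qed
qed auto

lemma replace_back:
  assumes "y \<notin> free F" "free_for y x F" "x \<noteq> y"
  shows "replace y x (replace x y F) = F \<and> free_for x y (replace x y F)"
  using assms(1,2)
proof (induction F)
  case (Atom R vs)
  then show ?case by (auto intro: map_idI)
next
  case (Quant Q z F)
  show ?case
  proof (cases "x \<in> free (Quant Q z F)")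
    case True
    then show ?thesis using Quant assms(3) by auto
  next
    case False
    then show ?thesis using Quant.prems assms(3) by (auto simp: replace_self)
  qed
qed auto

text \<open>After the renaming \<open>x\<close> is no longer free, and none of the occurrences of
  \<open>y\<close> lies under a quantifier on \<open>x\<close>, so the side conditions of N hold in
  the other direction as well.\<close>

lemma root_N_sym:
  assumes "y \<notin> free F" "free_for y x F"
  shows "root_step rule_N (Quant Q y (replace x y F)) (Quant Q x F)"
proof (cases "x = y")
  case True
  then show ?thesis using root_step.N[OF assms, of Q] by (simp add: replace_id)
next
  case False
  have "x \<notin> free (replace x y F)" using free_replace[OF assms(2)] False by auto
  then have "root_step rule_N (Quant Q y (replace x y F)) (Quant Q x (replace y x (replace x y F)))"
    using replace_back[OF assms False] by (intro root_step.N) auto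
  then show ?thesis using replace_back[OF assms False] by simp
qed

lemma rules_T_mem:
  "rule_A \<in> rules_T" "rule_C \<in> rules_T" "rule_O \<in> rules_T" "rule_Pdown \<in> rules_T"
  "rule_Pup \<in> rules_T" "rule_N \<in> rules_T"
  unfolding rules_T_def by simp_all

lemma rules_T_not_mem: "rule_Sdown \<notin> rules_T" "rule_M \<notin> rules_T"
  unfolding rules_T_def by simp_all

lemma root_step_T_sym:
  assumes "root_step r F G" "r \<in> rules_T" shows "\<exists>r'\<in>rules_T. root_step r' G F"
proof -
  note in_T = rules_T_mem and not_T = rules_T_not_mem
  from assms(1) show ?thesis
  proof cases
    case A_left then show ?thesis using root_step.A_right in_T(1) by metis
  next
    case A_right then show ?thesis using root_step.A_left in_T(1) by metis
  next
    case C then show ?thesis using root_step.C in_T(2) by metis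
  next
    case O then show ?thesis using root_step.O in_T(3) by metis
  next
    case Pdown_Exists then show ?thesis using assms(1) root_step.Pup in_T(5) by metis
  next
    case Pdown_Forall then show ?thesis using assms(1) root_step.Pup in_T(5) by metis
  next
    case Pup then show ?thesis using in_T(4) by metis
  next
    case (N y F x Q) then show ?thesis using root_N_sym in_T(6) by metis
  qed (use assms(2) not_T in auto)
qed

text \<open>Every rule of T is undone by a rule of T. Hence the reflexive-transitive closure alone
  is already the equivalence modulo T.\<close>

lemma rewrite_T_sym: "rewrite rules_T F G \<Longrightarrow> rewrite rules_T G F"
proof (induction rule: rewrite.induct)
  case (root r F G)
  then show ?case using root_step_T_sym rewrite.root by blast
qed (auto intro: rewrite.intros)

abbreviation eqT :: "('r, 'v) fm \<Rightarrow> ('r, 'v) fm \<Rightarrow> bool" (infix "\<approx>" 50) where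
  "F \<approx> G \<equiv> (rewrite rules_T)\<^sup>*\<^sup>* F G"

abbreviation red :: "('r, 'v) fm \<Rightarrow> ('r, 'v) fm \<Rightarrow> bool" (infix "\<leadsto>" 50) where
  "F \<leadsto> G \<equiv> (rewrite (rules_T \<union> {rule_Sdown, rule_M}))\<^sup>*\<^sup>* F G"

lemma eqT_sym: "F \<approx> G \<Longrightarrow> G \<approx> F"
  by (induction rule: rtranclp_induct) (auto intro: converse_rtranclp_into_rtranclp rewrite_T_sym)

lemma eqT_red: "F \<approx> G \<Longrightarrow> F \<leadsto> G"
  by (rule rtranclp_mono[THEN predicate2D]) (auto intro: rewrite_mono)

lemma rtrancl_Bin_left: "(rewrite R)\<^sup>*\<^sup>* F G \<Longrightarrow> (rewrite R)\<^sup>*\<^sup>* (Bin b F H) (Bin b G H)"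
  by (induction rule: rtranclp_induct) (auto intro: rtranclp.rtrancl_into_rtrancl in_Bin_left)

lemma rtrancl_Bin_right: "(rewrite R)\<^sup>*\<^sup>* F G \<Longrightarrow> (rewrite R)\<^sup>*\<^sup>* (Bin b H F) (Bin b H G)"
  by (induction rule: rtranclp_induct) (auto intro: rtranclp.rtrancl_into_rtrancl in_Bin_right)

lemma rtrancl_Bin: 
  "(rewrite R)\<^sup>*\<^sup>* F F' \<Longrightarrow> (rewrite R)\<^sup>*\<^sup>* G G' \<Longrightarrow> (rewrite R)\<^sup>*\<^sup>* (Bin b F G) (Bin b F' G')"
  using rtranclp_trans[OF rtrancl_Bin_left rtrancl_Bin_right] .

lemma rtrancl_Quant: "(rewrite R)\<^sup>*\<^sup>* F G \<Longrightarrow> (rewrite R)\<^sup>*\<^sup>* (Quant Q x F) (Quant Q x G)"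
  by (induction rule: rtranclp_induct) (auto intro: rtranclp.rtrancl_into_rtrancl in_Quant)

lemma eqT_root: "root_step r F G \<Longrightarrow> r \<in> rules_T \<Longrightarrow> F \<approx> G"
  by (blast intro: rewrite.root)

lemma eqT_assoc: "Bin b (Bin b F G) H \<approx> Bin b F (Bin b G H)"
  by (rule eqT_root[OF root_step.A_right rules_T_mem(1)])

lemma eqT_comm: "Bin b F G \<approx> Bin b G F"
  by (rule eqT_root[OF root_step.C rules_T_mem(2)])

lemma eqT_swap: "Quant Q x (Quant Q y F) \<approx> Quant Q y (Quant Q x F)"
  by (rule eqT_root[OF root_step.O rules_T_mem(3)])

lemma eqT_pull:
  "x \<notin> free G \<Longrightarrow> Quant Q x (Bin (bop_of Q) F G) \<approx> Bin (bop_of Q) (Quant Q x F) G"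
  using eqT_root[OF root_step.Pdown_Exists] eqT_root[OF root_step.Pdown_Forall]
  by (cases Q) (simp_all add: rules_T_mem)

lemma eqT_rename:
  "y \<notin> free F \<Longrightarrow> free_for y x F \<Longrightarrow> Quant Q x F \<approx> Quant Q y (replace x y F)"
  by (rule eqT_root[OF root_step.N rules_T_mem(6)])

lemma red_distrib:
  "Quant Q x (Bin (dual (bop_of Q)) F G) \<leadsto> Bin (dual (bop_of Q)) (Quant Q x F) (Quant Q x G)"
proof (rule r_into_rtranclp, rule rewrite.root[where r = rule_Sdown])
  show "root_step rule_Sdown (Quant Q x (Bin (dual (bop_of Q)) F G))
    (Bin (dual (bop_of Q)) (Quant Q x F) (Quant Q x G))"
    by (cases Q) (simp_all add: root_step.Sdown_Exists root_step.Sdown_Forall)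
qed simp

lemma red_M: "x \<notin> free F \<Longrightarrow> Quant Q x F \<leadsto> F"
  by (rule r_into_rtranclp, rule rewrite.root[OF _ root_step.M]) auto

section \<open>Iterated connectives and quantifier prefixes\<close>

fun big :: "bop \<Rightarrow> ('r, 'v) fm list \<Rightarrow> ('r, 'v) fm" where
  "big b [] = undefined"
| "big b [F] = F"
| "big b (F # G # Fs) = Bin b F (big b (G # Fs))"

lemma big_Cons: "Fs \<noteq> [] \<Longrightarrow> big b (F # Fs) = Bin b F (big b Fs)"
  by (cases Fs) auto

lemma big_append: "Fs \<noteq> [] \<Longrightarrow> Gs \<noteq> [] \<Longrightarrow> big b (Fs @ Gs) \<approx> Bin b (big b Fs) (big b Gs)"
proof (induction Fs rule: list_nonempty_induct)
  case (single F)
  then show ?case by (simp add: big_Cons)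
next
  case (cons F Fs)
  then have "big b ((F # Fs) @ Gs) \<approx> Bin b F (Bin b (big b Fs) (big b Gs))"
    by (simp add: big_Cons rtrancl_Bin_right)
  also have "\<dots> \<approx> Bin b (big b (F # Fs)) (big b Gs)"
    using cons by (simp add: big_Cons eqT_sym[OF eqT_assoc])
  finally show ?case .
qed

lemma big_perm: "mset Fs = mset Gs \<Longrightarrow> Fs \<noteq> [] \<Longrightarrow> big b Fs \<approx> big b Gs"
proof (induction Fs arbitrary: Gs)
  case (Cons F Fs)
  have "F \<in> set Gs" using mset_eq_setD[OF Cons.prems(1)] by auto
  then obtain A B where G: "Gs = A @ F # B" by (meson split_list)
  then have m: "mset Fs = mset (A @ B)" using Cons.prems by simp
  show ?case
  proof (cases "Fs = []")
    case True
    then show ?thesis using m G by simp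
  next
    case False
    then have ne: "A @ B \<noteq> []" using m by auto
    have IH: "big b Fs \<approx> big b (A @ B)" using Cons.IH[OF m False] .
    have "big b (F # A @ B) \<approx> big b (A @ F # B)"
    proof (cases "A = []")
      case A: False
      have "big b (F # A @ B) = big b ([F] @ A @ B)" by simp
      show ?thesis
      proof (cases "B = []")
        case True
        have "big b (F # A) \<approx> Bin b (big b A) F" using A eqT_comm by (simp add: big_Cons)
        also have "\<dots> \<approx> big b (A @ [F])" using eqT_sym[OF big_append[OF A, of "[F]" b]] by simp
        finally show ?thesis using True by simp
      next
        case B: False
        have "big b (F # A @ B) \<approx> Bin b F (Bin b (big b A) (big b B))"
          using big_append[OF A B] by (simp add: big_Cons A rtrancl_Bin_right)
        also have "\<dots> \<approx> Bin b (Bin b F (big b A)) (big b B)" by (rule eqT_sym[OF eqT_assoc])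
        also have "\<dots> \<approx> Bin b (Bin b (big b A) F) (big b B)" by (rule rtrancl_Bin_left[OF eqT_comm])
        also have "\<dots> \<approx> Bin b (big b A) (Bin b F (big b B))" by (rule eqT_assoc)
        also have "\<dots> \<approx> big b (A @ F # B)"
          using eqT_sym[OF big_append[OF A, of "F # B" b]] B by (simp add: big_Cons)
        finally show ?thesis .
      qed
    qed simp
    then show ?thesis
      using rtranclp_trans[OF rtrancl_Bin_right[OF IH, of b F]] False ne G by (simp add: big_Cons)
  qed
qed simp

lemma big_cong:
  assumes "\<And>c. c \<in> set cs \<Longrightarrow> (rewrite R)\<^sup>*\<^sup>* (f c) (g c)"
  shows "(rewrite R)\<^sup>*\<^sup>* (big b (map f cs)) (big b (map g cs))"
  using assms
proof (induction cs)
  case (Cons c cs)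
  then show ?case by (cases cs) (auto intro!: rtrancl_Bin)
qed simp

lemma free_big: "Fs \<noteq> [] \<Longrightarrow> free (big b Fs) = \<Union> (free ` set Fs)"
  by (induction Fs rule: list_nonempty_induct) (auto simp: big_Cons)

lemma replace_big: "Fs \<noteq> [] \<Longrightarrow> replace x y (big b Fs) = big b (map (replace x y) Fs)"
  by (induction Fs rule: list_nonempty_induct) (auto simp: big_Cons)

lemma free_for_big: "Fs \<noteq> [] \<Longrightarrow> free_for y x (big b Fs) \<longleftrightarrow> (\<forall>F\<in>set Fs. free_for y x F)"
  by (induction Fs rule: list_nonempty_induct) (auto simp: big_Cons)

lemma red_big_distrib:
  "Fs \<noteq> [] \<Longrightarrow> b = dual (bop_of Q) \<Longrightarrow> Quant Q x (big b Fs) \<leadsto> big b (map (Quant Q x) Fs)"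
proof (induction Fs rule: list_nonempty_induct)
  case (cons F Fs)
  have "Quant Q x (big b (F # Fs)) \<leadsto> Bin b (Quant Q x F) (Quant Q x (big b Fs))"
    using red_distrib[of Q x F "big b Fs"] cons by (simp add: big_Cons)
  also have "\<dots> \<leadsto> big b (map (Quant Q x) (F # Fs))"
    using cons by (simp add: big_Cons rtrancl_Bin_right)
  finally show ?case .
qed simp

text \<open>An arbitrary but fixed listing. By A and C (and by O for prefixes of quantifiers) its
  order matters only up to \<open>\<approx>\<close>, while fixing it makes reading back a
  function.\<close>

definition enum :: "'a set \<Rightarrow> 'a list" where
  "enum A = (SOME xs. set xs = A \<and> distinct xs)"

lemma set_enum: assumes "finite A" shows "set (enum A) = A" "distinct (enum A)"
  using someI_ex[OF finite_distinct_list[OF assms]] unfolding enum_def by auto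

lemma enum_empty [simp]: "enum {} = []" using set_enum(1)[of "{}"] by simp

lemma enum_eq_Nil: "finite A \<Longrightarrow> enum A = [] \<longleftrightarrow> A = {}" using set_enum(1) by fastforce

lemma enum_single [simp]: "enum {a} = [a]"
proof -
  have "length (enum {a}) = 1" using set_enum[of "{a}"] distinct_card[of "enum {a}"] by simp
  then obtain z where "enum {a} = [z]" by (cases "enum {a}") auto
  then show ?thesis using set_enum(1)[of "{a}"] by simp
qed

lemma mset_enum:
  assumes "finite A" "set xs = A" "distinct xs" shows "mset (enum A) = mset xs"
  using set_eq_iff_mset_eq_distinct[of "enum A" xs] set_enum[OF assms(1)] assms by simp

abbreviation bigs :: "bop \<Rightarrow> ('a \<Rightarrow> ('r, 'v) fm) \<Rightarrow> 'a set \<Rightarrow> ('r, 'v) fm" where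
  "bigs b f A \<equiv> big b (map f (enum A))"

lemma bigs_eq:
  assumes "set xs = A" "distinct xs" "A \<noteq> {}" shows "bigs b f A \<approx> big b (map f xs)"
proof -
  have A: "finite A" using assms by auto
  have "mset (map f (enum A)) = mset (map f xs)" 
    using mset_enum[OF A assms(1,2)] by simp
  then show ?thesis using enum_eq_Nil[OF A] assms(3) by (intro big_perm) auto
qed

lemma bigs_Un:
  assumes "finite A" "finite B" "A \<noteq> {}" "B \<noteq> {}" "A \<inter> B = {}"
  shows "bigs b f (A \<union> B) \<approx> Bin b (bigs b f A) (bigs b f B)"
proof -
  have "bigs b f (A \<union> B) \<approx> big b (map f (enum A @ enum B))"
    using assms set_enum[OF assms(1)] set_enum[OF assms(2)] by (intro bigs_eq) auto
  also have "\<dots> \<approx> Bin b (bigs b f A) (bigs b f B)"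
    using assms enum_eq_Nil unfolding map_append by (intro big_append) auto
  finally show ?thesis .
qed

lemma bigs_insert:
  assumes "finite A" "A \<noteq> {}" "a \<notin> A"
  shows "bigs b f (insert a A) \<approx> Bin b (f a) (bigs b f A)"
  using bigs_Un[of "{a}" A b f] assms by simp

lemma bigs_cong:
  assumes "finite A" "\<And>a. a \<in> A \<Longrightarrow> (rewrite R)\<^sup>*\<^sup>* (f a) (g a)"
  shows "(rewrite R)\<^sup>*\<^sup>* (bigs b f A) (bigs b g A)"
  using assms set_enum(1)[OF assms(1)] by (intro big_cong) auto

lemma bigs_cong_eq:
  assumes "finite A" "\<And>a. a \<in> A \<Longrightarrow> f a = g a" shows "bigs b f A = bigs b g A"
  using assms set_enum(1)[OF assms(1)] by (auto intro: arg_cong[of _ _ "big b"])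

lemma bigs_image:
  assumes "finite A" "A \<noteq> {}" "inj_on h A"
  shows "bigs b f (h ` A) \<approx> bigs b (\<lambda>a. f (h a)) A"
proof -
  have "bigs b f (h ` A) \<approx> big b (map f (map h (enum A)))"
    using assms set_enum[OF assms(1)] by (intro bigs_eq) (auto simp: distinct_map)
  then show ?thesis by (simp add: comp_def)
qed

lemma free_bigs: "finite A \<Longrightarrow> A \<noteq> {} \<Longrightarrow> free (bigs b f A) = (\<Union>a\<in>A. free (f a))"
  using enum_eq_Nil[of A] set_enum(1)[of A] by (simp add: free_big)

definition quants :: "quant \<Rightarrow> 'v list \<Rightarrow> ('r, 'v) fm \<Rightarrow> ('r, 'v) fm" where
  "quants Q xs F = foldr (Quant Q) xs F"

lemma quants_simps [simp]: "quants Q [] F = F" "quants Q (x # xs) F = Quant Q x (quants Q xs F)"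
  by (auto simp: quants_def)

lemma quants_append: "quants Q (xs @ ys) F = quants Q xs (quants Q ys F)"
  by (simp add: quants_def)

lemma quants_cong: "(rewrite R)\<^sup>*\<^sup>* F G \<Longrightarrow> (rewrite R)\<^sup>*\<^sup>* (quants Q xs F) (quants Q xs G)"
  by (induction xs) (auto intro: rtrancl_Quant)

lemma quants_swap: "Quant Q x (quants Q xs F) \<approx> quants Q xs (Quant Q x F)"
proof (induction xs)
  case (Cons y xs)
  have "Quant Q x (quants Q (y # xs) F) \<approx> Quant Q y (Quant Q x (quants Q xs F))"
    using eqT_swap by simp
  also have "\<dots> \<approx> quants Q (y # xs) (Quant Q x F)" using rtrancl_Quant[OF Cons.IH] by simp
  finally show ?case .
qed simp

lemma quants_perm: "mset xs = mset ys \<Longrightarrow> quants Q xs F \<approx> quants Q ys F"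
proof (induction xs arbitrary: ys)
  case (Cons x xs)
  have "x \<in> set ys" using mset_eq_setD[OF Cons.prems] by auto
  then obtain A B where y: "ys = A @ x # B" by (meson split_list)
  then have m: "mset xs = mset (A @ B)" using Cons.prems by simp
  from rtrancl_Quant[OF Cons.IH[OF m]]
  have "quants Q (x # xs) F \<approx> Quant Q x (quants Q A (quants Q B F))" by (simp add: quants_append)
  also have "\<dots> \<approx> quants Q ys F" unfolding y using quants_swap by (simp add: quants_append)
  finally show ?case .
qed simp

lemma quants_pull:
  assumes "set xs \<inter> free G = {}"
  shows "quants Q xs (Bin (bop_of Q) F G) \<approx> Bin (bop_of Q) (quants Q xs F) G"
  using assms
proof (induction xs)
  case (Cons x xs)
  then have "quants Q (x # xs) (Bin (bop_of Q) F G) \<approx> Quant Q x (Bin (bop_of Q) (quants Q xs F) G)"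
    by (simp add: rtrancl_Quant)
  also have "\<dots> \<approx> Bin (bop_of Q) (quants Q (x # xs) F) G"
    using Cons.prems by (simp add: eqT_pull)
  finally show ?case .
qed simp

lemma quants_pull2:
  assumes "set xs \<inter> free F = {}"
  shows "quants Q xs (Bin (bop_of Q) F G) \<approx> Bin (bop_of Q) F (quants Q xs G)"
proof -
  have "quants Q xs (Bin (bop_of Q) F G) \<approx> quants Q xs (Bin (bop_of Q) G F)"
    by (rule quants_cong[OF eqT_comm])
  also have "\<dots> \<approx> Bin (bop_of Q) (quants Q xs G) F" by (rule quants_pull[OF assms])
  also have "\<dots> \<approx> Bin (bop_of Q) F (quants Q xs G)" by (rule eqT_comm)
  finally show ?thesis .
qed

lemma free_quants: "free (quants Q xs F) = free F - set xs"
  by (induction xs) auto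

lemma replace_quants: "x \<notin> set xs \<Longrightarrow> replace x y (quants Q xs F) = quants Q xs (replace x y F)"
  by (induction xs) auto

lemma free_for_quants: "y \<notin> set xs \<Longrightarrow> free_for y x F \<Longrightarrow> free_for y x (quants Q xs F)"
  by (induction xs) auto

section \<open>Reading a formula back from a block tree\<close>

fun quant_of :: "bop \<Rightarrow> quant" where "quant_of Conj = Exists" | "quant_of Disj = Forall"

lemma bop_of_quant_of [simp]: "bop_of (quant_of b) = b" by (cases b) auto
lemma quant_of_bop_of [simp]: "quant_of (bop_of Q) = Q" by (cases Q) auto

text \<open>\<open>P\<close> stands for the argument positions of the formula under consideration.
  Its binders are subsets of \<open>P\<close>, so injectivity on \<open>Pow P\<close> gives distinct
  binders distinct names.\<close>

locale bound_naming =
  fixes ar :: "'r \<Rightarrow> nat" and nu :: "('r \<times> nat) set \<Rightarrow> 'v" and P :: "('r \<times> nat) set"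
  assumes finite_P: "finite P" and inj_nu: "inj_on nu (Pow P)"
begin

definition rebind :: "(('r \<times> nat) \<Rightarrow> 'v) \<Rightarrow> ('r \<times> nat) set set \<Rightarrow> ('r \<times> nat) \<Rightarrow> 'v" where
  "rebind \<rho> V p = (if \<exists>X\<in>V. p \<in> X then nu (THE X. X \<in> V \<and> p \<in> X) else \<rho> p)"

lemma upd_in:
  assumes d: "\<And>X Y. X \<in> V \<Longrightarrow> Y \<in> V \<Longrightarrow> X \<noteq> Y \<Longrightarrow> X \<inter> Y = {}" and X: "X \<in> V" "p \<in> X"
  shows "rebind \<rho> V p = nu X"
proof -
  have "(THE Z. Z \<in> V \<and> p \<in> Z) = X"
  proof (rule the_equality)
    show "Z = X" if "Z \<in> V \<and> p \<in> Z" for Z using d[of Z X] that X by blast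
  qed (use X in blast)
  then show ?thesis using X unfolding rebind_def by auto
qed

lemma upd_out: "(\<And>X. X \<in> V \<Longrightarrow> p \<notin> X) \<Longrightarrow> rebind \<rho> V p = \<rho> p"
  unfolding rebind_def by auto

lemma upd_cong:
  assumes "\<And>X. X \<in> V \<and> p \<in> X \<longleftrightarrow> X \<in> W \<and> p \<in> X"
  shows "rebind \<rho> V p = rebind \<rho> W p"
proof -
  have "(\<exists>X\<in>V. p \<in> X) = (\<exists>X\<in>W. p \<in> X)" using assms by blast
  then show ?thesis unfolding rebind_def by (simp only: assms)
qed

lemma upd_empty [simp]: "rebind \<rho> {} = \<rho>"
  by (auto simp: rebind_def)

text \<open>The name of a bound variable is \<open>nu X\<close> for its binder \<open>X\<close>; as \<open>nu\<close> is injective and fixed once for all,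
  no choice of fresh names is involved.\<close>

function readback :: "(('r \<times> nat) \<Rightarrow> 'v) \<Rightarrow> 'r bt \<Rightarrow> ('r, 'v) fm" where
  "readback \<rho> (Leaf r) = Atom r (map (\<lambda>i. \<rho> (r, i)) [0..<ar r])"
| "readback \<rho> (Blk b V C) =
    quants (quant_of b) (map nu (enum (fset V))) (bigs b (readback (rebind \<rho> (fset V))) (fset C))"
  by pat_completeness auto
termination
proof (relation "measure (\<lambda>(\<rho>, n). size n)")
  fix \<rho> b V and C :: "'r bt fset" and c assume "c \<in> set (enum (fset C))"
  then have "c |\<in>| C" using set_enum(1)[of "fset C"] by simp
  then show "((rebind \<rho> (fset V), c), (\<rho>, Blk b V C)) \<in> measure (\<lambda>(\<rho>, n). size n)"
    by (simp add: size_fset_overloaded_simps less_Suc_eq_le sum.remove add.assoc)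
qed simp

text \<open>For a tree that is no \<open>b\<close>-block the prefix is empty and the combination has
  one member, so reading back through the degenerate view changes nothing. Proofs need not
  distinguish the two cases.\<close>

lemma readback_view:
  "readback \<rho> n = quants (quant_of b) (map nu (enum (block_binders b n))) (bigs b (readback (rebind \<rho> (block_binders b n))) (block_args b n))"
proof (cases "is_block b n")
  case True
  then obtain V C where "n = Blk b V C" by (cases n) auto
  then show ?thesis by simp
next
  case False
  then show ?thesis by (simp add: view_not_block)
qed

declare readback.simps(2) [simp del]

definition pos :: "'r bt \<Rightarrow> ('r \<times> nat) set" where
  "pos n = {p. fst p \<in> leaves n \<and> snd p < ar (fst p)}"

lemma pos_view: "pos n = \<Union> (pos ` block_args b n)"
  unfolding pos_def using leaves_view[of n b] by auto

lemma readback_induct: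
  assumes "\<And>r. Q (Leaf r)" "\<And>b V C. (\<And>c. c \<in> fset C \<Longrightarrow> Q c) \<Longrightarrow> Q (Blk b V C)" shows "Q n"
  using assms by (induction n) auto

lemma readback_cong: "(\<And>p. p \<in> pos n \<Longrightarrow> \<rho> p = \<sigma> p) \<Longrightarrow> readback \<rho> n = readback \<sigma> n"
proof (induction n arbitrary: \<rho> \<sigma> rule: readback_induct)
  case (1 r)
  then show ?case by (auto simp: pos_def)
next
  case (2 b V C)
  have "readback (rebind \<rho> (fset V)) c = readback (rebind \<sigma> (fset V)) c" if c: "c \<in> fset C" for c
  proof (rule 2(1)[OF c])
    fix p assume "p \<in> pos c"
    then have "p \<in> pos (Blk b V C)" using c unfolding pos_def by auto
    then show "rebind \<rho> (fset V) p = rebind \<sigma> (fset V) p" using 2(2) unfolding rebind_def by simp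
  qed
  then have "bigs b (readback (rebind \<rho> (fset V))) (fset C) = bigs b (readback (rebind \<sigma> (fset V))) (fset C)"
    by (intro bigs_cong_eq finite_fset)
  then show ?case unfolding readback.simps(2) by (rule arg_cong)
qed

lemma wf_BlkD: assumes "wf_bt (Blk b V C)"
  shows "fset C \<noteq> {}" "\<And>c. c \<in> fset C \<Longrightarrow> wf_bt c"
    "\<And>X Y. X \<in> fset V \<Longrightarrow> Y \<in> fset V \<Longrightarrow> X \<noteq> Y \<Longrightarrow> X \<inter> Y = {}"
  using wf_viewD(3,4,9)[OF wf_view_views[OF assms, of b]] by simp_all

lemma free_readback: "wf_bt n \<Longrightarrow> free (readback \<rho> n) \<subseteq> \<rho> ` pos n"
proof (induction n arbitrary: \<rho> rule: readback_induct)
  case (1 r)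
  then show ?case by (auto simp: pos_def)
next
  case (2 b V C)
  note D = wf_BlkD[OF 2(2)]
  show ?case
  proof
    fix z assume "z \<in> free (readback \<rho> (Blk b V C))"
    then obtain c where c: "c \<in> fset C" "z \<in> free (readback (rebind \<rho> (fset V)) c)" and z: "z \<notin> nu ` fset V"
      unfolding readback.simps(2) free_quants using D(1) by (auto simp: free_bigs set_enum(1))
    then obtain p where p: "p \<in> pos c" "z = rebind \<rho> (fset V) p" using 2(1) D(2) by blast
    have "p \<notin> X" if "X \<in> fset V" for X using upd_in[OF D(3) that] that z p by blast
    then have "z = \<rho> p" using p upd_out by metis
    then show "z \<in> \<rho> ` pos (Blk b V C)" using p c unfolding pos_def by auto
  qed
qed

lemma replace_readback:
  "wf_bt n \<Longrightarrow> x \<notin> nu ` binders n \<Longrightarrow> replace x y (readback \<rho> n) = readback (\<lambda>p. if \<rho> p = x then y else \<rho> p) n"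
proof (induction n arbitrary: \<rho> rule: readback_induct)
  case (1 r)
  then show ?case by simp
next
  case (2 b V C)
  note D = wf_BlkD[OF 2(2)]
  have u: "rebind (\<lambda>p. if \<rho> p = x then y else \<rho> p) (fset V) = (\<lambda>p. if rebind \<rho> (fset V) p = x then y else rebind \<rho> (fset V) p)"
  proof
    fix p
    show "rebind (\<lambda>p. if \<rho> p = x then y else \<rho> p) (fset V) p = (if rebind \<rho> (fset V) p = x then y else rebind \<rho> (fset V) p)"
    proof (cases "\<exists>X\<in>fset V. p \<in> X")
      case True
      then obtain X where X: "X \<in> fset V" "p \<in> X" by blast
      then have "nu X \<noteq> x" using 2(3) by auto
      then show ?thesis using upd_in[OF D(3) X] by simp
    next
      case False
      then have "rebind \<sigma> (fset V) p = \<sigma> p" for \<sigma> by (intro upd_out) blast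
      then show ?thesis by simp
    qed
  qed
  have r: "replace x y (readback \<rho>' c) = readback (\<lambda>p. if \<rho>' p = x then y else \<rho>' p) c" if c: "c \<in> fset C" for c \<rho>'
    using 2(1)[OF c D(2)[OF c]] 2(3) c by auto
  have x: "x \<notin> set (map nu (enum (fset V)))" using 2(3) by (simp add: set_enum(1) image_Un)
  have "replace x y (bigs b (readback (rebind \<rho> (fset V))) (fset C)) = bigs b (\<lambda>c. replace x y (readback (rebind \<rho> (fset V)) c)) (fset C)"
    using D(1) enum_eq_Nil[of "fset C"] by (subst replace_big) (auto simp: comp_def)
  also have "\<dots> = bigs b (readback (rebind (\<lambda>p. if \<rho> p = x then y else \<rho> p) (fset V))) (fset C)"
    unfolding u by (intro bigs_cong_eq r) auto
  finally show ?case unfolding readback.simps(2) replace_quants[OF x] by simp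
qed

lemma free_for_readback: "wf_bt n \<Longrightarrow> y \<notin> nu ` binders n \<Longrightarrow> free_for y x (readback \<rho> n)"
proof (induction n arbitrary: \<rho> rule: readback_induct)
  case (1 r)
  then show ?case by simp
next
  case (2 b V C)
  note D = wf_BlkD[OF 2(2)]
  have "free_for y x (readback \<rho>' c)" if c: "c \<in> fset C" for c \<rho>'
    using 2(1)[OF c D(2)[OF c]] 2(3) c by auto
  then have "free_for y x (bigs b (readback (rebind \<rho> (fset V))) (fset C))"
    using D(1) enum_eq_Nil[of "fset C"] set_enum(1)[of "fset C"] by (subst free_for_big) auto
  then show ?case unfolding readback.simps(2) using 2(3) by (intro free_for_quants) (auto simp: set_enum(1))
qed

text \<open>The capture condition: no name supplied from outside is the name of a binder
  inside.\<close>

definition good :: "(('r \<times> nat) \<Rightarrow> 'v) \<Rightarrow> 'r bt \<Rightarrow> bool" where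
  "good \<rho> n \<longleftrightarrow> wf_bt n \<and> binders n \<subseteq> Pow P \<and> (\<forall>p\<in>pos n. \<rho> p \<notin> nu ` binders n)"

lemma block_binders_binders: "X \<in> block_binders b n \<Longrightarrow> X \<in> binders n"
  using binders_view[of n b] by blast

text \<open>The join reads back with one common prefix, and P returns each quantifier to its own
  side. This is possible because the name of a binder of one side is never free in the
  other.\<close>

lemma readback_jn2:
  assumes f: "family {n, m}" and nm: "n \<noteq> m" and g: "good \<rho> n" "good \<rho> m"
    and x: "\<And>p. p \<in> pos n \<Longrightarrow> \<rho> p \<notin> nu ` binders m" "\<And>p. p \<in> pos m \<Longrightarrow> \<rho> p \<notin> nu ` binders n"
  shows "readback \<rho> (join b {n, m}) \<approx> Bin b (readback \<rho> n) (readback \<rho> m)"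
proof -
  note J = family_join[OF f, of b]
  have wn: "wf_bt n" and wm: "wf_bt m" and d: "leaves n \<inter> leaves m = {}" using f nm unfolding family_def disj_leaves_def by auto
  note vn = wf_view_views[OF wn, of b] and vm = wf_view_views[OF wm, of b]
  let ?Vn = "block_binders b n" and ?Vm = "block_binders b m" and ?Q = "quant_of b"
  let ?\<rho> = "rebind \<rho> (?Vn \<union> ?Vm)"
  have Vd: "X \<inter> Y = {}" "X \<noteq> Y" if "X \<in> ?Vn" "Y \<in> ?Vm" for X Y
    using view_leaves(2)[OF wn that(1)] view_leaves(2)[OF wm that(2)] d by (blast, blast)
  have Cd: "block_args b n \<inter> block_args b m = {}"
    using view_leaves(1)[OF wn] view_leaves(1)[OF wm] d leaves_nonempty[OF block_args_props(1)[OF wn]] by blast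
  have un: "?\<rho> p = rebind \<rho> ?Vn p" if "p \<in> pos n" for p
  proof -
    have "p \<notin> X" if "X \<in> ?Vm" for X using view_leaves(2)[OF wm that] \<open>p \<in> pos n\<close> d unfolding pos_def by blast
    then show ?thesis by (intro upd_cong) blast
  qed
  have um: "?\<rho> p = rebind \<rho> ?Vm p" if "p \<in> pos m" for p
  proof -
    have "p \<notin> X" if "X \<in> ?Vn" for X using view_leaves(2)[OF wn that] \<open>p \<in> pos m\<close> d unfolding pos_def by blast
    then show ?thesis by (intro upd_cong) blast
  qed
  let ?A = "bigs b (readback (rebind \<rho> ?Vn)) (block_args b n)" and ?B = "bigs b (readback (rebind \<rho> ?Vm)) (block_args b m)"
  have A: "bigs b (readback ?\<rho>) (block_args b n) = ?A"
    using un by (intro bigs_cong_eq readback_cong) (auto simp: finite_view pos_view[of n b])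
  have B: "bigs b (readback ?\<rho>) (block_args b m) = ?B"
    using um by (intro bigs_cong_eq readback_cong) (auto simp: finite_view pos_view[of m b])
  note fin = finite_view[of b n] finite_view[of b m]
  have fm: "nu ` ?Vn \<inter> free (readback \<rho> m) = {}"
  proof -
    have "nu X \<notin> free (readback \<rho> m)" if "X \<in> ?Vn" for X
      using free_readback[OF wm, of \<rho>] x(2) block_binders_binders[OF that] by (metis imageE imageI subsetD)
    then show ?thesis by blast
  qed
  \<comment> \<open>A position of \<open>n\<close> is named after a binder of \<open>n\<close>,
    which injectivity of \<open>nu\<close> separates from the binders of \<open>m\<close>, or it
    carries an outer name, which the hypotheses keep off them.\<close>
  have fA: "nu ` ?Vm \<inter> free ?A = {}"
  proof -
    have "z \<notin> nu ` ?Vm" if z: "z \<in> free ?A" for z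
    proof -
      obtain c where c: "c \<in> block_args b n" "z \<in> free (readback (rebind \<rho> ?Vn) c)"
        using z fin wf_viewD(3)[OF vn] by (auto simp: free_bigs)
      then obtain p where p: "p \<in> pos c" "z = rebind \<rho> ?Vn p" using free_readback[OF block_args_props(1)[OF wn c(1)]] by blast
      have pn: "p \<in> pos n" using p c pos_view[of n b] by blast
      show ?thesis
      proof (cases "\<exists>X\<in>?Vn. p \<in> X")
        case True
        then obtain X where X: "X \<in> ?Vn" "p \<in> X" by blast
        have "nu X \<noteq> nu Y" if "Y \<in> ?Vm" for Y
        proof -
          have "X \<in> Pow P" "Y \<in> Pow P"
            using block_binders_binders[OF X(1)] block_binders_binders[OF that] g unfolding good_def by blast+
          then show ?thesis using Vd(2)[OF X(1) that] inj_onD[OF inj_nu] by metis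
        qed
        then show ?thesis using p upd_in[OF wf_viewD(9)[OF vn] X] by auto
      next
        case False
        then have "z = \<rho> p" using p upd_out by metis
        moreover have "\<rho> p \<notin> nu ` ?Vm"
          by (rule contra_subsetD[OF image_mono x(1)[OF pn]]) (rule subsetI, rule block_binders_binders)
        ultimately show ?thesis by simp
      qed
    qed
    then show ?thesis by blast
  qed
  have "mset (enum (?Vn \<union> ?Vm)) = mset (enum ?Vn @ enum ?Vm)"
    using fin Vd(2) by (intro mset_enum) (auto simp: set_enum)
  then have ms: "mset (map nu (enum (?Vn \<union> ?Vm))) = mset (map nu (enum ?Vn) @ map nu (enum ?Vm))" by simp
  have sn: "set (map nu (enum ?Vn)) = nu ` ?Vn" and sm: "set (map nu (enum ?Vm)) = nu ` ?Vm"
    using fin by (simp_all add: set_enum)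
  have p2: "quants ?Q (map nu (enum ?Vm)) (Bin b ?A ?B) \<approx> Bin b ?A (readback \<rho> m)"
    using quants_pull2[of "map nu (enum ?Vm)" ?A ?Q ?B] fA
    unfolding sm bop_of_quant_of readback_view[of \<rho> m b, symmetric] .
  have p1: "quants ?Q (map nu (enum ?Vn)) (Bin b ?A (readback \<rho> m)) \<approx> Bin b (readback \<rho> n) (readback \<rho> m)"
    using quants_pull[of "map nu (enum ?Vn)" "readback \<rho> m" ?Q ?A] fm
    unfolding sn bop_of_quant_of readback_view[of \<rho> n b, symmetric] .
  have s1: "quants ?Q (map nu (enum (?Vn \<union> ?Vm))) (bigs b (readback ?\<rho>) (block_args b n \<union> block_args b m))
      \<approx> quants ?Q (map nu (enum (?Vn \<union> ?Vm))) (Bin b ?A ?B)"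
    unfolding A[symmetric] B[symmetric]
    by (rule quants_cong[OF bigs_Un]) (use fin wf_viewD(3)[OF vn] wf_viewD(3)[OF vm] Cd in simp_all)
  have s2: "quants ?Q (map nu (enum (?Vn \<union> ?Vm))) (Bin b ?A ?B)
      \<approx> quants ?Q (map nu (enum ?Vn)) (quants ?Q (map nu (enum ?Vm)) (Bin b ?A ?B))"
    unfolding quants_append[symmetric] by (rule quants_perm[OF ms])
  show ?thesis
    unfolding readback_view[of \<rho> "join b {n, m}" b] J
    using rtranclp_trans[OF s1 rtranclp_trans[OF s2 rtranclp_trans[OF quants_cong[OF p2] p1]]] by simp
qed

lemma readback_join:
  assumes "family S" "\<And>s. s \<in> S \<Longrightarrow> binders s \<subseteq> Pow P"
    "\<And>s t p. s \<in> S \<Longrightarrow> t \<in> S \<Longrightarrow> p \<in> pos s \<Longrightarrow> \<rho> p \<notin> nu ` binders t"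
  shows "readback \<rho> (join b S) \<approx> bigs b (readback \<rho>) S"
proof -
  have "finite S" "S \<noteq> {}" using assms(1) unfolding family_def by auto
  then show ?thesis using assms
  proof (induction S rule: finite_ne_induct)
    case (singleton s)
    then show ?case by (simp add: family_def join_single)
  next
    case (insert s S)
    have f: "family S" "family {s}" using family_subset[OF insert.prems(1)] insert.hyps by auto
    note J = family_join[OF f(1), of b]
    have ws: "wf_bt s" using f(2) unfolding family_def by simp
    have dis: "leaves s \<inter> leaves (join b S) = {}"
      using insert.prems(1) insert.hyps unfolding J family_def disj_leaves_def by fastforce
    have ne: "s \<noteq> join b S" using dis leaves_nonempty[OF ws] by auto
    have f2: "family {s, join b S}" unfolding family_def disj_leaves_def using ws J dis by auto
    have pj: "\<exists>t\<in>S. p \<in> pos t" if "p \<in> pos (join b S)" for p using that unfolding pos_def J by auto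
    have nb: "\<rho> p \<notin> nu ` binders (join b S)" if t: "t \<in> insert s S" "p \<in> pos t" for p t
    proof
      assume "\<rho> p \<in> nu ` binders (join b S)"
      then obtain u where "u \<in> S" "\<rho> p \<in> nu ` binders u" unfolding J image_UN by (elim UN_E)
      then show False using insert.prems(3)[OF t(1) insertI2 t(2)] by blast
    qed
    have s0: "readback \<rho> (join b (insert s S)) = readback \<rho> (join b {s, join b S})"
      using join_Un[of "{s}" S b] insert.prems(1) insert.hyps join_single[OF ws, of b] by simp
    have s1: "readback \<rho> (join b {s, join b S}) \<approx> Bin b (readback \<rho> s) (readback \<rho> (join b S))"
    proof (rule readback_jn2[OF f2 ne])
      show "good \<rho> s" unfolding good_def
        using insert.prems(2)[OF insertI1] insert.prems(3)[OF insertI1 insertI1] ws by simp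
      have "binders (join b S) \<subseteq> Pow P" unfolding J using insert.prems(2) by (intro UN_least) simp
      moreover have "\<rho> p \<notin> nu ` binders (join b S)" if "p \<in> pos (join b S)" for p
        using pj[OF that] nb insertI2 by metis
      ultimately show "good \<rho> (join b S)" using J(1) unfolding good_def by simp
      show "\<rho> p \<notin> nu ` binders (join b S)" if "p \<in> pos s" for p using nb[OF insertI1 that] .
      show "\<rho> p \<notin> nu ` binders s" if "p \<in> pos (join b S)" for p
        using pj[OF that] insert.prems(3)[OF insertI2 insertI1] by metis
    qed
    have "readback \<rho> (join b S) \<approx> bigs b (readback \<rho>) S"
      by (rule insert.IH[OF f(1)]) (erule insert.prems(2)[OF insertI2], rule insert.prems(3)[OF insertI2 insertI2], assumption+)
    then have s2: "Bin b (readback \<rho> s) (readback \<rho> (join b S)) \<approx> Bin b (readback \<rho> s) (bigs b (readback \<rho>) S)"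
      by (rule rtrancl_Bin_right)
    have s3: "Bin b (readback \<rho> s) (bigs b (readback \<rho>) S) \<approx> bigs b (readback \<rho>) (insert s S)"
      by (rule eqT_sym[OF bigs_insert]) (use insert.hyps in simp_all)
    show ?case unfolding s0 using rtranclp_trans[OF s1 rtranclp_trans[OF s2 s3]] .
  qed
qed

end

lemma set2_free_for: "x \<notin> set2_fm F \<Longrightarrow> free_for x y F"
  by (induction F) auto

lemma free_set2: "free F \<subseteq> set2_fm F"
  by (induction F) auto

lemma finite_set2: "finite (set2_fm F)"
  by (induction F) auto

lemma size_replace [simp]: "size (replace x y F) = size F"
  by (induction F) auto

section \<open>Realising a push by rewriting\<close>

context bound_naming
begin

definition apos :: "('r, 'w) fm \<Rightarrow> ('r \<times> nat) set" where
  "apos F = {p. fst p \<in> rels F \<and> snd p < ar (fst p)}"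

lemma pos_tree_of: "linear F \<Longrightarrow> pos (tree_of F) = apos F"
  unfolding pos_def apos_def by (simp add: tree_of_leaves)

lemma occ_apos: "wf_fm ar F \<Longrightarrow> occ x F \<subseteq> apos F"
  unfolding apos_def by (induction F) auto

definition override :: "('r \<times> nat) set \<Rightarrow> 'v \<Rightarrow> (('r \<times> nat) \<Rightarrow> 'v) \<Rightarrow> ('r \<times> nat) \<Rightarrow> 'v" where
  "override X x \<sigma> p = (if p \<in> X then x else \<sigma> p)"

lemma upd_sub:
  assumes "\<And>Y. Y \<in> V \<Longrightarrow> X \<inter> Y = {}"
  shows "rebind (override X x \<sigma>) V = override X x (rebind \<sigma> V)"
proof
  fix p
  show "rebind (override X x \<sigma>) V p = override X x (rebind \<sigma> V) p"
  proof (cases "p \<in> X")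
    case True
    then have "rebind \<tau> V p = \<tau> p" for \<tau> using assms by (intro upd_out) blast
    then show ?thesis by (simp add: override_def)
  next
    case False
    then show ?thesis by (simp add: override_def rebind_def)
  qed
qed

lemma readback_sub_unmet: "X \<inter> pos n = {} \<Longrightarrow> readback (override X x \<sigma>) n = readback \<sigma> n"
  by (rule readback_cong) (auto simp: override_def)

lemma pos_block_args: "c \<in> block_args b n \<Longrightarrow> pos c \<subseteq> pos n"
  unfolding pos_view[of n b] by blast

lemma pos_mono: "leaves c \<subseteq> leaves n \<Longrightarrow> pos c \<subseteq> pos n"
  unfolding pos_def by blast

lemma meets_pos: "X \<inter> pos n \<noteq> {} \<Longrightarrow> meets X n"
  unfolding pos_def meets_def by blast

lemma nu_neq: "X \<in> Pow P \<Longrightarrow> Y \<in> Pow P \<Longrightarrow> X \<noteq> Y \<Longrightarrow> nu X \<noteq> nu Y"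
  using inj_onD[OF inj_nu] by blast

text \<open>Pushing inserts restrictions of \<open>X\<close> to subtrees, so every nonempty subset
  of \<open>X\<close> may become a binder, and its name must be kept clear in advance.\<close>

definition avoid :: "('r \<times> nat) set \<Rightarrow> 'r bt \<Rightarrow> ('r \<times> nat) set set" where
  "avoid X n = binders n \<union> {Y. Y \<subseteq> X \<and> Y \<noteq> {}}"

lemma avoid_mono: "binders m \<subseteq> binders n \<Longrightarrow> v \<notin> nu ` avoid X n \<Longrightarrow> v \<notin> nu ` avoid X m"
  unfolding avoid_def by (erule contra_subsetD[OF image_mono, rotated]) blast

text \<open>The last condition ensures that under \<open>override X x \<sigma>\<close> the name
  \<open>x\<close> stands at no position of \<open>n\<close> outside \<open>X\<close>, so that a
  quantifier on \<open>x\<close> binds nothing else.\<close>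

definition ready :: "('r \<times> nat) set \<Rightarrow> 'v \<Rightarrow> (('r \<times> nat) \<Rightarrow> 'v) \<Rightarrow> 'r bt \<Rightarrow> bool" where
  "ready X x \<sigma> n \<longleftrightarrow> wf_bt n \<and> apart X n \<and> binders n \<subseteq> Pow P \<and>
    (\<forall>p\<in>pos n. \<sigma> p \<notin> nu ` avoid X n) \<and> (\<forall>p\<in>pos n - X. \<sigma> p \<noteq> x)"

lemma readyD:
  assumes "ready X x \<sigma> n"
  shows "wf_bt n" "apart X n" "binders n \<subseteq> Pow P" "\<And>p. p \<in> pos n \<Longrightarrow> \<sigma> p \<notin> nu ` avoid X n"
    "\<And>p. p \<in> pos n \<Longrightarrow> p \<notin> X \<Longrightarrow> \<sigma> p \<noteq> x"
  using assms unfolding ready_def by simp_all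

lemma readyI:
  assumes "wf_bt n" "apart X n" "binders n \<subseteq> Pow P" "\<And>p. p \<in> pos n \<Longrightarrow> \<sigma> p \<notin> nu ` avoid X n"
    "\<And>p. p \<in> pos n \<Longrightarrow> p \<notin> X \<Longrightarrow> \<sigma> p \<noteq> x"
  shows "ready X x \<sigma> n"
  using assms unfolding ready_def by simp

text \<open>Entering a block names its bound positions after binders that are disjoint from
  \<open>X\<close> and from all deeper binders; injectivity of \<open>nu\<close> keeps these names
  off the ones to avoid.\<close>

lemma ready_view:
  assumes X: "X \<subseteq> P" "x \<notin> nu ` Pow P" and r: "ready X x \<sigma> n" and c: "c \<in> block_args b n"
  shows "ready X x (rebind \<sigma> (block_binders b n)) c"
proof -
  let ?\<rho> = "rebind \<sigma> (block_binders b n)"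
  note w = readyD(1)[OF r] and a = readyD(2)[OF r] and B = readyD(3)[OF r]
    and s = readyD(4)[OF r] and sx = readyD(5)[OF r]
  note v = wf_view_views[OF w, of b] and bcp = block_args_props[OF w c]
  have main: "?\<rho> p \<notin> nu ` avoid X c \<and> (p \<notin> X \<longrightarrow> ?\<rho> p \<noteq> x)" if p: "p \<in> pos c" for p
  proof (cases "\<exists>Y\<in>block_binders b n. p \<in> Y")
    case True
    then obtain Y where Y: "Y \<in> block_binders b n" "p \<in> Y" by blast
    have e: "?\<rho> p = nu Y" using upd_in[OF wf_viewD(9)[OF v] Y] .
    have YP: "Y \<in> Pow P" using B block_binders_binders[OF Y(1)] by blast
    have XY: "X \<inter> Y = {}" using a block_binders_binders[OF Y(1)] unfolding apart_def by blast
    have "nu Y \<noteq> nu Z" if Z: "Z \<in> avoid X c" for Z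
    proof (rule nu_neq[OF YP])
      show "Z \<in> Pow P" using Z bcp(4) B X(1) unfolding avoid_def by blast
      show "Y \<noteq> Z" using Z wf_viewD(10)[OF v Y(1) c] Y(2) XY unfolding avoid_def by blast
    qed
    then show ?thesis using e YP X(2) by auto
  next
    case False
    then have e: "?\<rho> p = \<sigma> p" by (intro upd_out) blast
    have pn: "p \<in> pos n" using p pos_block_args[OF c] by blast
    show ?thesis unfolding e using avoid_mono[OF bcp(4) s[OF pn]] sx[OF pn] by blast
  qed
  have "apart X c" using a bcp(4) unfolding apart_def by blast
  moreover have "binders c \<subseteq> Pow P" using bcp(4) B by (rule subset_trans)
  ultimately show ?thesis using bcp(1) main by (intro readyI) simp_all
qed

lemma ready_part:
  assumes r: "ready X x \<sigma> n" and e: "e \<in> parts d n"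
  shows "ready X x \<sigma> e"
proof (rule readyI)
  note p = part_sub(1-3)[OF readyD(1)[OF r] e]
  show "wf_bt e" by fact
  show "apart X e" using readyD(2)[OF r] p(3) unfolding apart_def by blast
  show "binders e \<subseteq> Pow P" using p(3) readyD(3)[OF r] by (rule subset_trans)
  fix q assume "q \<in> pos e"
  then have q: "q \<in> pos n" using pos_mono[OF p(2)] by blast
  show "\<sigma> q \<notin> nu ` avoid X e" by (rule avoid_mono[OF p(3) readyD(4)[OF r q]])
  show "\<sigma> q \<noteq> x" if "q \<notin> X" using readyD(5)[OF r q that] .
qed

lemma sub_ready_notin:
  assumes X: "X \<subseteq> P" "x \<notin> nu ` Pow P" and r: "ready X x \<sigma> n"
    and p: "p \<in> pos n"
  shows "override X x \<sigma> p \<notin> nu ` binders n"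
proof (cases "p \<in> X")
  case True
  have "binders n \<subseteq> Pow P" by (rule readyD(3)[OF r])
  then have "x \<notin> nu ` binders n" using contra_subsetD[OF image_mono X(2)] by blast
  then show ?thesis using True unfolding override_def by simp
next
  case False
  then show ?thesis using readyD(4)[OF r p] unfolding override_def avoid_def image_Un by simp
qed

text \<open>Each branch of \<open>push\<close> is carried out by rules. An unmet quantifier is
  deleted by M. A splitting one is moved past the other binders by O, freed of the remaining
  arguments by P, distributed over the parts by S, and treated recursively there. A stuck one is
  renamed by N to the name of its binder and sorted into the prefix by O.\<close>

lemma red_push:
  assumes "X \<subseteq> P" "x \<notin> nu ` Pow P" "ready X x \<sigma> n"
  shows "Quant Q x (readback (override X x \<sigma>) n) \<leadsto> readback \<sigma> (push (bop_of Q) X n)"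
  using assms(3)
proof (induction "card (leaves n)" arbitrary: n \<sigma> rule: less_induct)
  case less
  note X = assms(1,2) and r = less.prems
  let ?b = "bop_of Q" let ?d = "dual ?b"
  note w = readyD(1)[OF r] and a = readyD(2)[OF r] and B = readyD(3)[OF r]
    and s = readyD(4)[OF r] and sx = readyD(5)[OF r]
  note v = wf_view_views[OF w, of ?b]
  let ?V = "block_binders ?b n" and ?C = "block_args ?b n"
  have VX: "X \<inter> Y = {}" if "Y \<in> ?V" for Y using a block_binders_binders[OF that] unfolding apart_def by blast
  let ?\<rho> = "rebind \<sigma> ?V"
  have us: "rebind (override X x \<sigma>) ?V = override X x ?\<rho>" using upd_sub[OF VX] .
  have unmet: "x \<notin> free (readback (override X x \<tau>) c)"
    if c: "\<not> meets X c" "wf_bt c" and t: "\<And>p. p \<in> pos c \<Longrightarrow> p \<notin> X \<Longrightarrow> \<tau> p \<noteq> x" for c \<tau>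
  proof
    assume "x \<in> free (readback (override X x \<tau>) c)"
    then obtain p where p: "p \<in> pos c" "x = override X x \<tau> p" using free_readback[OF c(2)] by blast
    then have "p \<notin> X" using meets_pos c(1) by blast
    then show False using p(2) t[OF p(1)] unfolding override_def by simp
  qed
  show ?case
  proof (cases "meets X n")
    case False
    then have "readback (override X x \<sigma>) n = readback \<sigma> n" using meets_pos by (intro readback_sub_unmet) blast
    moreover have "x \<notin> free (readback (override X x \<sigma>) n)" by (rule unmet[OF False w]) (rule sx)
    ultimately show ?thesis using red_M[of x "readback \<sigma> n" Q] push_none[OF False] by simp
  next
    case m: True
    show ?thesis
    proof (cases "\<exists>j. splits ?b X n j")
      case True
      then obtain j where j: "splits ?b X n j" by blast
      have mj: "j \<in> ?C" "parts ?d j \<noteq> {j}" and hit: "hit ?b X n = {j}"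
        using hit_mem[OF j] j unfolding splits_def by auto
      note bj = block_args_props[OF w mj(1)]
      note sp = split_part_props[OF w a j]
      let ?j' = "split_part ?b X j"
      have rj: "ready X x ?\<rho> j" by (rule ready_view[OF X r mj(1)])
      note fp = family_parts[OF bj(1), of ?d]
      have re: "ready X x ?\<rho> e" if "e \<in> parts ?d j" for e by (rule ready_part[OF rj that])
      have ae: "apart X e" "wf_bt e" if "e \<in> parts ?d j" for e
        using readyD(1,2)[OF re[OF that]] by auto
      have IH: "Quant Q x (readback (override X x ?\<rho>) e) \<leadsto> readback ?\<rho> (push ?b X e)" if e: "e \<in> parts ?d j" for e
        by (rule less.hyps[OF part_card_less[OF w mj e] re[OF e]])
      have fpush: "family (push ?b X ` parts ?d j)" "inj_on (push ?b X) (parts ?d j)"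
        using family_image[OF fp, of "push ?b X"] ae push_wf push_leaves by blast+
      have fin: "finite (parts ?d j)" "parts ?d j \<noteq> {}" using fp unfolding family_def by auto
      have bsub: "binders t \<subseteq> binders j" if "t \<in> parts ?d j" for t using part_sub(3)[OF bj(1) that] .
      have psub: "pos t \<subseteq> pos j" if "t \<in> parts ?d j" for t using pos_mono[OF part_sub(2)[OF bj(1) that]] .
      \<comment> \<open>The components of \<open>j\<close> are made visible as operands of the
        opposite connective, which is the shape S needs.\<close>
      have j1: "readback (override X x ?\<rho>) j \<approx> bigs ?d (readback (override X x ?\<rho>)) (parts ?d j)"
      proof -
        have "readback (override X x ?\<rho>) (join ?d (parts ?d j)) \<approx> bigs ?d (readback (override X x ?\<rho>)) (parts ?d j)"
        proof (rule readback_join[OF fp])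
          show "binders t \<subseteq> Pow P" if "t \<in> parts ?d j" for t using bsub[OF that] bj(4) B by blast
          show "override X x ?\<rho> p \<notin> nu ` binders u" if "t \<in> parts ?d j" "u \<in> parts ?d j" "p \<in> pos t" for t u p
            by (rule contra_subsetD[OF image_mono[OF bsub[OF that(2)]] sub_ready_notin[OF X rj]])
              (use psub[OF that(1)] that(3) in blast)
        qed
        then show ?thesis unfolding join_parts[OF bj(1)] .
      qed
      have j2: "Quant Q x (bigs ?d (readback (override X x ?\<rho>)) (parts ?d j)) \<leadsto> bigs ?d (\<lambda>e. Quant Q x (readback (override X x ?\<rho>) e)) (parts ?d j)"
        using red_big_distrib[of "map (readback (override X x ?\<rho>)) (enum (parts ?d j))" ?d Q x] enum_eq_Nil[OF fin(1)] fin(2)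
        by (simp add: comp_def)
      have j3: "bigs ?d (\<lambda>e. Quant Q x (readback (override X x ?\<rho>) e)) (parts ?d j) \<leadsto> bigs ?d (\<lambda>e. readback ?\<rho> (push ?b X e)) (parts ?d j)"
        by (rule bigs_cong[OF fin(1) IH])
      have j4: "bigs ?d (\<lambda>e. readback ?\<rho> (push ?b X e)) (parts ?d j) \<approx> bigs ?d (readback ?\<rho>) (push ?b X ` parts ?d j)"
        by (rule eqT_sym[OF bigs_image[OF fin fpush(2)]])
      have j5: "bigs ?d (readback ?\<rho>) (push ?b X ` parts ?d j) \<approx> readback ?\<rho> ?j'"
        unfolding split_part_def
      proof (rule eqT_sym[OF readback_join[OF fpush(1)]])
        have bp: "Y \<in> avoid X j" 
          if Y: "Y \<in> binders (push ?b X t)" and t: "t \<in> parts ?d j" for Y t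
          using push_binders[OF ae(2,1)[OF t] Y] bsub[OF t] binders_leaves[OF push_wf[OF ae(2,1)[OF t]] Y]
          unfolding avoid_def by blast
        show "binders t \<subseteq> Pow P" if "t \<in> push ?b X ` parts ?d j" for t
          using that bp bj(4) B X(1) unfolding avoid_def by blast
        show "?\<rho> p \<notin> nu ` binders u" if t: "t \<in> push ?b X ` parts ?d j" and u: "u \<in> push ?b X ` parts ?d j" and p: "p \<in> pos t" for t u p
        proof -
          obtain t' where t': "t' \<in> parts ?d j" "t = push ?b X t'" using t by blast
          have "leaves t = leaves t'" using push_leaves[OF ae(2,1)[OF t'(1)]] t'(2) by simp
          then have "p \<in> pos j" using psub[OF t'(1)] p unfolding pos_def by blast
          then have nj: "?\<rho> p \<notin> nu ` avoid X j" by (rule readyD(4)[OF rj])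
          obtain u' where u': "u' \<in> parts ?d j" "u = push ?b X u'" using u by blast
          have "binders u \<subseteq> avoid X j" unfolding u'(2) using bp[OF _ u'(1)] by (rule subsetI)
          then show ?thesis by (rule contra_subsetD[OF image_mono nj])
        qed
      qed
      have jj: "Quant Q x (readback (override X x ?\<rho>) j) \<leadsto> readback ?\<rho> ?j'"
        by (rule rtranclp_trans[OF rtrancl_Quant[OF eqT_red[OF j1]] rtranclp_trans[OF j2 rtranclp_trans[OF j3
              rtranclp_trans[OF eqT_red[OF j4] eqT_red[OF j5]]]]])
      note views = push_split_views[OF w a j]
      have fC: "finite ?C" using finite_view by blast
      have rest: "readback (override X x ?\<rho>) c = readback ?\<rho> c \<and> x \<notin> free (readback (override X x ?\<rho>) c)" if c: "c \<in> ?C - {j}" for c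
      proof
        have nm: "\<not> meets X c" using hit c unfolding hit_def by blast
        show "readback (override X x ?\<rho>) c = readback ?\<rho> c" using nm meets_pos by (intro readback_sub_unmet) blast
        have cC: "c \<in> ?C" using c by simp
        show "x \<notin> free (readback (override X x ?\<rho>) c)"
          by (rule unmet[OF nm block_args_props(1)[OF w cC]]) (rule readyD(5)[OF ready_view[OF X r cC]])
      qed
      \<comment> \<open>The other arguments do not contain \<open>x\<close>, so P detaches them and
        the quantifier stands in front of \<open>j\<close> alone.\<close>
      have body: "Quant Q x (bigs ?b (readback (override X x ?\<rho>)) ?C) \<leadsto> bigs ?b (readback ?\<rho>) (insert ?j' (?C - {j}))"
      proof (cases "?C = {j}")
        case True
        then show ?thesis using jj by simp
      next
        case False
        let ?D = "?C - {j}"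
        have D: "?C = insert j ?D" "finite ?D" "?D \<noteq> {}" "j \<notin> ?D" "?j' \<notin> ?D"
          using mj(1) False fC replace_notin[OF w mj(1) sp(3)] by blast+
        have x: "x \<notin> free (bigs ?b (readback (override X x ?\<rho>)) ?D)" unfolding free_bigs[OF D(2,3)] using rest by blast
        have "bigs ?b (readback (override X x ?\<rho>)) ?C \<approx> Bin ?b (readback (override X x ?\<rho>) j) (bigs ?b (readback (override X x ?\<rho>)) ?D)"
          using bigs_insert[OF D(2,3,4), of ?b "readback (override X x ?\<rho>)"] D(1) by simp
        then have b1: "Quant Q x (bigs ?b (readback (override X x ?\<rho>)) ?C) \<leadsto> Quant Q x (Bin ?b (readback (override X x ?\<rho>) j) (bigs ?b (readback (override X x ?\<rho>)) ?D))"
          by (rule rtrancl_Quant[OF eqT_red])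
        have b2: "Quant Q x (Bin ?b (readback (override X x ?\<rho>) j) (bigs ?b (readback (override X x ?\<rho>)) ?D))
          \<leadsto> Bin ?b (Quant Q x (readback (override X x ?\<rho>) j)) (bigs ?b (readback (override X x ?\<rho>)) ?D)"
          by (rule eqT_red[OF eqT_pull[OF x]])
        have "bigs ?b (readback (override X x ?\<rho>)) ?D = bigs ?b (readback ?\<rho>) ?D"
          using rest by (intro bigs_cong_eq D) blast
        then have b3: "Bin ?b (Quant Q x (readback (override X x ?\<rho>) j)) (bigs ?b (readback (override X x ?\<rho>)) ?D)
          \<leadsto> Bin ?b (readback ?\<rho> ?j') (bigs ?b (readback ?\<rho>) ?D)"
          using rtrancl_Bin_left[OF jj] by simp
        have b4: "Bin ?b (readback ?\<rho> ?j') (bigs ?b (readback ?\<rho>) ?D) \<leadsto> bigs ?b (readback ?\<rho>) (insert ?j' ?D)"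
          by (rule eqT_red[OF eqT_sym[OF bigs_insert[OF D(2,3,5)]]])
        show ?thesis by (rule rtranclp_trans[OF b1 rtranclp_trans[OF b2 rtranclp_trans[OF b3 b4]]])
      qed
      let ?ys = "map nu (enum ?V)"
      have "Quant Q x (readback (override X x \<sigma>) n) = Quant Q x (quants Q ?ys (bigs ?b (readback (override X x ?\<rho>)) ?C))"
        unfolding readback_view[of "override X x \<sigma>" n ?b] us by simp
      moreover have "Quant Q x (quants Q ?ys (bigs ?b (readback (override X x ?\<rho>)) ?C))
          \<leadsto> quants Q ?ys (Quant Q x (bigs ?b (readback (override X x ?\<rho>)) ?C))"
        by (rule eqT_red[OF quants_swap])
      moreover have "quants Q ?ys (Quant Q x (bigs ?b (readback (override X x ?\<rho>)) ?C)) \<leadsto> quants Q ?ys (bigs ?b (readback ?\<rho>) (insert ?j' (?C - {j})))"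
        by (rule quants_cong[OF body])
      moreover have "quants Q ?ys (bigs ?b (readback ?\<rho>) (insert ?j' (?C - {j}))) = readback \<sigma> (push ?b X n)"
        unfolding readback_view[of \<sigma> "push ?b X n" ?b] views by simp
      ultimately show ?thesis by (metis rtranclp_trans)
    next
      case False
      let ?R = "restrict_to X n" let ?y = "nu ?R"
      note views = push_stuck_views[OF w a m False]
      have RX: "?R \<subseteq> X" "?R \<noteq> {}" using m unfolding restrict_to_def meets_def by auto
      have pR: "p \<in> ?R \<longleftrightarrow> p \<in> X" if "p \<in> pos n" for p using that unfolding restrict_to_def pos_def by auto
      have RV: "?R \<inter> Y = {}" if "Y \<in> ?V" for Y using VX[OF that] RX by blast
      have RP: "?R \<in> Pow P" using RX X(1) by blast
      have xb: "x \<notin> nu ` binders n" using X(2) B by blast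
      have "?R \<notin> binders n" using a RX unfolding apart_def by blast
      then have yb: "?y \<notin> nu ` binders n" using nu_neq[OF RP] B by blast
      have xy: "?y \<noteq> x" using X(2) RP by blast
      have sy: "\<sigma> p \<noteq> ?y" if "p \<in> pos n" for p using s[OF that] RX unfolding avoid_def by blast
      have yf: "?y \<notin> free (readback (override X x \<sigma>) n)"
      proof
        assume "?y \<in> free (readback (override X x \<sigma>) n)"
        then obtain p where p: "p \<in> pos n" "?y = override X x \<sigma> p" using free_readback[OF w] by blast
        then show False using sy[OF p(1)] xy unfolding override_def by (auto split: if_splits)
      qed
      have uR: "rebind (override ?R ?y \<sigma>) ?V = override ?R ?y ?\<rho>" by (rule upd_sub) (rule RV)
      \<comment> \<open>Replacing \<open>x\<close> by the name of \<open>?R\<close> produces exactly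
        the naming in which \<open>?R\<close> is one more binder of the block.\<close>
      have "replace x ?y (readback (override X x \<sigma>) n) = readback (\<lambda>p. if override X x \<sigma> p = x then ?y else override X x \<sigma> p) n"
        by (rule replace_readback[OF w xb])
      also have "\<dots> = readback (override ?R ?y \<sigma>) n"
        by (rule readback_cong) (use sx pR in \<open>auto simp: override_def\<close>)
      also have "\<dots> = quants Q (map nu (enum ?V)) (bigs ?b (readback (override ?R ?y ?\<rho>)) ?C)"
        unfolding readback_view[of "override ?R ?y \<sigma>" n ?b] uR by simp
      also have "bigs ?b (readback (override ?R ?y ?\<rho>)) ?C = bigs ?b (readback (rebind \<sigma> (insert ?R ?V))) ?C"
      proof (intro bigs_cong_eq readback_cong)
        show "finite ?C" using finite_view by blast
        fix p
        have d: "\<And>Y Z. Y \<in> insert ?R ?V \<Longrightarrow> Z \<in> insert ?R ?V \<Longrightarrow> Y \<noteq> Z \<Longrightarrow> Y \<inter> Z = {}"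
          using RV wf_viewD(9)[OF v] by blast
        show "override ?R ?y ?\<rho> p = rebind \<sigma> (insert ?R ?V) p"
        proof (cases "p \<in> ?R")
          case True
          then show ?thesis using upd_in[OF d insertI1 True] by (simp add: override_def)
        next
          case F: False
          then have "rebind \<sigma> (insert ?R ?V) p = ?\<rho> p" by (intro upd_cong) blast
          then show ?thesis using F by (simp add: override_def)
        qed
      qed
      finally have rep: "replace x ?y (readback (override X x \<sigma>) n)
        = quants Q (map nu (enum ?V)) (bigs ?b (readback (rebind \<sigma> (insert ?R ?V))) ?C)" .
      have fV: "finite ?V" using finite_view by blast
      have "?R \<notin> ?V" using RV RX by blast
      then have "mset (enum (insert ?R ?V)) = mset (?R # enum ?V)"
        using fV by (intro mset_enum) (auto simp: set_enum)
      then have ms: "mset (?y # map nu (enum ?V)) = mset (map nu (enum (insert ?R ?V)))" by simp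
      have "Quant Q x (readback (override X x \<sigma>) n) \<leadsto> Quant Q ?y (replace x ?y (readback (override X x \<sigma>) n))"
        by (rule eqT_red[OF eqT_rename[OF yf free_for_readback[OF w yb]]])
      moreover have "Quant Q ?y (replace x ?y (readback (override X x \<sigma>) n))
         = quants Q (?y # map nu (enum ?V)) (bigs ?b (readback (rebind \<sigma> (insert ?R ?V))) ?C)"
        unfolding rep by simp
      moreover have "quants Q (?y # map nu (enum ?V)) (bigs ?b (readback (rebind \<sigma> (insert ?R ?V))) ?C)
         \<leadsto> quants Q (map nu (enum (insert ?R ?V))) (bigs ?b (readback (rebind \<sigma> (insert ?R ?V))) ?C)"
        by (rule eqT_red[OF quants_perm[OF ms]])
      moreover have "quants Q (map nu (enum (insert ?R ?V))) (bigs ?b (readback (rebind \<sigma> (insert ?R ?V))) ?C) = readback \<sigma> (push ?b X n)"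
        unfolding readback_view[of \<sigma> "push ?b X n" ?b] views by simp
      ultimately show ?thesis by (metis rtranclp_trans)
    qed
  qed
qed

lemma tree_of_binders_pos:
  assumes "linear F" "wf_fm ar F" shows "binders (tree_of F) \<subseteq> Pow (apos F)"
  using assms
proof (induction F)
  case (Bin b F G)
  then show ?case using family_join(5)[OF tree_of_family(1)[OF Bin.prems(1)], of b] unfolding apos_def by auto
next
  case (Quant Q x F)
  have l: "linear F" using Quant.prems by simp
  have "Y \<subseteq> apos F" if Y: "Y \<in> binders (push (bop_of Q) (occ x F) (tree_of F))" for Y
    using push_binders[OF tree_of_wf[OF l] tree_of_apart[OF l] Y] Quant occ_apos[of F x] by auto
  then show ?case unfolding apos_def by auto
next
  case (Neg F)
  then show ?case unfolding apos_def by simp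
qed simp

text \<open>\<open>\<sigma>\<close> is tied to the formula at free occurrences only; a bound
  position may carry any name outside the range reserved for binders. The induction is on size
  because a bound variable is renamed before its scope is treated.\<close>

lemma red_readback:
  assumes "linear F" "wf_fm ar F" "neg_free F" "apos F \<subseteq> P"
    "\<And>z p. p \<in> occ z F \<Longrightarrow> \<sigma> p = z" "\<And>p. p \<in> apos F \<Longrightarrow> \<sigma> p \<notin> nu ` Pow P"
    and inf: "infinite (UNIV :: 'v set)"
  shows "F \<leadsto> readback \<sigma> (tree_of F)"
  using assms(1-6)
proof (induction "size F" arbitrary: F \<sigma> rule: less_induct)
  case less
  note lin = less.prems(1) and wff = less.prems(2) and P = less.prems(4)
    and occ = less.prems(5) and N = less.prems(6)
  show ?case
  proof (cases F)
    case (Atom R vs)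
    have "\<sigma> (R, i) = vs ! i" if "i < length vs" for i
      using occ[of "(R, i)" "vs ! i"] that unfolding Atom by simp
    then have "map (\<lambda>i. \<sigma> (R, i)) [0..<length vs] = vs" by (intro nth_equalityI) auto
    then show ?thesis using wff unfolding Atom by simp
  next
    case (Neg G)
    then show ?thesis using less.prems(3) by simp
  next
    case (Bin b G H)
    have l: "linear (Bin b G H)" "linear G" "linear H" "rels G \<inter> rels H = {}" using lin unfolding Bin by auto
    have ap: "apos G \<subseteq> apos F" "apos H \<subseteq> apos F" unfolding Bin apos_def by auto
    have IH: "K \<leadsto> readback \<sigma> (tree_of K)"
      if K: "size K < size F" "linear K" "wf_fm ar K" "neg_free K" "apos K \<subseteq> apos F" "\<And>z. occ z K \<subseteq> occ z F" for K
    proof (rule less.hyps[OF K(1-4)])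
      show "apos K \<subseteq> P" using K(5) P by (rule subset_trans)
      show "\<sigma> p = z" if "p \<in> occ z K" for z p using occ[OF subsetD[OF K(6) that]] .
      show "\<sigma> p \<notin> nu ` Pow P" if "p \<in> apos K" for p using N[OF subsetD[OF K(5) that]] .
    qed
    have "G \<leadsto> readback \<sigma> (tree_of G)"
      by (rule IH) (use l ap wff less.prems(3) in \<open>simp_all add: Bin\<close>)
    moreover have "H \<leadsto> readback \<sigma> (tree_of H)"
      by (rule IH) (use l ap wff less.prems(3) in \<open>simp_all add: Bin\<close>)
    ultimately have 1: "F \<leadsto> Bin b (readback \<sigma> (tree_of G)) (readback \<sigma> (tree_of H))" unfolding Bin by (rule rtrancl_Bin)
    have bP: "binders (tree_of G) \<subseteq> Pow P" "binders (tree_of H) \<subseteq> Pow P"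
      using subset_trans[OF tree_of_binders_pos[OF l(2)] Pow_mono[OF subset_trans[OF ap(1) P]]]
        subset_trans[OF tree_of_binders_pos[OF l(3)] Pow_mono[OF subset_trans[OF ap(2) P]]] wff unfolding Bin by simp_all
    have pp: "pos (tree_of G) \<subseteq> apos F" "pos (tree_of H) \<subseteq> apos F"
      using pos_tree_of[OF l(2)] pos_tree_of[OF l(3)] ap by auto
    have nP: "\<sigma> p \<notin> nu ` B" if "p \<in> apos F" "B \<subseteq> Pow P" for p B
      by (rule contra_subsetD[OF image_mono[OF that(2)] N[OF that(1)]])
    have "readback \<sigma> (join b {tree_of G, tree_of H}) \<approx> Bin b (readback \<sigma> (tree_of G)) (readback \<sigma> (tree_of H))"
    proof (rule readback_jn2[OF tree_of_family[OF l(1)]])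
      show "good \<sigma> (tree_of G)" 
        unfolding good_def by (intro conjI ballI tree_of_wf[OF l(2)] bP(1) nP[OF subsetD[OF pp(1)] bP(1)])
      show "good \<sigma> (tree_of H)" 
        unfolding good_def by (intro conjI ballI tree_of_wf[OF l(3)] bP(2) nP[OF subsetD[OF pp(2)] bP(2)])
      show "\<sigma> p \<notin> nu ` binders (tree_of H)" if "p \<in> pos (tree_of G)" for p
        by (rule nP[OF _ bP(2)]) (use pp(1) that in blast)
      show "\<sigma> p \<notin> nu ` binders (tree_of G)" if "p \<in> pos (tree_of H)" for p
        by (rule nP[OF _ bP(1)]) (use pp(2) that in blast)
    qed
    then show ?thesis using rtranclp_trans[OF 1 eqT_red[OF eqT_sym]] unfolding Bin by simp
  next
    case (Quant Q y G)
    have l: "linear G" "wf_fm ar G" "neg_free G" using less.prems(1-3) unfolding Quant by auto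
    have ap: "apos F = apos G" unfolding Quant apos_def by simp
    let ?X = "occ y G"
    \<comment> \<open>The variable \<open>y\<close> may be reserved for a binder, or
      \<open>\<sigma>\<close> may assign it to a position bound deeper inside. So it is first
      replaced by a variable that clashes with neither and occurs nowhere in \<open>G\<close>, which
      also excludes capture.\<close>
    have "finite (nu ` Pow P \<union> set2_fm G \<union> \<sigma> ` P \<union> {y})" using finite_P finite_set2 by blast
    from ex_new_if_finite[OF inf this]
    obtain x where x: "x \<notin> nu ` Pow P" "x \<notin> set2_fm G" "x \<notin> \<sigma> ` P" "x \<noteq> y"
      by (simp only: Un_iff de_Morgan_disj singleton_iff) blast
    have xG: "x \<notin> free G" "free_for x y G" "x \<noteq> y" "x \<notin> nu ` Pow P"
      using x set2_free_for[of x G y] free_set2[of G] by (blast, blast, blast, blast)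
    let ?G = "replace y x G"
    have wfr: "wf_fm ar ?G" "neg_free ?G" using PFO_replace_iff[of y x G ar] l unfolding PFO_def by auto
    have apr: "apos ?G = apos G" unfolding apos_def by simp
    have "?G \<leadsto> readback (override ?X x \<sigma>) (tree_of ?G)"
    proof (rule less.hyps)
      show "size ?G < size F" unfolding Quant by simp
      show "linear ?G" using l by simp
      show "wf_fm ar ?G" "neg_free ?G" by fact+
      show "apos ?G \<subseteq> P" using P ap apr by simp
      fix z p
      show "override ?X x \<sigma> p = z" if p: "p \<in> occ z ?G"
      proof (cases "z = x")
        case True
        then show ?thesis using p occ_replace[OF xG(1,2), of z] xG(3) unfolding override_def by simp
      next
        case False
        then have z: "z \<noteq> y" "p \<in> occ z G" using p occ_replace[OF xG(1,2), of z] by (auto split: if_splits)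
        then have "p \<notin> ?X" using occ_disjoint[OF l(1) z(1)] by blast
        then show ?thesis using occ[of p z] z unfolding Quant override_def by simp
      qed
      show "override ?X x \<sigma> p \<notin> nu ` Pow P" if "p \<in> apos ?G"
        using N[of p] that xG(4) unfolding override_def ap apr by simp
    qed
    then have 1: "Quant Q x ?G \<leadsto> Quant Q x (readback (override ?X x \<sigma>) (tree_of G))"
      using tree_of_replace[OF xG(1,2)] by (intro rtrancl_Quant) simp
    have bP: "binders (tree_of G) \<subseteq> Pow P" 
      using subset_trans[OF tree_of_binders_pos[OF l(1,2)] Pow_mono] P ap by simp
    have XP: "?X \<subseteq> P" using subset_trans[OF occ_apos[OF l(2)]] P ap by simp
    have pG: "pos (tree_of G) = apos G" by (rule pos_tree_of[OF l(1)])
    have "ready ?X x \<sigma> (tree_of G)"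
    proof (rule readyI)
      show "wf_bt (tree_of G)" "apart ?X (tree_of G)" using tree_of_wf[OF l(1)] tree_of_apart[OF l(1)] .
      show "binders (tree_of G) \<subseteq> Pow P" by fact
      fix p assume p: "p \<in> pos (tree_of G)"
      have "avoid ?X (tree_of G) \<subseteq> Pow P" using bP XP unfolding avoid_def by blast
      then show "\<sigma> p \<notin> nu ` avoid ?X (tree_of G)"
        by (rule contra_subsetD[OF image_mono]) (use N[of p] p pG ap in simp)
      have "p \<in> P" using p pG ap P by blast
      then show "\<sigma> p \<noteq> x" using x(3) by blast
    qed
    then have 2: "Quant Q x (readback (override ?X x \<sigma>) (tree_of G)) \<leadsto> readback \<sigma> (tree_of F)"
      using red_push[OF XP xG(4)] unfolding Quant by simp
    have "F \<leadsto> Quant Q x ?G" unfolding Quant by (rule eqT_red[OF eqT_rename[OF xG(1,2)]])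
    then show ?thesis by (rule rtranclp_trans[OF _ rtranclp_trans[OF 1 2]])
  qed
qed

end

section \<open>Termination\<close>

fun atoms :: "('r, 'v) fm \<Rightarrow> nat" where
  "atoms (Atom R vs) = 1"
| "atoms (Neg F) = atoms F"
| "atoms (Bin b F G) = atoms F + atoms G"
| "atoms (Quant Q x F) = atoms F"

lemma atoms_pos [simp]: "0 < atoms F"
  by (induction F) auto

text \<open>For a quantifier \<open>Qx\<close> whose kind moves freely across \<open>b\<close>: a bound for the atoms that S can still
  remove from the scope of \<open>x\<close>, plus the number of copies of \<open>Qx\<close> that S can still create with
  a bound occurrence of \<open>x\<close>.\<close>

fun splits_left :: "bop \<Rightarrow> 'v \<Rightarrow> ('r, 'v) fm \<Rightarrow> nat" where
  "splits_left b x (Atom R vs) = 0"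
| "splits_left b x (Neg F) = splits_left b x F"
| "splits_left b x (Bin c F G) = splits_left b x F + splits_left b x G +
    (if c = b then 0
     else if x \<in> free F \<and> x \<in> free G then 1
     else if x \<in> free F then atoms G
     else if x \<in> free G then atoms F
     else 0)"
| "splits_left b x (Quant Q y F) = (if y = x then 0 else splits_left b x F)"

fun used_weight :: "('r, 'v) fm \<Rightarrow> nat" where
  "used_weight (Atom R vs) = 0"
| "used_weight (Neg F) = used_weight F"
| "used_weight (Bin b F G) = used_weight F + used_weight G"
| "used_weight (Quant Q x F) = splits_left (bop_of Q) x F + used_weight F"

text \<open>A vacuous quantifier weighs \<open>2k - 1\<close>, where \<open>k\<close> is the number of atoms in its largest scope modulo P,
  computed as if all vacuous quantifiers had been deleted. Hence M does not change the weight of the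
  others. The parameters \<open>t\<close> and \<open>n\<close> are the kind and the number of atoms of the current block.\<close>

fun unused_weight :: "bop \<Rightarrow> nat \<Rightarrow> ('r, 'v) fm \<Rightarrow> nat" where
  "unused_weight t n (Atom R vs) = 0"
| "unused_weight t n (Neg F) = unused_weight t n F"
| "unused_weight t n (Bin b F G) =
    (if b = t then unused_weight t n F + unused_weight t n G
     else unused_weight b (atoms F + atoms G) F + unused_weight b (atoms F + atoms G) G)"
| "unused_weight t n (Quant Q x F) =
    (if x \<in> free F then unused_weight (bop_of Q) (if bop_of Q = t then n else atoms F) F
     else 2 * (if bop_of Q = t then n else atoms F) - 1 + unused_weight t n F)"

lemma splits_left_unused: "x \<notin> free F \<Longrightarrow> splits_left b x F = 0"
  by (induction F) auto

lemma atoms_replace [simp]: "atoms (replace x y F) = atoms F"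
  by (induction F) auto

lemma splits_left_replace:
  assumes "y \<notin> free F" "free_for y x F"
  shows "splits_left b z (replace x y F) =
    (if z = y then (if x = y then 0 else splits_left b x F) else if z = x then 0 else splits_left b z F)"
  using assms
proof (induction F)
  case (Quant Q u F)
  show ?case
  proof (cases "x \<in> free (Quant Q u F)")
    case True
    then show ?thesis using Quant splits_left_unused[of x F b] by auto
  next
    case False
    then have "splits_left b x (Quant Q u F) = 0" "splits_left b y (Quant Q u F) = 0"
      using splits_left_unused[OF False] splits_left_unused[OF Quant.prems(1)] by simp_all
    then show ?thesis by (subst replace_self[OF False]) auto
  qed
next
  case (Bin c F G)
  then show ?case by (auto simp: free_replace splits_left_unused)
qed auto

lemma used_weight_replace:
  assumes "y \<notin> free F" "free_for y x F" shows "used_weight (replace x y F) = used_weight F"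
  using assms
proof (induction F)
  case (Quant Q u F)
  show ?case
  proof (cases "x \<in> free (Quant Q u F)")
    case True
    then show ?thesis using Quant splits_left_replace[of y F x "bop_of Q" u] by auto
  next
    case False
    show ?thesis by (subst replace_self[OF False]) simp
  qed
qed auto

lemma unused_weight_replace:
  assumes "y \<notin> free F" "free_for y x F" shows "unused_weight t n (replace x y F) = unused_weight t n F"
  using assms
proof (induction F arbitrary: t n)
  case (Quant Q u F)
  show ?case
  proof (cases "x \<in> free (Quant Q u F)")
    case True
    then show ?thesis using Quant by (auto simp: free_replace)
  next
    case False
    show ?thesis by (subst replace_self[OF False]) simp
  qed
qed auto

section \<open>Invariance and decrease of the weights\<close>

definition similar :: "('r, 'v) fm \<Rightarrow> ('r, 'v) fm \<Rightarrow> bool" where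
  "similar F G \<longleftrightarrow> free F = free G \<and> atoms F = atoms G \<and> (\<forall>b x. splits_left b x F = splits_left b x G)"

text \<open>These three quantities are all that the weights of a surrounding formula read off a
  subformula. A maximal combination by the opposite connective in which \<open>k > 0\<close>
  operands contain \<open>x\<close> contributes \<open>k - 1\<close> and the atoms of the operands
  without \<open>x\<close>, beyond what the operands contribute themselves; this does not depend on
  bracketing or order. S and M affect no atoms, hence preserve it too.\<close>

lemma root_step_similar:
  assumes "root_step r F G" shows "similar F G"
  using assms
proof (induction rule: root_step.induct)
  case (N y F x Q)
  then show ?case using free_replace[OF N(2)] splits_left_replace[OF N] splits_left_unused[of y F] 
    unfolding similar_def by auto
next
  case (M x F Q)
  then show ?case unfolding similar_def by (auto simp: splits_left_unused)
next
  case (Pup F G)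
  then show ?case unfolding similar_def by simp
qed (auto simp: similar_def splits_left_unused)

lemma rewrite_similar: "rewrite R F G \<Longrightarrow> similar F G"
proof (induction rule: rewrite.induct)
  case (root r F G)
  then show ?case by (simp add: root_step_similar)
qed (auto simp: similar_def)

definition same_weight :: "('r, 'v) fm \<Rightarrow> ('r, 'v) fm \<Rightarrow> bool" where
  "same_weight F G \<longleftrightarrow> used_weight F = used_weight G \<and> (\<forall>t n. unused_weight t n F = unused_weight t n G)"

lemma root_step_same_weight:
  assumes "root_step r F G" "r \<in> rules_T" shows "same_weight F G"
proof -
  have "r \<noteq> rule_Sdown" "r \<noteq> rule_M" using assms(2) rules_T_not_mem by auto
  with assms(1) show ?thesis
  proof (induction rule: root_step.induct)
    case (N y F x Q)
    then show ?case using free_replace[OF N(2)] splits_left_replace[OF N(1,2)] 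
      used_weight_replace[OF N(1,2)] unused_weight_replace[OF N(1,2)] splits_left_unused
      unfolding same_weight_def by auto
  next
    case (Pup F G)
    then show ?case unfolding same_weight_def by simp
  qed (auto simp: same_weight_def splits_left_unused ac_simps)
qed

lemma rewrite_same_weight: "rewrite rules_T F G \<Longrightarrow> same_weight F G"
proof (induction rule: rewrite.induct)
  case (root r F G)
  then show ?case by (simp add: root_step_same_weight)
next
  case (in_Quant F G Q x)
  then show ?case using rewrite_similar[OF in_Quant(1)] unfolding same_weight_def similar_def by simp
next
  case (in_Bin_left F G b H)
  then show ?case using rewrite_similar[OF in_Bin_left(1)] unfolding same_weight_def similar_def by simp
next
  case (in_Bin_right F G b H)
  then show ?case using rewrite_similar[OF in_Bin_right(1)] unfolding same_weight_def similar_def by simp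
qed (simp add: same_weight_def)

text \<open>The decrease is required for every kind of surrounding block and every admissible atom
  count, since only the context of the step determines them.\<close>

definition lighter :: "('r, 'v) fm \<Rightarrow> ('r, 'v) fm \<Rightarrow> bool" where
  "lighter F G \<longleftrightarrow> used_weight G < used_weight F \<or>
    used_weight G = used_weight F \<and> (\<forall>t n. atoms F \<le> n \<longrightarrow> unused_weight t n G < unused_weight t n F)"

text \<open>If \<open>x\<close> is free on both sides, S removes the summand 1 from
  \<open>splits_left\<close>; if it is free on one side, S removes the atom count of the other. If
  it is free on neither, a weight of at least \<open>2 * (k1 + k2) - 1\<close> becomes
  \<open>(2 * k1 - 1) + (2 * k2 - 1)\<close>, where \<open>k1\<close> and \<open>k2\<close> count
  the atoms of the two sides: the subtracted 1 now occurs twice, which explains the form of the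
  weight. M removes a positive summand.\<close>

lemma root_step_lighter:
  assumes "root_step r F G" "r \<in> {rule_Sdown, rule_M}" shows "lighter F G"
  using assms
proof (induction rule: root_step.induct)
  case (Sdown_Exists x F1 F2)
  show ?case unfolding lighter_def
    by (auto simp: splits_left_unused) (use atoms_pos[of F1] atoms_pos[of F2] in arith)+
next
  case (Sdown_Forall x F1 F2)
  show ?case unfolding lighter_def
    by (auto simp: splits_left_unused) (use atoms_pos[of F1] atoms_pos[of F2] in arith)+
next
  case (M x F Q)
  have "0 < 2 * atoms F - Suc 0" using atoms_pos[of F] by arith
  then show ?case using M unfolding lighter_def by (auto simp: splits_left_unused)
qed auto

lemma rewrite_lighter: "rewrite {rule_Sdown, rule_M} F G \<Longrightarrow> lighter F G"
proof (induction rule: rewrite.induct)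
  case (root r F G)
  then show ?case by (simp add: root_step_lighter)
next
  case (in_Quant F G Q x)
  then show ?case using rewrite_similar[OF in_Quant(1)] unfolding lighter_def similar_def by auto
next
  case (in_Bin_left F G b H)
  then show ?case using rewrite_similar[OF in_Bin_left(1)] unfolding lighter_def similar_def by auto
next
  case (in_Bin_right F G b H)
  then show ?case using rewrite_similar[OF in_Bin_right(1)] unfolding lighter_def similar_def by auto
qed (simp add: lighter_def)

section \<open>Confluence and the quotient system\<close>

lemma free_map [simp]: "free (map_fm f (\<lambda>v. v) F) = free F"
  by (induction F) auto

lemma replace_map: "replace x y (map_fm f (\<lambda>v. v) F) = map_fm f (\<lambda>v. v) (replace x y F)"
  by (induction F) auto

lemma free_for_map [simp]: "free_for y x (map_fm f (\<lambda>v. v) F) \<longleftrightarrow> free_for y x F"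
  by (induction F) auto

lemma map_fm_eq:
  "Bin b G H = map_fm f (\<lambda>v. v) F \<longleftrightarrow> (\<exists>G' H'. F = Bin b G' H' \<and> G = map_fm f (\<lambda>v. v) G' \<and> H = map_fm f (\<lambda>v. v) H')"
  "Quant Q x G = map_fm f (\<lambda>v. v) F \<longleftrightarrow> (\<exists>G'. F = Quant Q x G' \<and> G = map_fm f (\<lambda>v. v) G')"
  "Neg G = map_fm f (\<lambda>v. v) F \<longleftrightarrow> (\<exists>G'. F = Neg G' \<and> G = map_fm f (\<lambda>v. v) G')"
  by (cases F; auto)+

lemma root_step_map: "root_step r F G \<Longrightarrow> root_step r (map_fm f (\<lambda>v. v) F) (map_fm f (\<lambda>v. v) G)"
  by (induction rule: root_step.induct) (auto simp: replace_map[symmetric] intro: root_step.intros)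

lemma rewrite_map: "rewrite R F G \<Longrightarrow> rewrite R (map_fm f (\<lambda>v. v) F) (map_fm f (\<lambda>v. v) G)"
  by (induction rule: rewrite.induct) (auto intro: rewrite.intros root_step_map)

text \<open>No rule inspects relation symbols, and no left-hand side contains the same subformula
  twice, so no equality between annotated parts is ever required.\<close>

lemma root_step_lift:
  assumes "root_step r (map_fm f (\<lambda>v. v) F) G"
  shows "\<exists>G'. G = map_fm f (\<lambda>v. v) G' \<and> root_step r F G'"
proof -
  let ?m = "map_fm f (\<lambda>v. v)"
  have goal: ?thesis if "G = ?m G'" "root_step r F G'" for G' using that by blast
  from assms show ?thesis
  proof cases
    case (A_left b F1 F2 F3)
    then obtain G1 G2 G3 where "F = Bin b G1 (Bin b G2 G3)" "F1 = ?m G1" "F2 = ?m G2" "F3 = ?m G3"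
      using map_fm_eq(1) by metis
    then show ?thesis using A_left goal[of "Bin b (Bin b G1 G2) G3"] by (simp add: root_step.A_left)
  next
    case (A_right b F1 F2 F3)
    then obtain G1 G2 G3 where "F = Bin b (Bin b G1 G2) G3" "F1 = ?m G1" "F2 = ?m G2" "F3 = ?m G3"
      using map_fm_eq(1) by metis
    then show ?thesis using A_right goal[of "Bin b G1 (Bin b G2 G3)"] by (simp add: root_step.A_right)
  next
    case (C b F1 F2)
    then obtain G1 G2 where "F = Bin b G1 G2" "F1 = ?m G1" "F2 = ?m G2"
      using map_fm_eq(1) by metis
    then show ?thesis using C goal[of "Bin b G2 G1"] by (simp add: root_step.C)
  next
    case (O Q x y F1)
    then obtain G1 where "F = Quant Q x (Quant Q y G1)" "F1 = ?m G1"
      using map_fm_eq(2) by metis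
    then show ?thesis using O goal[of "Quant Q y (Quant Q x G1)"] by (simp add: root_step.O)
  next
    case (Pdown_Exists x F2 F1)
    then obtain G1 G2 where "F = Quant Exists x (Bin Conj G1 G2)" "F1 = ?m G1" "F2 = ?m G2"
      using map_fm_eq(1,2) by metis
    then show ?thesis
      using Pdown_Exists goal[of "Bin Conj (Quant Exists x G1) G2"] by (simp add: root_step.Pdown_Exists)
  next
    case (Pdown_Forall x F2 F1)
    then obtain G1 G2 where "F = Quant Forall x (Bin Disj G1 G2)" "F1 = ?m G1" "F2 = ?m G2"
      using map_fm_eq(1,2) by metis
    then show ?thesis
      using Pdown_Forall goal[of "Bin Disj (Quant Forall x G1) G2"] by (simp add: root_step.Pdown_Forall)
  next
    case Pup
    from Pup(2) show ?thesis
    proof cases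
      case (Pdown_Exists x F2 F1)
      then obtain G1 G2 where "F = Bin Conj (Quant Exists x G1) G2" "F1 = ?m G1" "F2 = ?m G2"
        using map_fm_eq(1,2) by metis
      then show ?thesis using Pdown_Exists Pup(1) goal[of "Quant Exists x (Bin Conj G1 G2)"] by (simp add: root_step.Pup[OF root_step.Pdown_Exists])
    next
      case (Pdown_Forall x F2 F1)
      then obtain G1 G2 where "F = Bin Disj (Quant Forall x G1) G2" "F1 = ?m G1" "F2 = ?m G2"
        using map_fm_eq(1,2) by metis
      then show ?thesis using Pdown_Forall Pup(1) goal[of "Quant Forall x (Bin Disj G1 G2)"] by (simp add: root_step.Pup[OF root_step.Pdown_Forall])
    qed
  next
    case (N y F1 x Q)
    then obtain G1 where "F = Quant Q x G1" "F1 = ?m G1" using map_fm_eq(2) by metis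
    then show ?thesis using N goal[of "Quant Q y (replace x y G1)"] by (simp add: replace_map root_step.N)
  next
    case (Sdown_Exists x F1 F2)
    then obtain G1 G2 where "F = Quant Exists x (Bin Disj G1 G2)" "F1 = ?m G1" "F2 = ?m G2"
      using map_fm_eq(1,2) by metis
    then show ?thesis
      using Sdown_Exists goal[of "Bin Disj (Quant Exists x G1) (Quant Exists x G2)"] by (simp add: root_step.Sdown_Exists)
  next
    case (Sdown_Forall x F1 F2)
    then obtain G1 G2 where "F = Quant Forall x (Bin Conj G1 G2)" "F1 = ?m G1" "F2 = ?m G2"
      using map_fm_eq(1,2) by metis
    then show ?thesis
      using Sdown_Forall goal[of "Bin Conj (Quant Forall x G1) (Quant Forall x G2)"] by (simp add: root_step.Sdown_Forall)
  next
    case (M x Q)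
    then obtain G1 where "F = Quant Q x G1" "G = ?m G1" using map_fm_eq(2) by metis
    then show ?thesis using M goal[of G1] by (simp add: root_step.M)
  qed
qed

lemma rewrite_lift:
  assumes "rewrite R (map_fm f (\<lambda>v. v) F) G"
  shows "\<exists>G'. G = map_fm f (\<lambda>v. v) G' \<and> rewrite R F G'"
  using assms
proof (induction "map_fm f (\<lambda>v. v) F" G arbitrary: F rule: rewrite.induct)
  case (root r G)
  then show ?case using root_step_lift rewrite.root by metis
next
  case (in_Neg G H)
  then obtain G' where G: "F = Neg G'" "G = map_fm f (\<lambda>v. v) G'" by (metis map_fm_eq(3))
  with in_Neg(2) obtain H' where "H = map_fm f (\<lambda>v. v) H'" "rewrite R G' H'" by blast
  then show ?case using G by (intro exI[of _ "Neg H'"]) (auto intro: rewrite.intros)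
next
  case (in_Bin_left G H b K)
  then obtain G' K' where G: "F = Bin b G' K'" "G = map_fm f (\<lambda>v. v) G'" "K = map_fm f (\<lambda>v. v) K'" by (metis map_fm_eq(1))
  with in_Bin_left(2) obtain H' where "H = map_fm f (\<lambda>v. v) H'" "rewrite R G' H'" by blast
  then show ?case using G by (intro exI[of _ "Bin b H' K'"]) (auto intro: rewrite.intros)
next
  case (in_Bin_right G H b K)
  then obtain G' K' where G: "F = Bin b K' G'" "G = map_fm f (\<lambda>v. v) G'" "K = map_fm f (\<lambda>v. v) K'" by (metis map_fm_eq(1))
  with in_Bin_right(2) obtain H' where "H = map_fm f (\<lambda>v. v) H'" "rewrite R G' H'" by blast
  then show ?case using G by (intro exI[of _ "Bin b K' H'"]) (auto intro: rewrite.intros)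
next
  case (in_Quant G H Q x)
  then obtain G' where G: "F = Quant Q x G'" "G = map_fm f (\<lambda>v. v) G'" by (metis map_fm_eq(2))
  with in_Quant(2) obtain H' where "H = map_fm f (\<lambda>v. v) H'" "rewrite R G' H'" by blast
  then show ?case using G by (intro exI[of _ "Quant Q x H'"]) (auto intro: rewrite.intros)
qed

lemma rtrancl_map: "(rewrite R)\<^sup>*\<^sup>* F G \<Longrightarrow> (rewrite R)\<^sup>*\<^sup>* (map_fm f (\<lambda>v. v) F) (map_fm f (\<lambda>v. v) G)"
  by (induction rule: rtranclp_induct) (auto intro: rtranclp.rtrancl_into_rtrancl rewrite_map)

lemma rtrancl_lift:
  "(rewrite R)\<^sup>*\<^sup>* (map_fm f (\<lambda>v. v) F) G \<Longrightarrow> \<exists>G'. G = map_fm f (\<lambda>v. v) G' \<and> (rewrite R)\<^sup>*\<^sup>* F G'"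
proof (induction rule: rtranclp_induct)
  case base
  then show ?case by blast
next
  case (step G H)
  then obtain G' where G: "G = map_fm f (\<lambda>v. v) G'" "(rewrite R)\<^sup>*\<^sup>* F G'" by blast
  then obtain H' where "H = map_fm f (\<lambda>v. v) H'" "rewrite R G' H'" using step(2) rewrite_lift by metis
  then show ?case using rtranclp.rtrancl_into_rtrancl[OF G(2)] by blast
qed

text \<open>The atoms are numbered. Starting at an arbitrary \<open>k\<close> lets the second
  operand continue where the first one stopped.\<close>

lemma linear_annotation:
  "\<exists>F' m. map_fm fst (\<lambda>v. v) F' = F \<and> linear F' \<and> snd ` rels F' \<subseteq> {k..<m :: nat}"
proof (induction F arbitrary: k)
  case (Atom R vs)
  show ?case by (intro exI[of _ "Atom (R, k) vs"] exI[of _ "Suc k"]) auto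
next
  case (Neg F)
  then obtain F' m where "map_fm fst (\<lambda>v. v) F' = F" "linear F'" "snd ` rels F' \<subseteq> {k..<m}" by blast
  then show ?case by (intro exI[of _ "Neg F'"] exI[of _ m]) auto
next
  case (Quant Q x F)
  then obtain F' m where "map_fm fst (\<lambda>v. v) F' = F" "linear F'" "snd ` rels F' \<subseteq> {k..<m}" by blast
  then show ?case by (intro exI[of _ "Quant Q x F'"] exI[of _ m]) auto
next
  case (Bin b F G)
  obtain F' m where F: "map_fm fst (\<lambda>v. v) F' = F" "linear F'" "snd ` rels F' \<subseteq> {k..<m}" using Bin(1) by blast
  obtain G' l where G: "map_fm fst (\<lambda>v. v) G' = G" "linear G'" "snd ` rels G' \<subseteq> {m..<l}" using Bin(2) by blast
  have "m > k" using F(3) rels_nonempty[of F'] by fastforce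
  moreover have "l > m" using G(3) rels_nonempty[of G'] by fastforce
  moreover have "rels F' \<inter> rels G' = {}" using F(3) G(3) by fastforce
  ultimately show ?case using F G by (intro exI[of _ "Bin b F' G'"] exI[of _ l]) fastforce
qed

lemma PFO_map: "F \<in> PFO (ar \<circ> f) \<longleftrightarrow> map_fm f (\<lambda>v. v) F \<in> PFO ar"
  by (induction F) (auto simp: PFO_def)

lemma finite_rels: "finite (rels F)"
  by (induction F) auto

lemma ex_inj_avoiding:
  assumes "infinite (UNIV :: 'v set)" "finite A" "finite B"
  shows "\<exists>f :: 'a \<Rightarrow> 'v. inj_on f B \<and> f ` B \<inter> A = {}"
proof -
  have "infinite (UNIV - A)" using assms by (simp add: Diff_infinite_finite)
  then obtain T where T: "finite T" "card T = card B" "T \<subseteq> UNIV - A"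
    using infinite_arbitrarily_large by blast
  then obtain f where "bij_betw f B T" using finite_same_card_bij[OF assms(3) T(1)] by metis
  then show ?thesis using T(3) unfolding bij_betw_def by blast
qed

lemma red_tree_of:
  assumes "F \<leadsto> G" "linear F"
  shows "linear G \<and> rels G = rels F \<and> (\<forall>z. occ z G = occ z F) \<and> tree_of G = tree_of F"
  using assms
proof (induction rule: rtranclp_induct)
  case (step G H)
  then show ?case using rewrite_tree_of[OF step(2)] by auto
qed simp

lemma red_PFO: "F \<leadsto> G \<Longrightarrow> F \<in> PFO ar \<Longrightarrow> G \<in> PFO ar"
  by (induction rule: rtranclp_induct) (auto simp: rewrite_PFO_iff)

text \<open>The naming is computed from \<open>D\<close>, but it refers only to atoms and free
  occurrences, which all reducts of \<open>D\<close> share together with the tree. Hence all of them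
  read back to one and the same formula.\<close>

lemma red_normal_form:
  fixes D :: "('s, 'v::infinite) fm"
  assumes D: "linear D" "D \<in> PFO ar"
  shows "\<exists>N. \<forall>G. D \<leadsto> G \<longrightarrow> G \<leadsto> N"
proof -
  define P where "P = {p. fst p \<in> rels D \<and> snd p < ar (fst p)}"
  have "P = Sigma (rels D) (\<lambda>r. {..<ar r})" unfolding P_def by auto
  then have fP: "finite P" by (simp add: finite_rels)
  \<comment> \<open>A free position receives its variable. A bound one receives a default, which
    \<open>nu\<close> is chosen to avoid like the other names.\<close>
  define \<sigma> where "\<sigma> p = (if \<exists>z. p \<in> occ z D then THE z. p \<in> occ z D else undefined)" for p
  have \<sigma>: "\<sigma> p = z" if p: "p \<in> occ z D" for p z
  proof -
    have "(THE z. p \<in> occ z D) = z"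
    proof (rule the_equality)
      show "u = z" if "p \<in> occ u D" for u using occ_disjoint[OF D(1), of u z] that p by blast
    qed (fact p)
    then show ?thesis using p unfolding \<sigma>_def by auto
  qed
  have "finite (\<sigma> ` P)" "finite (Pow P)" using fP by auto
  then obtain nu :: "('s \<times> nat) set \<Rightarrow> 'v" where nu: "inj_on nu (Pow P)" "nu ` Pow P \<inter> \<sigma> ` P = {}"
    using ex_inj_avoiding[OF infinite_UNIV] by metis
  interpret bound_naming ar nu P by unfold_locales (fact fP, fact nu(1))
  have "G \<leadsto> readback \<sigma> (tree_of D)" if G: "D \<leadsto> G" for G
  proof -
    note r = red_tree_of[OF G D(1)] and p = red_PFO[OF G D(2)]
    have ap: "apos G = P" using r unfolding apos_def P_def by simp
    have "G \<leadsto> readback \<sigma> (tree_of G)"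
    proof (rule red_readback)
      show "linear G" "wf_fm ar G" "neg_free G" using r p unfolding PFO_def by auto
      show "apos G \<subseteq> P" using ap by simp
      show "\<sigma> p = z" if "p \<in> occ z G" for z p using \<sigma> r that by simp
      show "\<sigma> p \<notin> nu ` Pow P" if "p \<in> apos G" for p using nu(2) that unfolding ap by blast
      show "infinite (UNIV :: 'v set)" by (rule infinite_UNIV)
    qed
    then show ?thesis using r by simp
  qed
  then show ?thesis by blast
qed

text \<open>Both reductions lift to an annotated copy of \<open>F\<close>, where all reducts have a
  common one; erasing the annotation brings it back.\<close>

lemma red_confluent:
  fixes F :: "('r, 'v::infinite) fm"
  assumes "F \<in> PFO ar" "F \<leadsto> G" "F \<leadsto> H"
  shows "\<exists>N. G \<leadsto> N \<and> H \<leadsto> N"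
proof -
  obtain D :: "('r \<times> nat, 'v) fm" where D: "map_fm fst (\<lambda>v. v) D = F" "linear D"
    using linear_annotation[of F 0] by blast
  have "D \<in> PFO (ar \<circ> fst)" using assms(1) D(1) PFO_map[of D ar fst] by simp
  from red_normal_form[OF D(2) this] obtain N where N: "\<And>G. D \<leadsto> G \<Longrightarrow> G \<leadsto> N" by blast
  have "K \<leadsto> map_fm fst (\<lambda>v. v) N" if K: "F \<leadsto> K" for K
  proof -
    obtain K' where "K = map_fm fst (\<lambda>v. v) K'" "D \<leadsto> K'" using rtrancl_lift[of _ fst D K] K D(1) by blast
    then show ?thesis using rtrancl_map[OF N] by blast
  qed
  then show ?thesis using assms(2,3) by blast
qed

section \<open>Passage to the quotient\<close>

lemma PFO_equiv_iff: "(F, G) \<in> PFO_equiv ar rules_T \<longleftrightarrow> F \<in> PFO ar \<and> F \<approx> G"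
proof
  assume a: "(F, G) \<in> PFO_equiv ar rules_T"
  then have "(F, G) \<in> (PFO_rel ar rules_T \<union> (PFO_rel ar rules_T)\<inverse>)\<^sup>*" unfolding PFO_equiv_def by blast
  then have "F \<approx> G"
    by (induction rule: rtrancl_induct)
      (auto simp: PFO_rel_def intro: rtranclp.rtrancl_into_rtrancl rewrite_T_sym)
  then show "F \<in> PFO ar \<and> F \<approx> G" using a unfolding PFO_equiv_def by blast
next
  assume a: "F \<in> PFO ar \<and> F \<approx> G"
  then have "F \<approx> G" by blast
  then have "(F, G) \<in> (PFO_rel ar rules_T \<union> (PFO_rel ar rules_T)\<inverse>)\<^sup>* \<and> G \<in> PFO ar"
  proof (induction rule: rtranclp_induct)
    case (step G H)
    then have "(G, H) \<in> PFO_rel ar rules_T" unfolding PFO_rel_def using rewrite_PFO_iff by blast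
    then show ?case using step rewrite_PFO_iff by (auto intro: rtrancl_into_rtrancl)
  qed (use a in auto)
  then show "(F, G) \<in> PFO_equiv ar rules_T" using a unfolding PFO_equiv_def by blast
qed

definition quot_step :: "('r \<Rightarrow> nat) \<Rightarrow> (('r, 'v) fm set \<times> ('r, 'v) fm set) set" where
  "quot_step ar = snd (quotient_system (PFO_system ar {rule_Sdown, rule_M}) (PFO_equiv ar rules_T))"

abbreviation classes :: "('r \<Rightarrow> nat) \<Rightarrow> ('r, 'v) fm set set" where
  "classes ar \<equiv> PFO ar // PFO_equiv ar rules_T"

lemma quotient_system_eq:
  "quotient_system (PFO_system ar {rule_Sdown, rule_M}) (PFO_equiv ar rules_T) = (classes ar, quot_step ar)"
  unfolding quot_step_def quotient_system_def PFO_system_def by simp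

lemma quot_stepI:
  assumes "c \<in> PFO ar" "c' \<in> PFO ar" "rewrite {rule_Sdown, rule_M} c c'"
  shows "(PFO_equiv ar rules_T `` {c}, PFO_equiv ar rules_T `` {c'}) \<in> quot_step ar"
proof -
  have "(c, c') \<in> PFO_rel ar {rule_Sdown, rule_M}" using assms unfolding PFO_rel_def by simp
  moreover have "c \<in> PFO_equiv ar rules_T `` {c}" "c' \<in> PFO_equiv ar rules_T `` {c'}"
    using equiv_class_self[OF equiv_PFO_equiv] assms(1,2) by auto
  ultimately have "\<exists>a\<in>PFO_equiv ar rules_T `` {c}. \<exists>a'\<in>PFO_equiv ar rules_T `` {c'}.
    (a, a') \<in> PFO_rel ar {rule_Sdown, rule_M}" by (intro bexI)
  then show ?thesis unfolding quot_step_def quotient_system_def PFO_system_def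
    using quotientI[OF assms(1)] quotientI[OF assms(2)] by simp
qed

lemma quot_stepE:
  assumes "(C, C') \<in> quot_step ar"
  obtains c c' where "C \<in> classes ar" "C' \<in> classes ar" "c \<in> C" "c' \<in> C'" "rewrite {rule_Sdown, rule_M} c c'"
  using assms unfolding quot_step_def quotient_system_def PFO_system_def PFO_rel_def by auto

lemma classes_eqT: "C \<in> classes ar \<Longrightarrow> c \<in> C \<Longrightarrow> c' \<in> C \<Longrightarrow> c \<approx> c'"
  using in_quotient_imp_in_rel[OF equiv_PFO_equiv, of C ar rules_T c c'] PFO_equiv_iff by blast

text \<open>Changing the representative of a class is a T-reduction, and T belongs to the rules of
  \<open>\<leadsto>\<close>. Chains of classes thus yield reductions between arbitrary
  representatives, and \<open>red_quot_step\<close> gives the way back.\<close>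

lemma quot_step_red:
  assumes "(C, C') \<in> (quot_step ar)\<^sup>*" "C \<in> classes ar" "c \<in> C" "c' \<in> C'"
  shows "c \<leadsto> c'"
  using assms(1,4)
proof (induction arbitrary: c' rule: rtrancl_induct)
  case base
  then show ?case using classes_eqT[OF assms(2,3)] eqT_red by blast
next
  case (step B C')
  obtain d d' where d: "B \<in> classes ar" "C' \<in> classes ar" "d \<in> B" "d' \<in> C'" "rewrite {rule_Sdown, rule_M} d d'"
    using quot_stepE[OF step(2)] by blast
  have "c \<leadsto> d" using step(3) d(3) by blast
  moreover have "d \<leadsto> d'" using rewrite_mono[OF d(5)] by (intro r_into_rtranclp) blast
  moreover have "d' \<leadsto> c'" using classes_eqT[OF d(2,4) step(4)] eqT_red by blast
  ultimately show ?case by (metis rtranclp_trans)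
qed

lemma red_quot_step:
  assumes "c \<leadsto> c'" "c \<in> PFO ar"
  shows "(PFO_equiv ar rules_T `` {c}, PFO_equiv ar rules_T `` {c'}) \<in> (quot_step ar)\<^sup>*"
  using assms
proof (induction rule: rtranclp_induct)
  case (step d e)
  have P: "d \<in> PFO ar" "e \<in> PFO ar" using red_PFO[OF step(1)] step rewrite_PFO_iff by blast+
  consider "rewrite rules_T d e" | "rewrite {rule_Sdown, rule_M} d e" using rewrite_Un[OF step(2)] by blast
  then show ?case
  proof cases
    case 1
    then have "(d, e) \<in> PFO_equiv ar rules_T" using PFO_equiv_iff P by blast
    then have "PFO_equiv ar rules_T `` {d} = PFO_equiv ar rules_T `` {e}"
      by (rule equiv_class_eq[OF equiv_PFO_equiv])
    then show ?thesis using step by simp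
  next
    case 2
    have "(PFO_equiv ar rules_T `` {c}, PFO_equiv ar rules_T `` {d}) \<in> (quot_step ar)\<^sup>*"
      using step by blast
    then show ?thesis using quot_stepI[OF P 2] by (rule rtrancl_into_rtrancl)
  qed
qed simp

lemma quot_confluent:
  "confluent_system (classes ar :: ('r, 'v::infinite) fm set set, quot_step ar)"
  unfolding confluent_system_def
proof (clarify)
  fix D G H :: "('r, 'v) fm set"
  assume D: "D \<in> classes ar" and G: "G \<in> classes ar" and H: "H \<in> classes ar"
    and DG: "(D, G) \<in> (quot_step ar)\<^sup>*" and DH: "(D, H) \<in> (quot_step ar)\<^sup>*"
  obtain d where d: "D = PFO_equiv ar rules_T `` {d}" "d \<in> PFO ar" using D by (rule quotientE)
  obtain g where g: "G = PFO_equiv ar rules_T `` {g}" "g \<in> PFO ar" using G by (rule quotientE)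
  obtain h where h: "H = PFO_equiv ar rules_T `` {h}" "h \<in> PFO ar" using H by (rule quotientE)
  note self = equiv_class_self[OF equiv_PFO_equiv]
  have "d \<leadsto> g" using quot_step_red[OF DG D] d g self by blast
  moreover have "d \<leadsto> h" using quot_step_red[OF DH D] d h self by blast
  ultimately obtain f where f: "g \<leadsto> f" "h \<leadsto> f" using red_confluent[OF d(2)] by blast
  have "PFO_equiv ar rules_T `` {f} \<in> classes ar" using red_PFO[OF f(1) g(2)] by (rule quotientI)
  then show "\<exists>F\<in>classes ar. (G, F) \<in> (quot_step ar)\<^sup>* \<and> (H, F) \<in> (quot_step ar)\<^sup>*"
    using red_quot_step[OF f(1) g(2)] red_quot_step[OF f(2) h(2)] g(1) h(1) by blast
qed

text \<open>At the root the current block contains all atoms; its assumed kind then makes no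
  difference, so \<open>Conj\<close> is an arbitrary choice.\<close>

definition weight :: "('r, 'v) fm \<Rightarrow> nat \<times> nat" where
  "weight F = (used_weight F, unused_weight Conj (atoms F) F)"

lemma weight_eqT: "F \<approx> G \<Longrightarrow> weight F = weight G"
proof (induction rule: rtranclp_induct)
  case (step G H)
  then show ?case using rewrite_similar[OF step(2)] rewrite_same_weight[OF step(2)]
    unfolding weight_def similar_def same_weight_def by simp
qed simp

lemma weight_decreases: "rewrite {rule_Sdown, rule_M} F G \<Longrightarrow> (weight G, weight F) \<in> less_than <*lex*> less_than"
  using rewrite_similar[of _ F G] rewrite_lighter[of F G] unfolding weight_def similar_def lighter_def by auto

lemma quot_terminating: "terminating_system (classes ar, quot_step ar)"
  unfolding terminating_system_def
proof clarify
  fix C :: "nat \<Rightarrow> ('a, 'b) fm set"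
  assume C: "\<forall>i. C i \<in> classes ar \<and> (C i, C (Suc i)) \<in> quot_step ar"
  \<comment> \<open>The weight is constant on each class, so the chosen representative may be
    exchanged for the one at which a step starts or ends.\<close>
  define w where "w i = weight (SOME c. c \<in> C i)" for i
  have w: "w i = weight c" if "c \<in> C i" for i c
    unfolding w_def using C that by (intro weight_eqT classes_eqT[of "C i" ar]) (auto intro: someI)
  have "(w (Suc i), w i) \<in> less_than <*lex*> less_than" for i
  proof -
    obtain c c' where "c \<in> C i" "c' \<in> C (Suc i)" "rewrite {rule_Sdown, rule_M} c c'"
      using C quot_stepE by metis
    then show ?thesis using weight_decreases w by metis
  qed
  then show False using wf_iff_no_infinite_down_chain[of "less_than <*lex*> less_than"] by blast
qed

theorem theorem4p4:
  fixes ar :: "'r \<Rightarrow> nat"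
  shows "convergent_system
    (quotient_system
      (PFO_system ar {rule_Sdown, rule_M} :: ('r, 'v::infinite) fm system)
      (PFO_equiv ar rules_T))"
  unfolding convergent_system_def quotient_system_eq
  using quot_confluent quot_terminating by blast

end
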